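(* Let $\nu$ be a Borel probability measure on $\mathbb{R}^d$ whose support lies in the interior of $[0,1]^d$, and assume that there are $a>0$ and $C\ge1$ with $\nu(Q)\le C2^{-ak}$ for all $Q\in\mathcal D_k$, $k\ge0$. Let $0<t<1$ and put $a_t=\log(1/t)/K(t)$ with $K(t)=1+\frac{\log(1/t)+\log C}{a}$, so that $a_t\to a$ as $t\downarrow0$. (1) $a_t\le\varsigma_t\le\log(1/t)$, and $\nu\{\varsigma_t\ge v\}\le t^{1-d/v}$ for $v>d$. Consequently $\int((\varsigma_t-d)^+)^n\,d\nu\to0$ as $t\downarrow0$ for every $n\ge1$, all moments of $\varsigma_t$ are bounded for $t\le1/2$, and $$\mathsf D_\nu(t)=\Bigl(\int\varsigma_t^{-1}\,d\nu\Bigr)^{-1}\le\mathsf h_\nu(t),\qquad a_t\le\mathsf D_\nu(t),\qquad \mathsf h_\nu(t)\le d+o(1).$$ (2) One has the exact representations $$\mathsf h_\nu(t)-\mathsf D_\nu(t)=\int\frac{(\varsigma_t-\mathsf D_\nu(t))^2}{\varsigma_t}\,d\nu=\frac{\mathsf D_\nu(t)}{\mathsf h_\nu(t)}\int\frac{(\varsigma_t-\mathsf h_\nu(t))^2}{\varsigma_t}\,d\nu,$$ and $$\frac{\mathsf D_\nu(t)}{\mathsf h_\nu(t)}\Bigl(\frac{\mathsf V_\nu(t)}{d}-\varepsilon_t\Bigr)\le\mathsf h_\nu(t)-\mathsf D_\nu(t)\le\frac{\mathsf D_\nu(t)}{\mathsf h_\nu(t)}\cdot\frac{\mathsf V_\nu(t)}{a_t},$$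 where $\varepsilon_t=d^{-2}\int(\varsigma_t-\mathsf h_\nu(t))^2(\varsigma_t-d)^+\,d\nu\to0$ as $t\downarrow0$. In particular $\overline{\mathsf V}(\nu)=0$ if and only if $\mathsf h_\nu(t)-\mathsf D_\nu(t)\to0$ as $t\downarrow0$. (3) If $\overline{\mathsf V}(\nu)=0$, then $\beta_k''(1)=o(k)$ as $k\to\infty$ and $$\underline h(\nu)=\liminf_{t\downarrow0}\mathsf h_\nu(t)=\underline D_0(\nu),\qquad \overline h(\nu)=\limsup_{t\downarrow0}\mathsf h_\nu(t)=\overline D_0(\nu).$$ (4) If the laws of $X_k$ under $\nu$ converge weakly to a probability measure $\varrho$ as $k\to\infty$, then the laws of $\varsigma_t$ under $\nu$ converge weakly to $\varrho$ as $t\downarrow0$, and $$\mathsf h_\nu(t)\to\int y\,d\varrho(y)=h(\nu),\qquad \mathsf D_\nu(t)\to\Bigl(\int\frac1y\,d\varrho(y)\Bigr)^{-1}=D_0(\nu),$$ $$\mathsf V_\nu(t)\to\operatorname{Var}(\varrho)=\overline{\mathsf V}(\nu)=\lim_{k\to\infty}\frac{\beta_k''(1)}{k\ln2}.$$ In this case the conditions $\overline{\mathsf V}(\nu)=0$, $\beta_k''(1)=o(k)$ and $h(\nu)=D_0(\nu)$ are equivalent, and in the limit $t\downarrow0$ the representations in (2) become $$h(\nu)-D_0(\nu)=\int\frac{(y-D_0(\nu))^2}{y}\,d\varrho(y)=\frac{D_0(\nu)}{h(\nu)}\int\frac{(y-h(\nu))^2}{y}\,d\varrho(y).$$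
   Context: $\log$ is the logarithm to base 2 and $\ln$ the natural logarithm; $\mathbb{R}^d$ carries the maximum norm. $\mathcal D_k$ is the partition of the root cube $[0,1]^d$ into $2^{dk}$ dyadic cubes of side length $2^{-k}$ (half-open cubes, with the outer boundary faces of $[0,1]^d$ assigned to the adjacent end cubes, so that the partitions are disjoint and nested, $\mathcal D_0=\{[0,1]^d\}$). $Q_k(x)$ is the cube of $\mathcal D_k$ containing $x$. The null set of $x$ for which some $Q_k(x)$ has zero mass is discarded. Local information rates: $X_k(x)=-\frac1k\log\nu(Q_k(x))$, $k\ge1$. Stopping time: $\tau_t(x)=\min\{k\ge1:\nu(Q_k(x))<t\}$ for $0<t<1$; mean depth $\mathcal L_\nu(t)=\int\tau_t\,d\nu$; dimension estimate $\varsigma_t(x)=\log(1/t)/\tau_t(x)$. Further $$\mathsf h_\nu(t)=\int\varsigma_t\,d\nu,\quad \mathsf D_\nu(t)=\frac{\log(1/t)}{\mathcal L_\nu(t)},\quad \mathsf V_\nu(t)=\operatorname{Var}_\nu(\varsigma_t),\quad \overline{\mathsf V}(\nu)=\limsup_{t\downarrow0}\mathsf V_\nu(t).$$ $\beta_k(q)=\frac1k\log\sum_{Q\in\mathcal D_k,\nu(Q)>0}\nu(Q)^q$ for $q\in\mathbb{R}$. Entropy: $h_k(\nu)=-\frac1k\sum_{Q\in\mathcal D_k}\nu(Q)\log\nu(Q)$, $\underline h(\nu)=\liminf_k h_k(\nu)$, $\overline h(\nu)=\limsup_k h_k(\nu)$, $h(\nu)$ the common value when equal. Quantization: $\mathfrak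 e_{N,0}(\nu)=\inf_{1\le\#A\le N}\exp\bigl(\int\ln d(x,A)\,d\nu(x)\bigr)$, infimum over non-empty finite $A\subset\mathbb{R}^d$, $d(x,A)=\inf_{y\in A}\|x-y\|_\infty$; $\underline D_0(\nu)$ and $\overline D_0(\nu)$ are the lower and upper limits of $\frac{\log N}{-\log\mathfrak e_{N,0}(\nu)}$ as $N\to\infty$, $D_0(\nu)$ the common value when equal. *)

theory Defs
  imports "HOL-Probability.Probability" "HOL-Library.Landau_Symbols"
begin

text \<open>The ambient space is \<open>real ^ 'n\<close>, so the dimension \<open>d\<close> is \<open>CARD('n)\<close>; the maximum norm
  is the library's \<open>infnorm\<close>.\<close>

definition msupport :: "'a::topological_space measure \<Rightarrow> 'a set" where
  "msupport \<nu> = {x. \<forall>U. open U \<longrightarrow> x \<in> U \<longrightarrow> emeasure \<nu> U > 0}"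

definition mvar :: "'a measure \<Rightarrow> ('a \<Rightarrow> real) \<Rightarrow> real" where
  "mvar M f = (\<integral>x. (f x - (\<integral>y. f y \<partial>M))\<^sup>2 \<partial>M)"

text \<open>Weak convergence along an arbitrary filter. This is the library's \<open>weak_conv_m\<close>
  (convergence of distribution functions at continuity points of the limit) with
  \<open>sequentially\<close> replaced by \<open>F\<close>; it is needed for the limit \<open>t \<down> 0\<close>.\<close>

definition weak_conv_along :: "'i filter \<Rightarrow> ('i \<Rightarrow> real measure) \<Rightarrow> real measure \<Rightarrow> bool" where
  "weak_conv_along F M L \<longleftrightarrow>
     (\<forall>x. isCont (cdf L) x \<longrightarrow> ((\<lambda>i. cdf (M i) x) \<longlongrightarrow> cdf L x) F)"

lemma weak_conv_along_sequentially: "weak_conv_along sequentially M L \<longleftrightarrow> weak_conv_m M L"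
  by (simp add: weak_conv_along_def weak_conv_m_def weak_conv_def)

text \<open>Intervals are closed on the left and open on the right, except that the last one
  (\<open>j + 1 = 2 ^ k\<close>) also contains its right end point 1.\<close>

definition dyadic_interval :: "nat \<Rightarrow> nat \<Rightarrow> real set" where
  "dyadic_interval k j =
     (if j + 1 < 2 ^ k then {real j / 2 ^ k ..< (real j + 1) / 2 ^ k}
      else {real j / 2 ^ k .. (real j + 1) / 2 ^ k})"

definition dyadic_cubes :: "nat \<Rightarrow> (real ^ 'n) set set" where
  "dyadic_cubes k =
     {{x. \<forall>i. x $ i \<in> dyadic_interval k (z i)} | z :: 'n \<Rightarrow> nat. \<forall>i. z i < 2 ^ k}"

text \<open>The union has exactly one member if \<open>x\<close> is in the unit cube, and is empty otherwise.\<close>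

definition cube_at :: "nat \<Rightarrow> real ^ 'n \<Rightarrow> (real ^ 'n) set" where
  "cube_at k x = \<Union>{Q \<in> dyadic_cubes k. x \<in> Q}"

text \<open>The points that remain after discarding those for which some cube has zero mass.\<close>

definition good_points :: "(real ^ 'n) measure \<Rightarrow> (real ^ 'n) set" where
  "good_points \<nu> = {x \<in> cbox 0 1. \<forall>k. measure \<nu> (cube_at k x) > 0}"

definition info_rate :: "(real ^ 'n) measure \<Rightarrow> nat \<Rightarrow> real ^ 'n \<Rightarrow> real" where
  "info_rate \<nu> k x = - (1 / real k) * log 2 (measure \<nu> (cube_at k x))"

definition stop_time :: "(real ^ 'n) measure \<Rightarrow> real \<Rightarrow> real ^ 'n \<Rightarrow> nat" where
  "stop_time \<nu> t x = (LEAST k. k \<ge> 1 \<and> measure \<nu> (cube_at k x) < t)"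

definition mean_depth :: "(real ^ 'n) measure \<Rightarrow> real \<Rightarrow> real" where
  "mean_depth \<nu> t = (\<integral>x. real (stop_time \<nu> t x) \<partial>\<nu>)"

definition dim_est :: "(real ^ 'n) measure \<Rightarrow> real \<Rightarrow> real ^ 'n \<Rightarrow> real" where
  "dim_est \<nu> t x = log 2 (1 / t) / real (stop_time \<nu> t x)"

definition h_est :: "(real ^ 'n) measure \<Rightarrow> real \<Rightarrow> real" where
  "h_est \<nu> t = (\<integral>x. dim_est \<nu> t x \<partial>\<nu>)"

definition D_est :: "(real ^ 'n) measure \<Rightarrow> real \<Rightarrow> real" where
  "D_est \<nu> t = log 2 (1 / t) / mean_depth \<nu> t"

definition V_est :: "(real ^ 'n) measure \<Rightarrow> real \<Rightarrow> real" where
  "V_est \<nu> t = mvar \<nu> (dim_est \<nu> t)"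

definition V_upper :: "(real ^ 'n) measure \<Rightarrow> ereal" where
  "V_upper \<nu> = Limsup (at_right 0) (\<lambda>t. ereal (V_est \<nu> t))"

definition depth_bound :: "real \<Rightarrow> real \<Rightarrow> real \<Rightarrow> real" where
  "depth_bound a C t = 1 + (log 2 (1 / t) + log 2 C) / a"

definition rate_bound :: "real \<Rightarrow> real \<Rightarrow> real \<Rightarrow> real" where
  "rate_bound a C t = log 2 (1 / t) / depth_bound a C t"

definition eps_est :: "(real ^ 'n) measure \<Rightarrow> real \<Rightarrow> real" where
  "eps_est \<nu> t = (1 / (real CARD('n))\<^sup>2) *
     (\<integral>x. (dim_est \<nu> t x - h_est \<nu> t)\<^sup>2 * max (dim_est \<nu> t x - real CARD('n)) 0 \<partial>\<nu>)"

definition beta :: "(real ^ 'n) measure \<Rightarrow> nat \<Rightarrow> real \<Rightarrow> real" where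
  "beta \<nu> k q =
     (1 / real k) * log 2 (\<Sum>Q \<in> {Q \<in> dyadic_cubes k. measure \<nu> Q > 0}. measure \<nu> Q powr q)"

definition beta_dd1 :: "(real ^ 'n) measure \<Rightarrow> nat \<Rightarrow> real" where
  "beta_dd1 \<nu> k = (deriv ^^ 2) (beta \<nu> k) 1"

definition entropy_level :: "(real ^ 'n) measure \<Rightarrow> nat \<Rightarrow> real" where
  "entropy_level \<nu> k = - (1 / real k) * (\<Sum>Q \<in> dyadic_cubes k. measure \<nu> Q * log 2 (measure \<nu> Q))"

definition h_lower :: "(real ^ 'n) measure \<Rightarrow> ereal" where
  "h_lower \<nu> = liminf (\<lambda>k. ereal (entropy_level \<nu> k))"

definition h_upper :: "(real ^ 'n) measure \<Rightarrow> ereal" where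
  "h_upper \<nu> = limsup (\<lambda>k. ereal (entropy_level \<nu> k))"

text \<open>The common value; the description is meaningful only when lower and upper limit agree
  and are finite. Every use must therefore come with that agreement.\<close>

definition h_dim :: "(real ^ 'n) measure \<Rightarrow> real" where
  "h_dim \<nu> = (THE v. h_lower \<nu> = ereal v \<and> h_upper \<nu> = ereal v)"

definition max_dist :: "real ^ 'n \<Rightarrow> (real ^ 'n) set \<Rightarrow> real" where
  "max_dist x A = (INF y\<in>A. infnorm (x - y))"

text \<open>This reading of \<open>\<integral>ln d(x,A) d\<nu>(x)\<close> as a Bochner integral presupposes that \<open>ln d(\<cdot>,A)\<close> is
  integrable. For compactly supported probability measures with \<open>\<nu>(Q) \<le> C 2\<^bsup>-ak\<^esup>\<close> on dyadic cubes
  this holds for all non-empty finite \<open>A\<close>, and \<open>A\<close>, where the library's convention \<open>ln 0 = 0\<close>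
  would matter, is a null set.\<close>

definition quant_err :: "(real ^ 'n) measure \<Rightarrow> nat \<Rightarrow> real" where
  "quant_err \<nu> N =
     (INF A \<in> {A. finite A \<and> 1 \<le> card A \<and> card A \<le> N}. exp (\<integral>x. ln (max_dist x A) \<partial>\<nu>))"

definition D0_lower :: "(real ^ 'n) measure \<Rightarrow> ereal" where
  "D0_lower \<nu> = liminf (\<lambda>N. ereal (log 2 (real N) / (- log 2 (quant_err \<nu> N))))"

definition D0_upper :: "(real ^ 'n) measure \<Rightarrow> ereal" where
  "D0_upper \<nu> = limsup (\<lambda>N. ereal (log 2 (real N) / (- log 2 (quant_err \<nu> N))))"

definition D0_dim :: "(real ^ 'n) measure \<Rightarrow> real" where
  "D0_dim \<nu> = (THE v. D0_lower \<nu> = ereal v \<and> D0_upper \<nu> = ereal v)"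

end

theory Submission
  imports Defs "HOL-Real_Asymp.Real_Asymp"
begin

text \<open>Stopping times and information rates are dual: \<open>\<tau>\<^sub>t(x) \<le> k\<close> holds iff \<open>\<nu>(Q\<^sub>k(x)) < t\<close>, that is,
  iff the information rate at level \<open>k\<close> exceeds \<open>log(1/t)/k\<close>. Counting the \<open>2\<^bsup>dk\<^esup>\<close> cubes of level \<open>k\<close>
  bounds the total mass of light cubes and yields the tail bound, hence all moment estimates;
  part (2) is then algebra.

  If the variance of \<open>\<varsigma>\<^sub>t\<close> vanishes, the information rates concentrate as well: over \<open>m\<close> levels the
  mass of the cube around most points drops by a factor of order at most \<open>2\<^bsup>dm\<^esup>\<close>, so if the rates
  were spread to both sides of \<open>[v, v + \<epsilon>]\<close> at level \<open>k\<close>, the stopping time at \<open>t = 2\<^bsup>-kv\<^esup>\<close> would be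
  spread too. Entropies and means of \<open>\<varsigma>\<^sub>t\<close> are then compared by duality at thresholds slightly above
  or below the mean.

  For the quantization dimensions, the centres of the cubes of mass at least \<open>t\<close> give
  \<open>-log e \<ge> \<integral>\<tau>\<^sub>t d\<nu>\<close> with about \<open>1/t\<close> points. Conversely, the points that are \<open>2\<^bsup>-m\<^esup>\<close>-close to a given
  set of \<open>N\<close> points and lie in a level \<open>m\<close> cube of mass less than \<open>t\<close> have total mass at most
  \<open>3\<^bsup>d\<^esup>N min(t, C 2\<^bsup>-am\<^esup>)\<close>; summing over \<open>m\<close> gives \<open>-log e \<le> \<integral>\<tau>\<^sub>t d\<nu> + O(N t log(1/t))\<close>.\<close>

text \<open>Vanishing variance only says that, for each \<open>t\<close>, the estimate sits near its
  own mean \<open>h t\<close>, and this mean may wander with \<open>t\<close>. The law of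
  \<open>info_rate \<nu> k\<close> involves all thresholds \<open>t = 2 powr (- k v)\<close> at
  once, each with its own mean. Concentration is therefore shown without naming a centre: for every
  \<open>v\<close> of a finite grid, nearly all mass lies above \<open>v\<close> or nearly none
  above \<open>v + \<epsilon>\<close>, and the first grid point where the former fails is the
  centre.

  In the quantization estimates, few points relative to \<open>1 / t\<close> are needed for one
  bound and more than \<open>1 / t\<close> for the other. Logarithmic corrections provide both while
  keeping \<open>log N\<close> asymptotic to \<open>log (1 / t)\<close>, which is all that the
  quotients see.

  Outside the unit cube \<open>cube_at\<close> is empty, masses vanish and the stopping time is 1,
  so its bounds hold at every point. The information rate, however, is 0 on cubes of mass 0 because
  \<open>ln 0 = 0\<close>, so its duality with the stopping time holds only almost
  everywhere.\<close>

section \<open>Dyadic cells, their integer indices and the nesting of levels\<close>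

definition cell :: "nat \<Rightarrow> ('n \<Rightarrow> nat) \<Rightarrow> (real ^ 'n) set" where
  "cell k z = {x. \<forall>i. x $ i \<in> dyadic_interval k (z i)}"

definition indices :: "nat \<Rightarrow> ('n::finite \<Rightarrow> nat) set" where
  "indices k = {z. \<forall>i. z i < 2 ^ k}"

text \<open>Within the unit cube the cap \<open>2 ^ k - 1\<close> matters only for a coordinate
  equal to 1, where the floor is \<open>2 ^ k\<close> although the point belongs to the last
  interval. It also keeps the index of an arbitrary point in range.\<close>

definition cell_index :: "nat \<Rightarrow> real ^ 'n \<Rightarrow> 'n \<Rightarrow> nat" where
  "cell_index k x = (\<lambda>i. min (nat \<lfloor>x $ i * 2 ^ k\<rfloor>) (2 ^ k - 1))"

lemma dyadic_interval_subset: "j < 2 ^ k \<Longrightarrow> dyadic_interval k j \<subseteq> {0..1}"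
proof
  fix u assume j: "j < 2 ^ k" and u: "u \<in> dyadic_interval k j"
  then have "real (j + 1) \<le> real (2 ^ k)" by (simp only: of_nat_le_iff)
  then have "(real j + 1) / 2 ^ k \<le> 1" by (simp add: field_simps)
  moreover have "0 \<le> real j / 2 ^ k" by simp
  moreover have "real j / 2 ^ k \<le> u" "u \<le> (real j + 1) / 2 ^ k"
    using u by (auto simp: dyadic_interval_def split: if_splits)
  ultimately show "u \<in> {0..1}" unfolding atLeastAtMost_iff by linarith
qed

lemma mem_dyadic_interval_iff:
  assumes "0 \<le> u" "u \<le> 1" "j < 2 ^ k"
  shows "u \<in> dyadic_interval k j \<longleftrightarrow> j = min (nat \<lfloor>u * 2 ^ k\<rfloor>) (2 ^ k - 1)"
proof -
  have fl: "0 \<le> \<lfloor>u * 2 ^ k\<rfloor>" using assms(1) by simp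
  have ge: "j \<le> nat \<lfloor>u * 2 ^ k\<rfloor> \<longleftrightarrow> real j \<le> u * 2 ^ k"
    using fl by (simp add: le_nat_iff le_floor_iff)
  have n: "nat \<lfloor>u * 2 ^ k\<rfloor> = j \<longleftrightarrow> real j \<le> u * 2 ^ k \<and> u * 2 ^ k < real j + 1"
    using fl floor_eq_iff[of "u * 2 ^ k" "int j"] by auto
  show ?thesis
  proof (cases "j + 1 < 2 ^ k")
    case True
    then have "j = min (nat \<lfloor>u * 2 ^ k\<rfloor>) (2 ^ k - 1) \<longleftrightarrow> nat \<lfloor>u * 2 ^ k\<rfloor> = j"
      by linarith
    with n True show ?thesis
      by (simp add: dyadic_interval_def field_simps)
  next
    case False
    with assms have j: "j = 2 ^ k - 1" by linarith
    then have rj: "real j + 1 = 2 ^ k" by (simp add: of_nat_diff)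
    \<comment> \<open>In the last interval the upper bound is automatic from
      \<open>u \<le> 1\<close>, so membership is the single inequality that the capped floor
      expresses.\<close>
    have le: "u * 2 ^ k \<le> 2 ^ k" using assms by simp
    note ge
    moreover have "u \<in> dyadic_interval k j \<longleftrightarrow> real j \<le> u * 2 ^ k"
      using False le rj by (simp add: dyadic_interval_def field_simps)
    ultimately show ?thesis using j by linarith
  qed
qed

lemma mem_cell_iff:
  fixes x :: "real ^ 'n"
  assumes "x \<in> cbox 0 1" "z \<in> indices k"
  shows "x \<in> cell k z \<longleftrightarrow> z = cell_index k x"
proof -
  have "x $ i \<in> dyadic_interval k (z i) \<longleftrightarrow> z i = cell_index k x i" for i
    using assms unfolding cell_index_def
    by (intro mem_dyadic_interval_iff) (auto simp: mem_box_cart indices_def)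
  then show ?thesis by (auto simp: cell_def)
qed

lemma cell_subset: "z \<in> indices k \<Longrightarrow> cell k z \<subseteq> cbox (0 :: real ^ 'n) 1"
  using dyadic_interval_subset by (fastforce simp: cell_def indices_def mem_box_cart)

lemma cell_index_in [simp]: "cell_index k x \<in> indices k"
proof -
  have "min a (2 ^ k - 1) < 2 ^ k" for a :: nat
    by (rule le_less_trans[OF min.cobounded2]) simp
  then show ?thesis by (simp add: cell_index_def indices_def)
qed

lemma mem_cell_index: "x \<in> cbox 0 1 \<Longrightarrow> x \<in> cell k (cell_index k x)"
  by (simp add: mem_cell_iff)

lemma cell_nonempty:
  assumes "z \<in> indices k"
  shows "(\<chi> i. real (z i) / 2 ^ k) \<in> cell k z"
  by (auto simp: cell_def dyadic_interval_def divide_strict_right_mono divide_right_mono)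

text \<open>Every cell has a point, and that point determines the index. Injectivity lets sums over
  the set of cubes be written as sums over indices.\<close>

lemma inj_on_cell: "inj_on (cell k) (indices k :: ('n::finite \<Rightarrow> nat) set)"
proof (rule inj_onI)
  fix z w :: "'n \<Rightarrow> nat"
  assume zw: "z \<in> indices k" "w \<in> indices k" "cell k z = cell k w"
  then obtain x where x: "x \<in> cell k z" using cell_nonempty by blast
  with zw cell_subset have "x \<in> cbox 0 1" by blast
  with x zw show "z = w" by (metis mem_cell_iff)
qed

lemma dyadic_cubes_eq: "dyadic_cubes k = cell k ` indices k"
  by (auto simp: dyadic_cubes_def cell_def indices_def)

lemma card_fun_Pi: "card {z :: 'n::finite \<Rightarrow> nat. \<forall>i. z i \<in> A i} = (\<Prod>i\<in>UNIV. card (A i))"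
proof -
  have "{z :: 'n \<Rightarrow> nat. \<forall>i. z i \<in> A i} = PiE UNIV A" by (auto simp: PiE_def Pi_def)
  then show ?thesis by (simp add: card_PiE)
qed

lemma finite_fun_Pi:
  assumes "\<And>i. finite (A i)"
  shows "finite {z :: 'n::finite \<Rightarrow> nat. \<forall>i. z i \<in> A i}"
proof -
  have "{z :: 'n \<Rightarrow> nat. \<forall>i. z i \<in> A i} = PiE UNIV A" by (auto simp: PiE_def Pi_def)
  then show ?thesis using assms by (simp add: finite_PiE)
qed

lemma finite_indices [simp]: "finite (indices k :: ('n::finite \<Rightarrow> nat) set)"
  using finite_fun_Pi[of "\<lambda>_::'n. {..<2 ^ k}"] by (simp add: indices_def)

lemma card_indices: "card (indices k :: ('n::finite \<Rightarrow> nat) set) = 2 ^ (k * CARD('n))"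
  using card_fun_Pi[of "\<lambda>_::'n. {..<2 ^ k}"] by (simp add: indices_def power_mult)

lemma finite_dyadic_cubes [simp]: "finite (dyadic_cubes k :: (real ^ 'n) set set)"
  by (simp add: dyadic_cubes_eq)

lemma cube_at_eq: "cube_at k x = (if x \<in> cbox 0 1 then cell k (cell_index k x) else {})"
  using mem_cell_iff[of x] cell_subset
  by (auto simp: cube_at_def dyadic_cubes_eq) blast+

lemma cube_at_0: "x \<in> cbox 0 1 \<Longrightarrow> cube_at 0 x = cbox 0 1"
  by (auto simp: cube_at_eq cell_def cell_index_def dyadic_interval_def mem_box_cart)

lemma dyadic_interval_borel [measurable]: "dyadic_interval k j \<in> sets borel"
  by (auto simp: dyadic_interval_def)

lemma cell_borel [measurable]: "cell k (z :: 'n::finite \<Rightarrow> nat) \<in> sets borel"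
proof -
  have "cell k z = (\<Inter>i. (\<lambda>x. x $ i) -` dyadic_interval k (z i) \<inter> space borel)"
    by (auto simp: cell_def)
  also have "\<dots> \<in> sets borel"
    by (intro sets.finite_INT measurable_sets[OF borel_measurable_nth]) auto
  finally show ?thesis .
qed

text \<open>The partitions are nested because dividing indices by \<open>2 ^ m\<close> yields the
  ancestor. The cap is compatible with this: \<open>(2 ^ (k + m) - 1) div 2 ^ m\<close> is
  \<open>2 ^ k - 1\<close>, and \<open>div\<close> is monotone, so it commutes with
  \<open>min\<close>.\<close>

lemma cell_index_div:
  fixes x :: "real ^ 'n"
  assumes "x \<in> cbox 0 1"
  shows "cell_index k x = (\<lambda>i. cell_index (k + m) x i div 2 ^ m)"
proof
  fix i
  let ?u = "x $ i"
  have u: "0 \<le> ?u" "?u \<le> 1" using assms by (auto simp: mem_box_cart)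
  have "\<lfloor>?u * 2 ^ k\<rfloor> = \<lfloor>?u * 2 ^ (k + m)\<rfloor> div 2 ^ m"
    using floor_divide_real_eq_div[of "2 ^ m" "?u * 2 ^ (k + m)"] by (simp add: power_add)
  then have "nat \<lfloor>?u * 2 ^ k\<rfloor> = nat \<lfloor>?u * 2 ^ (k + m)\<rfloor> div 2 ^ m"
    by (simp add: nat_div_distrib nat_power_eq u)
  moreover have "(2 ^ (k + m) - 1) div 2 ^ m = (2 ^ k - 1 :: nat)"
  proof -
    obtain A B :: nat where "2 ^ k = Suc A" "2 ^ m = Suc B"
      by (metis not0_implies_Suc power_not_zero zero_neq_numeral)
    moreover have "Suc A * Suc B - 1 = B + A * Suc B" by simp
    moreover have "(B + A * Suc B) div Suc B = A" by (subst div_mult_self1) simp_all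
    ultimately show ?thesis by (simp add: power_add del: mult_Suc mult_Suc_right)
  qed
  moreover have "min a b div c = min (a div c) (b div c)" for a b c :: nat
    by (rule min_of_mono[symmetric]) (simp add: mono_def div_le_mono)
  ultimately show "cell_index k x i = cell_index (k + m) x i div 2 ^ m"
    by (simp add: cell_index_def)
qed

lemma cell_mono:
  assumes "x \<in> cbox 0 1"
  shows "cell (k + m) (cell_index (k + m) x) \<subseteq> cell k (cell_index k x)"
proof
  fix y assume y: "y \<in> cell (k + m) (cell_index (k + m) x)"
  then have yb: "y \<in> cbox 0 1" using cell_subset cell_index_in by blast
  then have "cell_index (k + m) x = cell_index (k + m) y"
    using y by (simp add: mem_cell_iff)
  then have "cell_index k x = cell_index k y"
    using cell_index_div[OF assms, of k m] cell_index_div[OF yb, of k m] by (simp only:)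
  then show "y \<in> cell k (cell_index k x)" using yb mem_cell_index by metis
qed

lemma cube_at_mono: "k \<le> l \<Longrightarrow> cube_at l x \<subseteq> cube_at k x"
  using cell_mono[of x k "l - k"] by (auto simp: cube_at_eq)

text \<open>Each index of level \<open>k\<close> has exactly \<open>2 ^ m\<close> descendants per
  coordinate after \<open>m\<close> more levels, so all fibres of the ancestor map have the same
  cardinality.\<close>

lemma sum_over_indices_div:
  fixes w :: "('n::finite \<Rightarrow> nat) \<Rightarrow> real"
  shows "(\<Sum>z\<in>indices (k + m). w (\<lambda>i. z i div 2 ^ m)) = 2 ^ (m * CARD('n)) * (\<Sum>y\<in>indices k. w y)"
proof -
  let ?\<pi> = "\<lambda>(z :: 'n \<Rightarrow> nat) i. z i div 2 ^ m"
  have sub: "?\<pi> ` indices (k + m) \<subseteq> indices k"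
    by (auto simp: indices_def power_add less_mult_imp_div_less)
  have fib: "card {z \<in> indices (k + m). ?\<pi> z = y} = 2 ^ (m * CARD('n))" if y: "y \<in> indices k" for y :: "'n \<Rightarrow> nat"
  proof -
    have iff: "a div 2 ^ m = b \<longleftrightarrow> a \<in> {b * 2 ^ m ..< (b + 1) * 2 ^ m}" for a b :: nat
      using less_eq_div_iff_mult_less_eq[of "2 ^ m" b a] div_less_iff_less_mult[of "2 ^ m" a "b + 1"]
      by auto
    have "{z \<in> indices (k + m). ?\<pi> z = y} = {z. \<forall>i. z i \<in> {y i * 2 ^ m ..< (y i + 1) * 2 ^ m}}"
    proof (intro Collect_cong iffI conjI)
      fix z assume "z \<in> indices (k + m) \<and> ?\<pi> z = y"
      then show "\<forall>i. z i \<in> {y i * 2 ^ m ..< (y i + 1) * 2 ^ m}"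
        using iff by blast
    next
      fix z assume z: "\<forall>i. z i \<in> {y i * 2 ^ m ..< (y i + 1) * 2 ^ m}"
      then show "?\<pi> z = y" using iff by blast
      show "z \<in> indices (k + m)"
        unfolding indices_def
      proof (clarify)
        fix i
        have "z i < (y i + 1) * 2 ^ m" using z by auto
        also have "\<dots> \<le> 2 ^ k * 2 ^ m" using y by (intro mult_right_mono) (auto simp: indices_def Suc_le_eq)
        finally show "z i < 2 ^ (k + m)" by (simp add: power_add)
      qed
    qed
    then show ?thesis
      using card_fun_Pi[of "\<lambda>i::'n. {y i * 2 ^ m ..< (y i + 1) * 2 ^ m}"] by (simp add: power_mult)
  qed
  have "(\<Sum>z\<in>indices (k + m). w (?\<pi> z)) = (\<Sum>y\<in>indices k. \<Sum>z\<in>{z \<in> indices (k + m). ?\<pi> z = y}. w (?\<pi> z))"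
    using sub by (intro sum.group[symmetric]) auto
  also have "\<dots> = (\<Sum>y\<in>indices k. 2 ^ (m * CARD('n)) * w y)"
    by (intro sum.cong refl) (simp add: fib)
  finally show ?thesis by (simp add: sum_distrib_left)
qed

section \<open>Cell centres and neighbouring cells in the maximum norm\<close>

definition cell_center :: "nat \<Rightarrow> ('n::finite \<Rightarrow> nat) \<Rightarrow> real ^ 'n" where
  "cell_center k z = (\<chi> i. (real (z i) + 1 / 2) / 2 ^ k)"

lemma infnorm_le_cart:
  fixes x :: "real ^ 'n"
  assumes "\<And>i. \<bar>x $ i\<bar> \<le> r"
  shows "infnorm x \<le> r"
proof -
  have "Sup {\<bar>x $ i\<bar> | i. i \<in> UNIV} \<le> r"
    using assms by (intro cSup_least) blast+
  then show ?thesis by (simp only: infnorm_cart)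
qed

text \<open>Half a side length. Centres instead of corners gain exactly one level: the centre of the
  parent of a stopped cube of level \<open>T\<close> is within \<open>1 / 2 ^ T\<close>, with no
  constant left over.\<close>

lemma infnorm_cell_center:
  assumes "x \<in> cell k z"
  shows "infnorm (x - cell_center k z) \<le> 1 / 2 ^ (k + 1)"
proof (rule infnorm_le_cart)
  fix i
  have "x $ i \<in> dyadic_interval k (z i)" using assms by (simp add: cell_def)
  then have "real (z i) / 2 ^ k \<le> x $ i" "x $ i \<le> (real (z i) + 1) / 2 ^ k"
    by (auto simp: dyadic_interval_def split: if_splits)
  moreover have "1 / 2 ^ (k + 1) = (1 / 2 :: real) / 2 ^ k" by simp
  ultimately show "\<bar>(x - cell_center k z) $ i\<bar> \<le> 1 / 2 ^ (k + 1)"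
    by (simp only: cell_center_def abs_le_iff vector_minus_component vec_lambda_beta add_divide_distrib) linarith
qed

text \<open>The cells that a point at distance below \<open>1 / 2 ^ m\<close> from \<open>y\<close>
  can occupy. As an image of three shifts per coordinate the set has at most 3 choices in each, even
  where truncation merges values; \<open>y\<close> may lie outside the unit cube.\<close>

definition nearby :: "nat \<Rightarrow> real ^ 'n \<Rightarrow> ('n \<Rightarrow> nat) set" where
  "nearby m y = {z. \<forall>i. z i \<in> (\<lambda>j. min (nat (\<lfloor>y $ i * 2 ^ m\<rfloor> + j)) (2 ^ m - 1)) ` {- 1, 0, 1}}"

lemma finite_nearby [simp]: "finite (nearby m y)"
  unfolding nearby_def by (rule finite_fun_Pi) simp

lemma card_nearby: "card (nearby m (y :: real ^ 'n)) \<le> 3 ^ CARD('n)"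
proof -
  have c: "card (f ` {-1, 0, 1 :: int}) \<le> 3" for f :: "int \<Rightarrow> nat"
    by (rule order_trans[OF card_image_le]) simp_all
  have "card (nearby m y) \<le> (\<Prod>i\<in>(UNIV :: 'n set). 3)"
    unfolding nearby_def card_fun_Pi by (intro prod_mono conjI c zero_le)
  then show ?thesis by simp
qed

lemma cell_index_nearby:
  fixes x y :: "real ^ 'n"
  assumes "infnorm (x - y) < 1 / 2 ^ m"
  shows "cell_index m x \<in> nearby m y"
proof -
  { fix i
    have "\<bar>x $ i - y $ i\<bar> < 1 / 2 ^ m"
      using component_le_infnorm_cart[of "x - y" i] assms by simp
    then have "\<bar>x $ i - y $ i\<bar> * 2 ^ m < 1"
      by (simp add: field_simps)
    moreover have "\<bar>x $ i * 2 ^ m - y $ i * 2 ^ m\<bar> = \<bar>x $ i - y $ i\<bar> * 2 ^ m"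
      by (simp only: left_diff_distrib[symmetric] abs_mult) simp
    ultimately have "\<bar>x $ i * 2 ^ m - y $ i * 2 ^ m\<bar> < 1" by simp
    then have "\<lfloor>x $ i * 2 ^ m\<rfloor> - \<lfloor>y $ i * 2 ^ m\<rfloor> \<in> {-1, 0, 1}"
      unfolding insert_iff empty_iff by linarith
    then have "cell_index m x i \<in> (\<lambda>j. min (nat (\<lfloor>y $ i * 2 ^ m\<rfloor> + j)) (2 ^ m - 1)) ` {- 1, 0, 1}"
      unfolding cell_index_def by (intro image_eqI[where x="\<lfloor>x $ i * 2 ^ m\<rfloor> - \<lfloor>y $ i * 2 ^ m\<rfloor>"]) auto
  }
  then show ?thesis by (auto simp: nearby_def)
qed

section \<open>Second derivative of the log-partition function, and elementary exponential
  bounds\<close>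

text \<open>The second logarithmic derivative of a partition function is a variance: here of
  \<open>ln (p i)\<close> under the weights \<open>p i\<close>, since these are the Gibbs weights at
  \<open>q = 1\<close>. The factor \<open>1 / ln 2\<close> converts the outer logarithm to base
  2.\<close>

lemma deriv2_log_sum_powr:
  fixes p :: "'i \<Rightarrow> real"
  assumes S: "finite S" "S \<noteq> {}" and pos: "\<And>i. i \<in> S \<Longrightarrow> 0 < p i" and one: "(\<Sum>i\<in>S. p i) = 1"
  shows "(deriv ^^ 2) (\<lambda>q. c * log 2 (\<Sum>i\<in>S. p i powr q)) 1 =
    c / ln 2 * ((\<Sum>i\<in>S. p i * (ln (p i))\<^sup>2) - (\<Sum>i\<in>S. p i * ln (p i))\<^sup>2)"
proof -
  \<comment> \<open>\<open>Z n\<close> is the \<open>n\<close>-th derivative of \<open>Z 0\<close>,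
    so the quotient rule applied to \<open>Z 1 / Z 0\<close> brings in nothing beyond
    \<open>Z 2\<close>.\<close>
  define Z where "Z n q = (\<Sum>i\<in>S. p i powr q * ln (p i) ^ n)" for n :: nat and q
  have Z_deriv: "(Z n has_real_derivative Z (Suc n) q) (at q)" for n q
  proof -
    have *: "((\<lambda>q. p i powr q * ln (p i) ^ n) has_real_derivative p i powr q * ln (p i) ^ Suc n) (at q)"
      if "i \<in> S" for i
    proof -
      have "((\<lambda>q. exp (q * ln (p i)) * ln (p i) ^ n) has_real_derivative
          exp (q * ln (p i)) * ln (p i) ^ Suc n) (at q)"
        by (auto intro!: derivative_eq_intros)
      then show ?thesis using pos[OF that] by (simp add: powr_def)
    qed
    show ?thesis unfolding Z_def by (rule DERIV_sum[OF *])
  qed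
  have Z_pos: "Z 0 q > 0" for q
    unfolding Z_def using S by (intro sum_pos) (auto dest: pos)
  have d1: "deriv (\<lambda>q. c * log 2 (\<Sum>i\<in>S. p i powr q)) = (\<lambda>q. c / ln 2 * (Z 1 q / Z 0 q))"
  proof
    fix q
    have "((\<lambda>q. c / ln 2 * ln (Z 0 q)) has_real_derivative c / ln 2 * (Z 1 q / Z 0 q)) (at q)"
      using Z_pos[of q] by (auto intro!: derivative_eq_intros Z_deriv[of 0, simplified] simp: mult.commute)
    moreover have "(\<lambda>q. c / ln 2 * ln (Z 0 q)) = (\<lambda>q. c * log 2 (\<Sum>i\<in>S. p i powr q))"
      by (simp add: Z_def log_def)
    ultimately show "deriv (\<lambda>q. c * log 2 (\<Sum>i\<in>S. p i powr q)) q = c / ln 2 * (Z 1 q / Z 0 q)"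
      by (simp add: DERIV_imp_deriv)
  qed
  have "((\<lambda>q. c / ln 2 * (Z 1 q / Z 0 q)) has_real_derivative
      c / ln 2 * ((Z 2 1 * Z 0 1 - Z 1 1 * Z 1 1) / (Z 0 1 * Z 0 1))) (at 1)"
    using Z_pos[of 1] Z_deriv[of 0 1] Z_deriv[of 1 1]
    by (intro DERIV_cmult DERIV_divide) (auto simp: numeral_2_eq_2)
  then have "deriv (\<lambda>q. c / ln 2 * (Z 1 q / Z 0 q)) 1 =
      c / ln 2 * ((Z 2 1 * Z 0 1 - Z 1 1 * Z 1 1) / (Z 0 1 * Z 0 1))"
    by (rule DERIV_imp_deriv)
  moreover have "Z n 1 = (\<Sum>i\<in>S. p i * ln (p i) ^ n)" for n
    unfolding Z_def by (intro sum.cong) (auto dest: pos)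
  ultimately show ?thesis
    by (simp add: numeral_2_eq_2 d1[unfolded numeral_2_eq_2] one power2_eq_square)
qed

text \<open>From \<open>x < exp x\<close> at \<open>x = w * ln 2\<close>; the constant 2 covers
  \<open>1 / ln 2\<close>.\<close>

lemma le_two_powr: "w \<le> 2 * 2 powr w" for w :: real
proof (cases "w \<le> 0")
  case True
  then show ?thesis by (smt (verit) powr_ge_zero)
next
  case False
  have "w * ln 2 < exp (w * ln 2)" using exp_ge_add_one_self[of "w * ln 2"] by linarith
  moreover have "w * (1 / 2) \<le> w * ln 2"
    using False ln2_ge_two_thirds by (intro mult_left_mono) auto
  ultimately show ?thesis by (simp add: powr_def)
qed

text \<open>The linear bound at \<open>w / n\<close>, raised to the power \<open>n\<close>. It is
  the common source of the constants \<open>2 n\<close> and \<open>4 n\<close> in the moment bounds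
  below.\<close>

lemma power_le_two_powr:
  fixes w :: real
  assumes "0 \<le> w"
  shows "w ^ n \<le> (2 * real n) ^ n * 2 powr w"
proof (cases "n = 0")
  case True
  then show ?thesis using assms ge_one_powr_ge_zero[of 2 w] by simp
next
  case False
  have "w / n \<le> 2 * 2 powr (w / n)" by (rule le_two_powr)
  then have "w \<le> 2 * n * 2 powr (w / n)" using False by (simp add: field_simps)
  then have "w ^ n \<le> (2 * n * 2 powr (w / n)) ^ n" using assms by (intro power_mono)
  also have "\<dots> = (2 * real n) ^ n * (2 powr (w / n)) ^ n" by (simp add: power_mult_distrib)
  also have "(2 powr (w / n)) ^ n = 2 powr w"
    using False by (simp add: powr_realpow[symmetric] powr_powr)
  finally show ?thesis .
qed

section \<open>Masses of dyadic cubes and information rates of a Frostman measure\<close>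

locale frostman_measure = prob_space \<nu> for \<nu> :: "(real ^ 'n) measure" +
  fixes a C d :: real
  assumes borel: "sets \<nu> = sets borel"
    and supp: "msupport \<nu> \<subseteq> interior (cbox 0 1)"
    and a: "a > 0" and C: "C \<ge> 1"
    and frostman: "\<And>k Q. Q \<in> dyadic_cubes k \<Longrightarrow> measure \<nu> Q \<le> C * 2 powr (- a * real k)"
    and dim: "d = real CARD('n)"
begin

abbreviation "X \<equiv> info_rate \<nu>"

abbreviation "H \<equiv> entropy_level \<nu>"

abbreviation "V \<equiv> V_est \<nu>"

abbreviation "h \<equiv> h_est \<nu>"

abbreviation "D \<equiv> D_est \<nu>"

abbreviation mass :: "nat \<Rightarrow> real ^ 'n \<Rightarrow> real" where
  "mass k x \<equiv> measure \<nu> (cube_at k x)"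

lemma d_ge_1: "d \<ge> 1"
  by (simp add: dim Suc_le_eq)

lemma space_eq [simp]: "space \<nu> = UNIV"
  using sets_eq_imp_space_eq[OF borel] by simp

lemma borel_imp_sets [measurable_dest]: "A \<in> sets borel \<Longrightarrow> A \<in> sets \<nu>"
  by (simp add: borel)

lemma cell_sets [measurable]: "cell k z \<in> sets \<nu>"
  by (simp add: borel)

text \<open>The complement of the support is a union of open null sets; the Lindelof property
  reduces it to a countable union, hence to a null set.\<close>

lemma AE_cube: "AE x in \<nu>. x \<in> cbox (0 :: real ^ 'n) 1"
proof -
  let ?F = "{U :: (real ^ 'n) set. open U \<and> emeasure \<nu> U = 0}"
  obtain F' where F': "F' \<subseteq> ?F" "countable F'" "\<Union>F' = \<Union>?F"
    using Lindelof[of ?F] by auto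
  have "\<Union>F' \<in> null_sets \<nu>"
    using F' by (intro null_sets_UN'[of F' "\<lambda>U. U", simplified]) (auto simp: null_sets_def borel)
  then have "AE x in \<nu>. x \<notin> \<Union>F'" by (rule AE_not_in)
  moreover have "x \<in> cbox 0 1" if "x \<notin> \<Union>F'" for x
  proof -
    have "x \<in> msupport \<nu>"
      using that unfolding F'(3) msupport_def by (auto simp: zero_less_iff_neq_zero)
    then show ?thesis using supp interior_subset by blast
  qed
  ultimately show ?thesis by auto
qed

text \<open>A function of the level \<open>k\<close> index agrees almost everywhere with a finite
  simple function. Integrability is therefore free, even for expressions such as powers of
  \<open>log 2 (mass k x)\<close> that come with no a priori bound.\<close>

lemma integral_eq_sum_cells:
  fixes f :: "real ^ 'n \<Rightarrow> real"
  assumes f: "f \<in> borel_measurable \<nu>"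
    and g: "\<And>x. x \<in> cbox 0 1 \<Longrightarrow> f x = g (cell_index k x)"
  shows "integrable \<nu> f" "(\<integral>x. f x \<partial>\<nu>) = (\<Sum>z\<in>indices k. measure \<nu> (cell k z) * g z)"
proof -
  let ?h = "\<lambda>x. \<Sum>z\<in>indices k. indicator (cell k z) x * g z :: real"
  have eq: "f x = ?h x" if x: "x \<in> cbox 0 1" for x
  proof -
    have "?h x = (\<Sum>z\<in>indices k. if z = cell_index k x then g z else 0)"
      using x by (intro sum.cong refl) (auto simp: mem_cell_iff)
    then show ?thesis using g[OF x] by simp
  qed
  then have AE: "AE x in \<nu>. f x = ?h x" using AE_cube by auto
  have h: "integrable \<nu> ?h"
    by (intro Bochner_Integration.integrable_sum integrable_mult_left integrable_real_indicator)
       (auto simp: less_top[symmetric])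
  then show "integrable \<nu> f" using integrable_cong_AE[OF f _ AE] by auto
  have "(\<integral>x. f x \<partial>\<nu>) = (\<integral>x. ?h x \<partial>\<nu>)" using f h AE by (intro integral_cong_AE) auto
  also have "\<dots> = (\<Sum>z\<in>indices k. measure \<nu> (cell k z) * g z)"
    by (subst Bochner_Integration.integral_sum)
       (auto intro!: integrable_mult_left integrable_real_indicator simp: less_top[symmetric])
  finally show "(\<integral>x. f x \<partial>\<nu>) = (\<Sum>z\<in>indices k. measure \<nu> (cell k z) * g z)" .
qed

lemma mass_eq: "x \<in> cbox 0 1 \<Longrightarrow> mass k x = measure \<nu> (cell k (cell_index k x))"
  by (simp add: cube_at_eq)

lemma mass_measurable [measurable]: "mass k \<in> borel_measurable \<nu>"
proof -
  \<comment> \<open>Outside the unit cube both sides vanish, so the representation is an identity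
    and not merely almost sure; this is what measurability with respect to the Borel sets
    requires.\<close>
  have "mass k x = (\<Sum>z\<in>indices k. indicator (cell k z) x * measure \<nu> (cell k z))" for x
  proof (cases "x \<in> cbox 0 1")
    case True
    then have "(\<Sum>z\<in>indices k. indicator (cell k z) x * measure \<nu> (cell k z)) =
        (\<Sum>z\<in>indices k. if z = cell_index k x then measure \<nu> (cell k z) else 0)"
      by (intro sum.cong refl) (auto simp: mem_cell_iff)
    then show ?thesis using True by (simp add: mass_eq)
  next
    case False
    then have "indicator (cell k z) x = (0 :: real)" if "z \<in> indices k" for z
      using cell_subset[OF that] by (auto simp: indicator_def)
    then show ?thesis using False by (simp add: cube_at_eq)
  qed
  then have "mass k = (\<lambda>x. \<Sum>z\<in>indices k. indicator (cell k z) x * measure \<nu> (cell k z))" ..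
  moreover have "\<dots> \<in> borel_measurable \<nu>" by measurable
  ultimately show ?thesis by (simp only:)
qed

lemma pred_imp_sets: "Measurable.pred \<nu> P \<Longrightarrow> {x. P x} \<in> sets \<nu>"
  by (simp add: pred_def)

lemma prob_eq_sum_cells:
  assumes "Measurable.pred \<nu> P" and "\<And>x. x \<in> cbox 0 1 \<Longrightarrow> P x \<longleftrightarrow> R (cell_index k x)"
  shows "prob {x. P x} = (\<Sum>z\<in>indices k. measure \<nu> (cell k z) * of_bool (R z))"
proof -
  have "prob {x. P x} = (\<integral>x. indicator {x. P x} x \<partial>\<nu>)" by simp
  also have "\<dots> = (\<Sum>z\<in>indices k. measure \<nu> (cell k z) * of_bool (R z))"
    using assms(2) borel_measurable_indicator[OF pred_imp_sets[OF assms(1)]]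
    by (intro integral_eq_sum_cells(2)) (auto split: split_indicator)
  finally show ?thesis .
qed

lemma sum_cells: "(\<Sum>z\<in>indices k. measure \<nu> (cell k z)) = 1"
  using integral_eq_sum_cells(2)[of "\<lambda>_. 1" "\<lambda>_. 1" k] prob_space by simp

lemma sum_dyadic_cubes: "(\<Sum>Q\<in>dyadic_cubes k. f Q) = (\<Sum>z\<in>indices k. f (cell k z))"
  by (simp add: dyadic_cubes_eq sum.reindex inj_on_cell)

lemma mass_le: "mass k x \<le> C * 2 powr (- a * real k)"
  using frostman[of "cell k (cell_index k x)" k] C by (auto simp: cube_at_eq dyadic_cubes_eq)

lemma mass_antimono: "k \<le> l \<Longrightarrow> mass l x \<le> mass k x"
  using cube_at_mono[of k l x] by (intro finite_measure_mono) (auto simp: cube_at_eq)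

lemma mass_0: "x \<in> cbox 0 1 \<Longrightarrow> mass 0 x = 1"
  using AE_cube by (simp add: cube_at_0 prob_eq_1 borel)

text \<open>At each level the points in null cells have total mass zero, a finite sum of zeros, and
  there are countably many levels.\<close>

lemma AE_mass_pos: "AE x in \<nu>. \<forall>k. 0 < mass k x"
  unfolding AE_all_countable
proof
  fix k
  have "prob {x. mass k x = 0} = (\<Sum>z\<in>indices k. measure \<nu> (cell k z) * of_bool (measure \<nu> (cell k z) = 0))"
    by (rule prob_eq_sum_cells) (measurable, simp add: mass_eq)
  also have "\<dots> = 0" by (intro sum.neutral) auto
  finally have "prob {x. mass k x = 0} = 0" .
  then have "AE x in \<nu>. x \<notin> {x. mass k x = 0}"
    by (intro AE_not_in) (auto simp: null_sets_def emeasure_eq_measure intro!: pred_imp_sets)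
  then show "AE x in \<nu>. 0 < mass k x"
    by eventually_elim (simp add: zero_less_measure_iff measure_le_0_iff)
qed

lemma prob_mass_less:
  assumes "0 \<le> t"
  shows "prob {x. mass k x < t} \<le> 2 ^ (k * CARD('n)) * t"
proof -
  have "prob {x. mass k x < t} = (\<Sum>z\<in>indices k. measure \<nu> (cell k z) * of_bool (measure \<nu> (cell k z) < t))"
    by (rule prob_eq_sum_cells) (measurable, simp add: mass_eq)
  also have "\<dots> \<le> (\<Sum>z\<in>(indices k :: ('n \<Rightarrow> nat) set). t)"
    using assms by (intro sum_mono) auto
  finally show ?thesis by (simp add: card_indices)
qed

text \<open>Counting relative to ancestors: a bad descendant carries at most
  \<open>\<eta> / 2 ^ (m d)\<close> of the mass of its ancestor, and an ancestor has
  \<open>2 ^ (m d)\<close> descendants, so the bad ones take at most the share \<open>\<eta>\<close>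
  of every cube of level \<open>k\<close>. The bound depends neither on \<open>k\<close> nor on
  \<open>m\<close>.\<close>

lemma prob_mass_drop:
  assumes "0 \<le> \<eta>"
  shows "prob {x. mass (k + m) x \<le> \<eta> * mass k x / 2 ^ (m * CARD('n))} \<le> \<eta>"
proof -
  let ?D = "2 ^ (m * CARD('n)) :: real"
  let ?\<pi> = "\<lambda>(z :: 'n \<Rightarrow> nat) i. z i div 2 ^ m"
  have "prob {x. mass (k + m) x \<le> \<eta> * mass k x / ?D} = (\<Sum>z\<in>indices (k + m). measure \<nu> (cell (k + m) z) *
      of_bool (measure \<nu> (cell (k + m) z) \<le> \<eta> * measure \<nu> (cell k (?\<pi> z)) / ?D))"
    by (rule prob_eq_sum_cells) (measurable, simp add: mass_eq cell_index_div[of _ k m])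
  also have "\<dots> \<le> (\<Sum>z\<in>indices (k + m). \<eta> * measure \<nu> (cell k (?\<pi> z)) / ?D)"
    using assms by (intro sum_mono) auto
  also have "\<dots> = ?D * (\<Sum>y\<in>indices k. \<eta> * measure \<nu> (cell k y) / ?D)"
    by (rule sum_over_indices_div[of "\<lambda>y. \<eta> * measure \<nu> (cell k y) / ?D"])
  also have "\<dots> = \<eta> * (\<Sum>y\<in>indices k. measure \<nu> (cell k y))"
    by (simp add: sum_distrib_left)
  finally show ?thesis by (simp add: sum_cells)
qed

lemma info_rate_measurable [measurable]: "X k \<in> borel_measurable \<nu>"
  unfolding info_rate_def[abs_def] by measurable

lemma integral_info_rate:
  fixes F :: "real \<Rightarrow> real"
  assumes [measurable]: "F \<in> borel_measurable borel"
  shows "integrable \<nu> (\<lambda>x. F (X k x))"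
    and "(\<integral>x. F (X k x) \<partial>\<nu>) = (\<Sum>z\<in>indices k. measure \<nu> (cell k z) *
      F (- (1 / real k) * log 2 (measure \<nu> (cell k z))))"
  by (rule integral_eq_sum_cells, measurable, simp add: info_rate_def mass_eq)+

lemma entropy_level_eq: "H k = (\<integral>x. X k x \<partial>\<nu>)"
  using integral_info_rate(2)[of "\<lambda>x. x" k]
  by (simp add: entropy_level_def sum_dyadic_cubes sum_negf sum_distrib_left mult.left_commute sum_divide_distrib)

text \<open>The bound holds cell by cell. A cell of mass \<open>p = 2 powr (- k (u + d))\<close>
  with \<open>u > 0\<close> contributes \<open>u ^ n\<close> times \<open>2 powr (- k u)\<close>
  times \<open>2 powr (- k d)\<close>; the first exponential absorbs the power, the second cancels
  the number of cells.\<close>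

lemma info_rate_excess:
  assumes k: "0 < k" and n: "0 < n"
  shows "(\<integral>x. (max (X k x - d) 0) ^ n \<partial>\<nu>) \<le> (2 * real n / real k) ^ n"
proof -
  have *: "p * (max (- (1 / real k) * log 2 p - d) 0) ^ n \<le> (2 * real n / real k) ^ n / 2 ^ (k * CARD('n))"
    if p: "0 \<le> p" for p :: real
  proof (cases "p = 0 \<or> - (1 / real k) * log 2 p \<le> d")
    case True
    then show ?thesis using n by (auto simp: max_def zero_power)
  next
    case False
    define u where "u = - (1 / real k) * log 2 p - d"
    have u: "0 < u" and p0: "0 < p" using False p by (auto simp: u_def)
    have "log 2 p = - (real k * (u + d))" using k by (simp add: u_def)
    then have "p = 2 powr (- (real k * (u + d)))" using p0 by (metis powr_log_cancel zero_less_numeral numeral_eq_one_iff semiring_norm(85))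
    also have "\<dots> = 2 powr (- (real k * u)) * 2 powr (- (real k * d))"
      by (simp add: powr_add[symmetric] algebra_simps)
    also have "2 powr (- (real k * d)) = 1 / 2 ^ (k * CARD('n))"
      by (simp add: dim powr_minus_divide powr_realpow[symmetric])
    finally have p_eq: "p = 2 powr (- (real k * u)) / 2 ^ (k * CARD('n))" by simp
    have "(real k * u) ^ n \<le> (2 * real n) ^ n * 2 powr (real k * u)"
      using u by (intro power_le_two_powr) auto
    then have "u ^ n * 2 powr (- (real k * u)) \<le> (2 * real n / real k) ^ n"
      using k by (simp add: powr_minus_divide power_mult_distrib power_divide field_simps)
    then have "u ^ n * p \<le> (2 * real n / real k) ^ n / 2 ^ (k * CARD('n))"
      by (simp add: p_eq divide_right_mono)
    moreover have "max (- (1 / real k) * log 2 p - d) 0 = u"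
      using u unfolding u_def by (intro max_absorb1) simp
    ultimately show ?thesis by (simp only: mult.commute)
  qed
  have "(\<integral>x. (max (X k x - d) 0) ^ n \<partial>\<nu>) = (\<Sum>z\<in>indices k. measure \<nu> (cell k z) *
      (max (- (1 / real k) * log 2 (measure \<nu> (cell k z)) - d) 0) ^ n)"
    by (rule integral_info_rate) simp
  also have "\<dots> \<le> (\<Sum>z\<in>(indices k :: ('n \<Rightarrow> nat) set). (2 * real n / real k) ^ n / 2 ^ (k * CARD('n)))"
    by (intro sum_mono *) simp
  finally show ?thesis by (simp add: card_indices)
qed

lemma mvar_info_rate: "mvar \<nu> (X k) = (\<integral>x. (X k x)\<^sup>2 \<partial>\<nu>) - (\<integral>x. X k x \<partial>\<nu>)\<^sup>2"
  unfolding mvar_def using integral_info_rate(1)[of "\<lambda>x. x" k] integral_info_rate(1)[of "\<lambda>x. x\<^sup>2" k]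
  by (intro variance_eq) auto

text \<open>Since \<open>X k = - ln p / (k ln 2)\<close>, the variance of \<open>ln p\<close> is
  \<open>(k ln 2)\<^sup>2\<close> times that of \<open>X k\<close>; the factor
  \<open>1 / (k ln 2)\<close> in front of the second derivative removes one of the two powers. Null
  cubes, absent from \<open>beta\<close>, have weight 0 in the moments.\<close>

lemma beta_dd1_eq:
  assumes k: "0 < k"
  shows "beta_dd1 \<nu> k = real k * ln 2 * mvar \<nu> (X k)"
proof -
  let ?S = "{Q \<in> dyadic_cubes k. measure \<nu> Q > 0}" and ?p = "measure \<nu>"
  have S_sum: "(\<Sum>Q\<in>?S. ?p Q * f Q) = (\<Sum>z\<in>indices k. ?p (cell k z) * f (cell k z))" for f
    unfolding sum_dyadic_cubes[symmetric, of "\<lambda>Q. ?p Q * f Q"]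
    by (intro sum.mono_neutral_left) (auto simp: zero_less_measure_iff)
  have one: "(\<Sum>Q\<in>?S. ?p Q) = 1" using S_sum[of "\<lambda>_. 1"] by (simp add: sum_cells)
  then have ne: "?S \<noteq> {}" by (metis sum.empty zero_neq_one)
  let ?l = "real k * ln 2"
  have X: "- (1 / real k) * log 2 p = - (1 / ?l) * ln p" for p by (simp add: log_def)
  have "(\<integral>x. X k x \<partial>\<nu>) = - (1 / ?l) * (\<Sum>Q\<in>?S. ?p Q * ln (?p Q))"
    using integral_info_rate(2)[of "\<lambda>x. x" k] unfolding S_sum X
    by (simp add: sum_distrib_left sum_negf mult.left_commute sum_divide_distrib)
  moreover have "(\<integral>x. (X k x)\<^sup>2 \<partial>\<nu>) = (1 / ?l)\<^sup>2 * (\<Sum>Q\<in>?S. ?p Q * (ln (?p Q))\<^sup>2)"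
    using integral_info_rate(2)[of "\<lambda>x. x\<^sup>2" k] unfolding S_sum X power_mult_distrib
    by (simp add: sum_distrib_left mult.left_commute sum_divide_distrib)
  ultimately have "mvar \<nu> (X k) =
      (1 / ?l)\<^sup>2 * ((\<Sum>Q\<in>?S. ?p Q * (ln (?p Q))\<^sup>2) - (\<Sum>Q\<in>?S. ?p Q * ln (?p Q))\<^sup>2)"
    unfolding mvar_info_rate by (simp add: power_mult_distrib right_diff_distrib power2_eq_square)
  moreover have "beta_dd1 \<nu> k =
      1 / real k / ln 2 * ((\<Sum>Q\<in>?S. ?p Q * (ln (?p Q))\<^sup>2) - (\<Sum>Q\<in>?S. ?p Q * ln (?p Q))\<^sup>2)"
    unfolding beta_dd1_def beta_def[abs_def] using ne one by (intro deriv2_log_sum_powr) auto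
  ultimately show ?thesis using k by (simp add: power2_eq_square)
qed

end

section \<open>Stopping times: tails, moments, and the gap between arithmetic and harmonic
  mean\<close>

lemma Limsup_ereal_eq_0_iff:
  fixes f :: "'i \<Rightarrow> real"
  assumes "F \<noteq> bot" "eventually (\<lambda>x. 0 \<le> f x) F"
  shows "Limsup F (\<lambda>x. ereal (f x)) = 0 \<longleftrightarrow> (f \<longlongrightarrow> 0) F"
proof
  assume L: "Limsup F (\<lambda>x. ereal (f x)) = 0"
  have "0 \<le> Liminf F (\<lambda>x. ereal (f x))"
    using assms(2) by (intro Liminf_bounded) (auto elim: eventually_mono)
  then have "Liminf F (\<lambda>x. ereal (f x)) = 0"
    using Liminf_le_Limsup[OF assms(1), of "\<lambda>x. ereal (f x)"] L by (simp add: antisym)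
  then have "((\<lambda>x. ereal (f x)) \<longlongrightarrow> ereal 0) F"
    using L by (intro Liminf_eq_Limsup assms) (auto simp: zero_ereal_def)
  then show "(f \<longlongrightarrow> 0) F" by simp
next
  assume "(f \<longlongrightarrow> 0) F"
  then have "((\<lambda>x. ereal (f x)) \<longlongrightarrow> ereal 0) F" by simp
  from lim_imp_Limsup[OF assms(1) this] show "Limsup F (\<lambda>x. ereal (f x)) = 0"
    by (simp add: zero_ereal_def)
qed

lemma eventually_at_right_unit: "\<forall>\<^sub>F t in at_right (0 :: real). 0 < t \<and> t < 1"
  by (rule eventually_at_rightI[of 0 1]) auto

text \<open>With \<open>s = log 2 (1 / t)\<close> one has
  \<open>t powr \<delta> = 2 powr (- \<delta> s)\<close>. Half of this exponential absorbs
  \<open>s ^ n\<close>, the other half remains as decay.\<close>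

lemma log_power_times_powr_le:
  fixes t \<delta> :: real
  assumes t: "0 < t" "t < 1" and \<delta>: "0 < \<delta>"
  shows "(log 2 (1 / t)) ^ n * t powr \<delta> \<le> (4 * real n / \<delta>) ^ n * t powr (\<delta> / 2)"
proof -
  define s where "s = log 2 (1 / t)"
  have s: "0 < s" using t by (simp add: s_def)
  have "ln t = - (s * ln 2)" using t by (simp add: s_def log_def ln_div)
  then have tp: "t powr c = 2 powr (- (c * s))" for c
    using t(1) unfolding powr_def by (simp only: if_False mult_minus_left mult_minus_right mult.assoc) auto
  have "(\<delta> / 2 * s) ^ n \<le> (2 * real n) ^ n * 2 powr (\<delta> / 2 * s)"
    using s \<delta> by (intro power_le_two_powr) auto
  then have "(2 / \<delta>) ^ n * (\<delta> / 2 * s) ^ n \<le> (2 / \<delta>) ^ n * ((2 * real n) ^ n * 2 powr (\<delta> / 2 * s))"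
    using \<delta> by (intro mult_left_mono) auto
  moreover have "(2 / \<delta>) ^ n * (\<delta> / 2 * s) ^ n = s ^ n"
    using \<delta> by (subst power_mult_distrib[symmetric]) simp
  moreover have "(2 / \<delta>) ^ n * (2 * real n) ^ n = (4 * real n / \<delta>) ^ n"
    by (subst power_mult_distrib[symmetric]) (rule arg_cong[where f="\<lambda>x. x ^ n"], simp)
  ultimately have "s ^ n \<le> (4 * real n / \<delta>) ^ n * 2 powr (\<delta> / 2 * s)"
    by (simp only: mult.assoc[symmetric])
  then have "s ^ n * t powr \<delta> \<le> (4 * real n / \<delta>) ^ n * 2 powr (\<delta> / 2 * s) * t powr \<delta>"
    by (intro mult_right_mono) auto
  also have "\<dots> = (4 * real n / \<delta>) ^ n * t powr (\<delta> / 2)"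
    by (simp add: tp mult.assoc powr_add[symmetric])
  finally show ?thesis by (simp add: s_def)
qed

context frostman_measure
begin

abbreviation "\<sigma> t \<equiv> log 2 (1 / t)"

lemma sigma_pos: "0 < t \<Longrightarrow> t < 1 \<Longrightarrow> 0 < \<sigma> t"
  by simp

lemma depth_bound_ge_1: "0 < t \<Longrightarrow> t < 1 \<Longrightarrow> 1 \<le> depth_bound a C t"
  using a C by (simp add: depth_bound_def)

lemma mass_less_of_large:
  assumes t: "0 < t" and k: "(\<sigma> t + log 2 C) / a < real k"
  shows "C * 2 powr (- a * real k) < t"
proof -
  have "\<sigma> t + log 2 C < a * real k" using k a by (simp add: field_simps)
  then have "log 2 (C * 2 powr (- a * real k)) < log 2 t"
    using t C by (simp add: log_mult log_divide)
  then show ?thesis using t C by (subst (asm) log_less_cancel_iff) auto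
qed

lemma ex_mass_less:
  assumes t: "0 < t" "t < 1"
  shows "\<exists>k\<ge>1. mass k x < t \<and> real k \<le> depth_bound a C t"
proof -
  let ?y = "(\<sigma> t + log 2 C) / a"
  \<comment> \<open>The least integer strictly above \<open>?y\<close>; it may exceed
    \<open>?y\<close> by a full unit, which is the summand 1 in \<open>depth_bound\<close>.\<close>
  define k where "k = nat \<lfloor>?y\<rfloor> + 1"
  have "0 \<le> ?y" using t C a by simp
  then have k: "?y < real k" "real k \<le> 1 + ?y" unfolding k_def by linarith+
  have "mass k x < t" using mass_less_of_large[OF t(1) k(1)] mass_le[of k x] by linarith
  moreover have "1 \<le> k" by (simp add: k_def)
  ultimately show ?thesis using k(2) unfolding depth_bound_def by blast
qed

text \<open>\<open>mass_le\<close> holds at every point, so the minimum defining the stopping time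
  is always attained and these bounds need no exceptional set.\<close>

lemma
  assumes t: "0 < t" "t < 1"
  shows stop_time_ge_1: "1 \<le> stop_time \<nu> t x"
    and mass_stop_time: "mass (stop_time \<nu> t x) x < t"
    and stop_time_le: "real (stop_time \<nu> t x) \<le> depth_bound a C t"
proof -
  obtain k where k: "k \<ge> 1" "mass k x < t" "real k \<le> depth_bound a C t"
    using ex_mass_less[OF t] by blast
  have "stop_time \<nu> t x \<ge> 1 \<and> mass (stop_time \<nu> t x) x < t"
    unfolding stop_time_def by (rule LeastI[of _ k]) (use k in auto)
  then show "1 \<le> stop_time \<nu> t x" "mass (stop_time \<nu> t x) x < t" by auto
  have "stop_time \<nu> t x \<le> k"
    unfolding stop_time_def by (rule Least_le) (use k in auto)
  then show "real (stop_time \<nu> t x) \<le> depth_bound a C t" using k by simp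
qed

lemma stop_time_le_iff:
  assumes t: "0 < t" "t < 1" and k: "1 \<le> k"
  shows "stop_time \<nu> t x \<le> k \<longleftrightarrow> mass k x < t"
proof
  assume "stop_time \<nu> t x \<le> k"
  then show "mass k x < t" using mass_stop_time[OF t, of x] mass_antimono[of _ k x] by (meson le_less_trans)
next
  assume "mass k x < t"
  then show "stop_time \<nu> t x \<le> k" unfolding stop_time_def using k by (intro Least_le) auto
qed

lemma stop_time_measurable [measurable]: "stop_time \<nu> t \<in> measurable \<nu> (count_space UNIV)"
  unfolding stop_time_def[abs_def] by measurable

lemma dim_est_measurable [measurable]: "dim_est \<nu> t \<in> borel_measurable \<nu>"
  unfolding dim_est_def[abs_def] by measurable

text \<open>For fixed \<open>t\<close> the stopping time takes finitely many values, so every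
  function of it is bounded.\<close>

lemma integrable_stop_time:
  fixes g :: "nat \<Rightarrow> real"
  assumes t: "0 < t" "t < 1"
  shows "integrable \<nu> (\<lambda>x. g (stop_time \<nu> t x))"
proof (rule integrable_const_bound[of _ "Max ((\<lambda>k. \<bar>g k\<bar>) ` {..nat \<lfloor>depth_bound a C t\<rfloor>})"])
  have "stop_time \<nu> t x \<le> nat \<lfloor>depth_bound a C t\<rfloor>" for x
    using stop_time_le[OF t, of x] by (simp add: le_nat_floor)
  then show "AE x in \<nu>. norm (g (stop_time \<nu> t x)) \<le> Max ((\<lambda>k. \<bar>g k\<bar>) ` {..nat \<lfloor>depth_bound a C t\<rfloor>})"
    by (intro AE_I2) (auto intro!: Max_ge)
  show "(\<lambda>x. g (stop_time \<nu> t x)) \<in> borel_measurable \<nu>"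
    by (rule measurable_compose[OF stop_time_measurable]) simp
qed

lemma integrable_dim_est:
  fixes F :: "real \<Rightarrow> real"
  assumes t: "0 < t" "t < 1"
  shows "integrable \<nu> (\<lambda>x. F (dim_est \<nu> t x))"
  unfolding dim_est_def by (rule integrable_stop_time[OF t])

lemma
  assumes t: "0 < t" "t < 1"
  shows rate_bound_pos: "0 < rate_bound a C t"
    and rate_bound_le_dim_est: "rate_bound a C t \<le> dim_est \<nu> t x"
    and dim_est_le: "dim_est \<nu> t x \<le> \<sigma> t"
    and dim_est_pos: "0 < dim_est \<nu> t x"
proof -
  have K: "1 \<le> depth_bound a C t" and s: "0 < \<sigma> t" and T: "1 \<le> real (stop_time \<nu> t x)"
    using depth_bound_ge_1[OF t] sigma_pos[OF t] stop_time_ge_1[OF t, of x] by auto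
  show "0 < rate_bound a C t" unfolding rate_bound_def using K s by (intro divide_pos_pos) auto
  show "0 < dim_est \<nu> t x" unfolding dim_est_def using T s by (intro divide_pos_pos) auto
  show "rate_bound a C t \<le> dim_est \<nu> t x"
    unfolding rate_bound_def dim_est_def using stop_time_le[OF t, of x] T s
    by (intro divide_left_mono mult_pos_pos) auto
  have "\<sigma> t / real (stop_time \<nu> t x) \<le> \<sigma> t / 1" using T s by (intro divide_left_mono) auto
  then show "dim_est \<nu> t x \<le> \<sigma> t" by (simp add: dim_est_def)
qed

text \<open>Stopping times are integers, so their bound \<open>\<sigma> t / v\<close> can be rounded
  down. The clause \<open>1 \<le> nat \<lfloor>\<sigma> t / v\<rfloor>\<close> covers thresholds
  \<open>v > \<sigma> t\<close>, which the estimate never reaches because stopping times start at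
  1.\<close>

lemma dim_est_ge_iff:
  assumes t: "0 < t" "t < 1" and v: "0 < v"
  shows "v \<le> dim_est \<nu> t x \<longleftrightarrow> 1 \<le> nat \<lfloor>\<sigma> t / v\<rfloor> \<and> mass (nat \<lfloor>\<sigma> t / v\<rfloor>) x < t"
proof -
  have T: "1 \<le> stop_time \<nu> t x" by (rule stop_time_ge_1[OF t])
  have "v \<le> dim_est \<nu> t x \<longleftrightarrow> real (stop_time \<nu> t x) \<le> \<sigma> t / v"
    using T v by (simp add: dim_est_def field_simps)
  also have "\<dots> \<longleftrightarrow> stop_time \<nu> t x \<le> nat \<lfloor>\<sigma> t / v\<rfloor>"
    using sigma_pos[OF t] v by (simp add: le_nat_iff le_floor_iff)
  also have "\<dots> \<longleftrightarrow> 1 \<le> nat \<lfloor>\<sigma> t / v\<rfloor> \<and> mass (nat \<lfloor>\<sigma> t / v\<rfloor>) x < t"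
    using stop_time_le_iff[OF t] T by (meson order_trans)
  finally show ?thesis .
qed

lemma dim_est_ge_iff_mass:
  assumes t: "0 < t" "t < 1" and k: "1 \<le> k"
  shows "\<sigma> t / real k \<le> dim_est \<nu> t x \<longleftrightarrow> mass k x < t"
proof -
  have "\<sigma> t / (\<sigma> t / real k) = real k" using sigma_pos[OF t] k by simp
  then show ?thesis using dim_est_ge_iff[OF t, of "\<sigma> t / real k" x] sigma_pos[OF t] k by simp
qed

text \<open>Origin of the exponent: the level is at most \<open>\<sigma> t / v\<close>, so the
  number of cubes costs a factor of at most
  \<open>2 powr (d \<sigma> t / v) = t powr (- d / v)\<close>.\<close>

lemma prob_dim_est_ge:
  assumes t: "0 < t" "t < 1" and v: "d < v"
  shows "prob {x. v \<le> dim_est \<nu> t x} \<le> t powr (1 - d / v)"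
proof -
  have v0: "0 < v" using v d_ge_1 by simp
  let ?k = "nat \<lfloor>\<sigma> t / v\<rfloor>"
  have k: "real ?k \<le> \<sigma> t / v" using sigma_pos[OF t] v0 by simp
  have "prob {x. v \<le> dim_est \<nu> t x} \<le> prob {x. mass ?k x < t}"
    using dim_est_ge_iff[OF t v0] by (intro finite_measure_mono) (auto intro!: pred_imp_sets)
  also have "\<dots> \<le> 2 ^ (?k * CARD('n)) * t" using t by (intro prob_mass_less) simp
  also have "(2 :: real) ^ (?k * CARD('n)) = 2 powr (real ?k * d)"
    by (simp add: dim powr_realpow[symmetric])
  also have "\<dots> \<le> 2 powr (\<sigma> t / v * d)"
    using k d_ge_1 by (intro powr_mono mult_right_mono) auto
  also have "2 powr (\<sigma> t / v * d) * t = t powr (1 - d / v)"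
  proof -
    have "\<sigma> t / v * d = log 2 t * (- (d / v))" using t by (simp add: log_divide)
    then have "2 powr (\<sigma> t / v * d) = (2 powr (log 2 t)) powr (- (d / v))"
      by (simp only: powr_powr)
    then have "2 powr (\<sigma> t / v * d) = t powr (- (d / v))" using t by simp
    then show ?thesis using t powr_add[of t "- (d / v)" 1] by simp
  qed
  finally show ?thesis using t by (simp add: mult_right_mono)
qed

definition excess :: "nat \<Rightarrow> real \<Rightarrow> real" where
  "excess n t = (\<integral>x. (max (dim_est \<nu> t x - d) 0) ^ n \<partial>\<nu>)"

lemma excess_nonneg: "0 \<le> excess n t"
  unfolding excess_def by (intro integral_nonneg_AE) auto

text \<open>Below \<open>v\<close> the integrand is at most \<open>c\<close>. Above \<open>v\<close>
  the crude bound \<open>\<sigma> t ^ n\<close> is only logarithmic in \<open>1 / t\<close> and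
  loses against the tail probability, a positive power of \<open>t\<close>. The excess is treated
  with \<open>c = \<epsilon> ^ n\<close>, the plain moments with
  \<open>c = (d + 1) ^ n\<close>.\<close>

lemma integral_le_split:
  fixes F :: "real \<Rightarrow> real"
  assumes t: "0 < t" "t < 1" and v: "d < v"
    and F1: "\<And>y. y < v \<Longrightarrow> 0 < y \<Longrightarrow> F y \<le> c" and c: "0 \<le> c"
    and F2: "\<And>y. 0 < y \<Longrightarrow> F y \<le> y ^ n"
  shows "(\<integral>x. F (dim_est \<nu> t x) \<partial>\<nu>) \<le> c + (4 * real n / (1 - d / v)) ^ n * t powr ((1 - d / v) / 2)"
proof -
  let ?A = "{x. v \<le> dim_est \<nu> t x}"
  have \<delta>: "0 < 1 - d / v" using v d_ge_1 by (simp add: field_simps)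
  have [measurable]: "?A \<in> sets \<nu>" by (intro pred_imp_sets) measurable
  have "(\<integral>x. F (dim_est \<nu> t x) \<partial>\<nu>) \<le> (\<integral>x. c + \<sigma> t ^ n * indicator ?A x \<partial>\<nu>)"
  proof (intro integral_mono integrable_dim_est[OF t] Bochner_Integration.integrable_add integrable_mult_right integrable_real_indicator)
    fix x
    show "F (dim_est \<nu> t x) \<le> c + \<sigma> t ^ n * indicator ?A x"
    proof (cases "v \<le> dim_est \<nu> t x")
      case True
      have "F (dim_est \<nu> t x) \<le> dim_est \<nu> t x ^ n" by (intro F2 dim_est_pos t)
      also have "\<dots> \<le> \<sigma> t ^ n"
        using dim_est_pos[OF t, of x] dim_est_le[OF t, of x] by (intro power_mono) auto
      finally show ?thesis using True c by simp
    next
      case False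
      then show ?thesis using F1[of "dim_est \<nu> t x"] dim_est_pos[OF t, of x] by simp
    qed
  qed (auto simp: less_top[symmetric])
  also have "\<dots> = c + \<sigma> t ^ n * prob ?A"
    by (subst Bochner_Integration.integral_add)
       (auto simp: prob_space[simplified] less_top[symmetric] intro!: integrable_real_indicator)
  also have "\<dots> \<le> c + \<sigma> t ^ n * t powr (1 - d / v)"
    using prob_dim_est_ge[OF t v] sigma_pos[OF t] by (intro add_left_mono mult_left_mono) auto
  also have "\<dots> \<le> c + (4 * real n / (1 - d / v)) ^ n * t powr ((1 - d / v) / 2)"
    by (intro add_left_mono log_power_times_powr_le t \<delta>)
  finally show ?thesis .
qed

lemma excess_tendsto_0:
  assumes n: "1 \<le> n"
  shows "(excess n \<longlongrightarrow> 0) (at_right 0)"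
proof (rule order_tendstoI)
  fix e :: real assume "e < 0"
  then show "\<forall>\<^sub>F t in at_right 0. e < excess n t" by (intro always_eventually allI less_le_trans[OF _ excess_nonneg])
next
  fix e :: real assume e: "0 < e"
  define \<epsilon> where "\<epsilon> = root n (e / 2)"
  have \<epsilon>: "0 < \<epsilon>" "\<epsilon> ^ n = e / 2" using e n by (auto simp: \<epsilon>_def)
  let ?v = "d + \<epsilon>"
  have \<delta>: "0 < 1 - d / ?v" using \<epsilon> d_ge_1 by (simp add: field_simps)
  have "((\<lambda>t. (4 * real n / (1 - d / ?v)) ^ n * t powr ((1 - d / ?v) / 2)) \<longlongrightarrow>
      (4 * real n / (1 - d / ?v)) ^ n * 0 powr ((1 - d / ?v) / 2)) (at_right 0)"
    using \<delta> by (intro tendsto_mult tendsto_const tendsto_powr' tendsto_ident_at)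
       (auto simp: eventually_at_filter)
  then have "\<forall>\<^sub>F t in at_right 0. (4 * real n / (1 - d / ?v)) ^ n * t powr ((1 - d / ?v) / 2) < e / 2"
    using e by (intro order_tendstoD(2)) auto
  with eventually_at_right_unit show "\<forall>\<^sub>F t in at_right 0. excess n t < e"
  proof eventually_elim
    case (elim t)
    have "excess n t \<le> \<epsilon> ^ n + (4 * real n / (1 - d / ?v)) ^ n * t powr ((1 - d / ?v) / 2)"
      unfolding excess_def
    proof (rule integral_le_split)
      fix y :: real assume "y < d + \<epsilon>" "0 < y"
      then show "max (y - d) 0 ^ n \<le> \<epsilon> ^ n" using \<epsilon> by (intro power_mono) auto
    next
      fix y :: real assume "0 < y"
      then show "max (y - d) 0 ^ n \<le> y ^ n" using d_ge_1 by (intro power_mono) auto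
    qed (use elim \<epsilon> in auto)
    with elim \<epsilon> show ?case by linarith
  qed
qed

lemma moments_bounded:
  assumes t: "0 < t" "t < 1"
  shows "(\<integral>x. dim_est \<nu> t x ^ n \<partial>\<nu>) \<le> (d + 1) ^ n + (4 * real n / (1 - d / (d + 1))) ^ n"
proof -
  have \<delta>: "0 < 1 - d / (d + 1)" using d_ge_1 by (simp add: field_simps)
  have "(\<integral>x. dim_est \<nu> t x ^ n \<partial>\<nu>) \<le> (d + 1) ^ n +
      (4 * real n / (1 - d / (d + 1))) ^ n * t powr ((1 - d / (d + 1)) / 2)"
    using d_ge_1 by (intro integral_le_split t) (auto intro!: power_mono)
  also have "\<dots> \<le> (d + 1) ^ n + (4 * real n / (1 - d / (d + 1))) ^ n * 1"
    using t \<delta> by (intro add_left_mono mult_left_mono powr_le1) auto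
  finally show ?thesis by simp
qed

lemma ex_moment_bound:
  "\<exists>B. \<forall>t. 0 < t \<and> t \<le> 1 / 2 \<longrightarrow>
    integrable \<nu> (\<lambda>x. dim_est \<nu> t x ^ n) \<and> (\<integral>x. dim_est \<nu> t x ^ n \<partial>\<nu>) \<le> B"
proof (intro exI allI impI)
  fix t :: real assume "0 < t \<and> t \<le> 1 / 2"
  then have t: "0 < t" "t < 1" by auto
  show "integrable \<nu> (\<lambda>x. dim_est \<nu> t x ^ n) \<and> (\<integral>x. dim_est \<nu> t x ^ n \<partial>\<nu>) \<le>
      (d + 1) ^ n + (4 * real n / (1 - d / (d + 1))) ^ n"
    using integrable_dim_est[OF t, of "\<lambda>y. y ^ n"] moments_bounded[OF t] by blast
qed

lemma rate_bound_tendsto: "(rate_bound a C \<longlongrightarrow> a) (at_right 0)"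
  unfolding rate_bound_def[abs_def] depth_bound_def using a by real_asymp

lemma mean_depth_ge_1:
  assumes t: "0 < t" "t < 1"
  shows "1 \<le> mean_depth \<nu> t"
proof -
  have "(\<integral>x. 1 \<partial>\<nu>) \<le> mean_depth \<nu> t"
    unfolding mean_depth_def using stop_time_ge_1[OF t]
    by (intro integral_mono integrable_stop_time[OF t]) (auto simp: Suc_le_eq)
  then show ?thesis by (simp add: prob_space[simplified])
qed

lemma D_est_pos: "0 < t \<Longrightarrow> t < 1 \<Longrightarrow> 0 < D t"
  unfolding D_est_def using mean_depth_ge_1[of t] by (intro divide_pos_pos) auto

lemma integral_inverse_dim_est: "(\<integral>x. inverse (dim_est \<nu> t x) \<partial>\<nu>) = inverse (D t)"
  by (simp add: dim_est_def D_est_def mean_depth_def)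

lemma h_est_pos:
  assumes t: "0 < t" "t < 1"
  shows "0 < h t"
proof -
  have "(\<integral>x. rate_bound a C t \<partial>\<nu>) \<le> h t"
    unfolding h_est_def using rate_bound_le_dim_est[OF t]
    by (intro integral_mono integrable_dim_est[OF t, of "\<lambda>y. y"]) auto
  then show ?thesis using rate_bound_pos[OF t] by (simp add: prob_space[simplified])
qed

text \<open>Expanding \<open>(y - c)\<^sup>2 / y = y - 2 c + c\<^sup>2 / y\<close> leaves only the
  arithmetic mean \<open>h\<close> and the harmonic mean \<open>D\<close>. Taking
  \<open>c = D t\<close> gives \<open>h t - D t\<close>, and \<open>c = h t\<close> gives
  \<open>(h t - D t) h t / D t\<close>; these are the two exact representations.\<close>

lemma integral_sq_dev_over:
  assumes t: "0 < t" "t < 1"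
  shows "(\<integral>x. (dim_est \<nu> t x - c)\<^sup>2 / dim_est \<nu> t x \<partial>\<nu>) = h t - 2 * c + c\<^sup>2 / D t"
proof -
  have "(\<integral>x. (dim_est \<nu> t x - c)\<^sup>2 / dim_est \<nu> t x \<partial>\<nu>) =
      (\<integral>x. (dim_est \<nu> t x - 2 * c) + c\<^sup>2 * inverse (dim_est \<nu> t x) \<partial>\<nu>)"
  proof (intro Bochner_Integration.integral_cong refl)
    fix x
    show "(dim_est \<nu> t x - c)\<^sup>2 / dim_est \<nu> t x = (dim_est \<nu> t x - 2 * c) + c\<^sup>2 * inverse (dim_est \<nu> t x)"
      using dim_est_pos[OF t, of x] by (simp add: field_simps power2_eq_square)
  qed
  also have "\<dots> = (\<integral>x. dim_est \<nu> t x - 2 * c \<partial>\<nu>) + (\<integral>x. c\<^sup>2 * inverse (dim_est \<nu> t x) \<partial>\<nu>)"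
    by (intro Bochner_Integration.integral_add integrable_dim_est[OF t])
  also have "(\<integral>x. dim_est \<nu> t x - 2 * c \<partial>\<nu>) = h t - 2 * c"
    using integrable_dim_est[OF t, of "\<lambda>y. y"] by (simp add: h_est_def prob_space[simplified])
  also have "(\<integral>x. c\<^sup>2 * inverse (dim_est \<nu> t x) \<partial>\<nu>) = c\<^sup>2 / D t"
    by (simp add: integral_inverse_dim_est divide_inverse)
  finally show ?thesis .
qed

lemma h_minus_D:
  assumes t: "0 < t" "t < 1"
  shows "h t - D t = (\<integral>x. (dim_est \<nu> t x - D t)\<^sup>2 / dim_est \<nu> t x \<partial>\<nu>)"
    and "h t - D t =
      D t / h t * (\<integral>x. (dim_est \<nu> t x - h t)\<^sup>2 / dim_est \<nu> t x \<partial>\<nu>)"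
  unfolding integral_sq_dev_over[OF t] using D_est_pos[OF t] h_est_pos[OF t]
  by (simp_all add: field_simps power2_eq_square)

lemma D_est_le_h_est:
  assumes t: "0 < t" "t < 1"
  shows "D t \<le> h t"
proof -
  have "0 \<le> h t - D t"
    unfolding h_minus_D(1)[OF t] using dim_est_pos[OF t]
    by (intro integral_nonneg_AE AE_I2) (auto simp: less_imp_le)
  then show ?thesis by simp
qed

lemma rate_bound_le_D_est:
  assumes t: "0 < t" "t < 1"
  shows "rate_bound a C t \<le> D t"
proof -
  have "mean_depth \<nu> t \<le> (\<integral>x. depth_bound a C t \<partial>\<nu>)"
    unfolding mean_depth_def by (intro integral_mono integrable_stop_time[OF t]) (auto intro!: stop_time_le t)
  then have "mean_depth \<nu> t \<le> depth_bound a C t" by (simp add: prob_space[simplified])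
  then show ?thesis
    unfolding rate_bound_def D_est_def
    using sigma_pos[OF t] mean_depth_ge_1[OF t] depth_bound_ge_1[OF t]
    by (intro divide_left_mono mult_pos_pos) auto
qed

lemma h_est_le:
  assumes t: "0 < t" "t < 1"
  shows "h t \<le> d + excess 1 t"
proof -
  have "h t \<le> (\<integral>x. d + max (dim_est \<nu> t x - d) 0 \<partial>\<nu>)"
    unfolding h_est_def
    by (intro integral_mono integrable_dim_est[OF t, of "\<lambda>y. y"] integrable_dim_est[OF t, of "\<lambda>y. d + max (y - d) 0"]) auto
  also have "\<dots> = d + excess 1 t"
    unfolding excess_def using integrable_dim_est[OF t, of "\<lambda>y. max (y - d) 0"]
    by (simp add: prob_space[simplified])
  finally show ?thesis .
qed

lemma h_minus_D_lower:
  assumes t: "0 < t" "t < 1"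
  shows "D t / h t * (V t / d - eps_est \<nu> t) \<le> h t - D t"
proof -
  let ?h = "h t"
  \<comment> \<open>Convexity of \<open>1 / y\<close>: above \<open>d\<close> the graph lies over
    its tangent at \<open>d\<close>, below \<open>d\<close> it lies over the constant
    \<open>1 / d\<close>. The slope of the tangent accounts for the prefactor
    \<open>1 / d\<^sup>2\<close> of \<open>eps_est\<close>.\<close>
  have tangent: "1 / d - max (y - d) 0 / d\<^sup>2 \<le> 1 / y" if "0 < y" for y
  proof (cases "y \<le> d")
    case True
    then show ?thesis using that by (simp add: frac_le)
  next
    case False
    have "(y - d)\<^sup>2 \<ge> 0" by simp
    then show ?thesis using that False d_ge_1
      by (simp add: field_simps power2_eq_square)
  qed
  have "V t / d - eps_est \<nu> t =
      (\<integral>x. (dim_est \<nu> t x - ?h)\<^sup>2 / d - (dim_est \<nu> t x - ?h)\<^sup>2 * max (dim_est \<nu> t x - d) 0 / d\<^sup>2 \<partial>\<nu>)"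
    unfolding V_est_def mvar_def h_est_def[symmetric] eps_est_def dim[symmetric]
    using integrable_dim_est[OF t, of "\<lambda>y. (y - ?h)\<^sup>2 / d"]
      integrable_dim_est[OF t, of "\<lambda>y. (y - ?h)\<^sup>2 * max (y - d) 0 / d\<^sup>2"]
    by (subst Bochner_Integration.integral_diff) auto
  also have "\<dots> \<le> (\<integral>x. (dim_est \<nu> t x - ?h)\<^sup>2 / dim_est \<nu> t x \<partial>\<nu>)"
  proof (intro integral_mono integrable_dim_est[OF t])
    fix x
    have "(dim_est \<nu> t x - ?h)\<^sup>2 * (1 / d - max (dim_est \<nu> t x - d) 0 / d\<^sup>2) \<le>
        (dim_est \<nu> t x - ?h)\<^sup>2 * (1 / dim_est \<nu> t x)"
      by (intro mult_left_mono tangent dim_est_pos t) auto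
    then show "(dim_est \<nu> t x - ?h)\<^sup>2 / d - (dim_est \<nu> t x - ?h)\<^sup>2 * max (dim_est \<nu> t x - d) 0 / d\<^sup>2 \<le>
        (dim_est \<nu> t x - ?h)\<^sup>2 / dim_est \<nu> t x"
      by (simp add: right_diff_distrib)
  qed
  finally show ?thesis
    unfolding h_minus_D(2)[OF t] using D_est_pos[OF t] h_est_pos[OF t]
    by (intro mult_left_mono) auto
qed

lemma h_minus_D_upper:
  assumes t: "0 < t" "t < 1"
  shows "h t - D t \<le> D t / h t * (V t / rate_bound a C t)"
proof -
  let ?h = "h t"
  have "(\<integral>x. (dim_est \<nu> t x - ?h)\<^sup>2 / dim_est \<nu> t x \<partial>\<nu>) \<le> (\<integral>x. (dim_est \<nu> t x - ?h)\<^sup>2 / rate_bound a C t \<partial>\<nu>)"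
    using rate_bound_le_dim_est[OF t] rate_bound_pos[OF t] dim_est_pos[OF t]
    by (intro integral_mono integrable_dim_est[OF t] divide_left_mono mult_pos_pos) auto
  also have "\<dots> = V t / rate_bound a C t"
    by (simp add: V_est_def mvar_def h_est_def)
  finally show ?thesis
    unfolding h_minus_D(2)[OF t] using D_est_pos[OF t] h_est_pos[OF t]
    by (intro mult_left_mono) auto
qed

lemma V_est_nonneg: "0 \<le> V t"
  unfolding V_est_def mvar_def by (intro integral_nonneg_AE) auto

lemma eps_est_nonneg: "0 \<le> eps_est \<nu> t"
  unfolding eps_est_def by (intro mult_nonneg_nonneg integral_nonneg_AE) auto

text \<open>The deviation is split at \<open>d\<close>: it is \<open>u + (d - h t)\<close> with
  \<open>u\<close> the excess over \<open>d\<close>, and the distance of \<open>h t\<close> from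
  \<open>d\<close> is at most \<open>d + excess 1 t\<close>. The integrand thus reduces to first and
  third powers of the excess.\<close>

lemma eps_est_le:
  assumes t: "0 < t" "t < 1"
  shows "eps_est \<nu> t \<le> 1 / d\<^sup>2 * (2 * excess 3 t + 2 * (d + excess 1 t)\<^sup>2 * excess 1 t)"
proof -
  let ?h = "h t" and ?c = "2 * (d + excess 1 t)\<^sup>2"
  have "(\<integral>x. (dim_est \<nu> t x - ?h)\<^sup>2 * max (dim_est \<nu> t x - d) 0 \<partial>\<nu>) \<le>
      (\<integral>x. 2 * max (dim_est \<nu> t x - d) 0 ^ 3 + ?c * max (dim_est \<nu> t x - d) 0 ^ 1 \<partial>\<nu>)"
  proof (intro integral_mono integrable_dim_est[OF t])
    fix x
    define u where "u = max (dim_est \<nu> t x - d) 0"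
    have u: "0 \<le> u" by (simp add: u_def)
    have "(d - ?h)\<^sup>2 \<le> (d + excess 1 t)\<^sup>2"
      using h_est_pos[OF t] h_est_le[OF t] excess_nonneg[of 1 t] d_ge_1
      by (intro power2_le_iff_abs_le[THEN iffD2]) auto
    moreover have "0 \<le> (u - (d - ?h))\<^sup>2" by simp
    then have "(u + (d - ?h))\<^sup>2 \<le> 2 * u\<^sup>2 + 2 * (d - ?h)\<^sup>2"
      by (simp add: power2_eq_square algebra_simps)
    ultimately have "(u + (d - ?h))\<^sup>2 * u \<le> (2 * u\<^sup>2 + ?c) * u"
      using u by (intro mult_right_mono) auto
    \<comment> \<open>Below \<open>d\<close> the deviation is not \<open>u + (d - h t)\<close>, but
      there the factor \<open>u\<close> is 0.\<close>
    moreover have "(dim_est \<nu> t x - ?h)\<^sup>2 * u = (u + (d - ?h))\<^sup>2 * u"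
      by (cases "u = 0") (auto simp: u_def max_def split: if_splits)
    ultimately show "(dim_est \<nu> t x - ?h)\<^sup>2 * u \<le> 2 * u ^ 3 + ?c * u ^ 1"
      by (simp add: power2_eq_square power3_eq_cube algebra_simps)
  qed
  also have "\<dots> = 2 * excess 3 t + ?c * excess 1 t"
    unfolding excess_def using integrable_dim_est[OF t, of "\<lambda>y. max (y - d) 0 ^ 3"]
      integrable_dim_est[OF t, of "\<lambda>y. max (y - d) 0 ^ 1"]
    by (subst Bochner_Integration.integral_add) auto
  finally show ?thesis
    unfolding eps_est_def dim[symmetric] by (intro mult_left_mono) auto
qed

lemma eps_est_tendsto_0: "(eps_est \<nu> \<longlongrightarrow> 0) (at_right 0)"
proof (rule tendsto_sandwich[OF _ _ tendsto_const])
  show "\<forall>\<^sub>F t in at_right 0. 0 \<le> eps_est \<nu> t" by (simp add: eps_est_nonneg)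
  show "\<forall>\<^sub>F t in at_right 0. eps_est \<nu> t \<le> 1 / d\<^sup>2 * (2 * excess 3 t + 2 * (d + excess 1 t)\<^sup>2 * excess 1 t)"
    using eventually_at_right_unit by eventually_elim (intro eps_est_le; simp)
  have "((\<lambda>t. 1 / d\<^sup>2 * (2 * excess 3 t + 2 * (d + excess 1 t)\<^sup>2 * excess 1 t)) \<longlongrightarrow>
     1 / d\<^sup>2 * (2 * 0 + 2 * (d + 0)\<^sup>2 * 0)) (at_right 0)"
    by (intro tendsto_intros excess_tendsto_0) auto
  then show "((\<lambda>t. 1 / d\<^sup>2 * (2 * excess 3 t + 2 * (d + excess 1 t)\<^sup>2 * excess 1 t)) \<longlongrightarrow> 0) (at_right 0)"
    by simp
qed

lemma V_upper_eq_0_iff_V_est: "V_upper \<nu> = 0 \<longleftrightarrow> (V \<longlongrightarrow> 0) (at_right 0)"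
  unfolding V_upper_def by (intro Limsup_ereal_eq_0_iff) (auto simp: V_est_nonneg)

text \<open>Variance and gap control each other because \<open>D t / h t\<close> stays between
  positive constants: it is at most 1 and, asymptotically, at least \<open>a / d\<close>.\<close>

lemma V_upper_eq_0_iff: "V_upper \<nu> = 0 \<longleftrightarrow> ((\<lambda>t. h t - D t) \<longlongrightarrow> 0) (at_right 0)"
  unfolding V_upper_eq_0_iff_V_est
proof
  assume V: "(V \<longlongrightarrow> 0) (at_right 0)"
  show "((\<lambda>t. h t - D t) \<longlongrightarrow> 0) (at_right 0)"
  proof (rule tendsto_sandwich[OF _ _ tendsto_const])
    show "\<forall>\<^sub>F t in at_right 0. 0 \<le> h t - D t"
      using eventually_at_right_unit by eventually_elim (simp add: D_est_le_h_est)
    show "\<forall>\<^sub>F t in at_right 0. h t - D t \<le> V t / rate_bound a C t"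
      using eventually_at_right_unit
    proof eventually_elim
      case (elim t)
      then have t: "0 < t" "t < 1" by auto
      have "h t - D t \<le> D t / h t * (V t / rate_bound a C t)"
        by (rule h_minus_D_upper[OF t])
      also have "\<dots> \<le> 1 * (V t / rate_bound a C t)"
        using D_est_le_h_est[OF t] h_est_pos[OF t] rate_bound_pos[OF t] V_est_nonneg[of t]
        by (intro mult_right_mono) auto
      finally show ?case by simp
    qed
    show "((\<lambda>t. V t / rate_bound a C t) \<longlongrightarrow> 0) (at_right 0)"
      using tendsto_divide[OF V rate_bound_tendsto] a by simp
  qed
next
  assume hD: "((\<lambda>t. h t - D t) \<longlongrightarrow> 0) (at_right 0)"
  show "(V \<longlongrightarrow> 0) (at_right 0)"
  proof (rule tendsto_sandwich[OF _ _ tendsto_const])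
    show "\<forall>\<^sub>F t in at_right 0. 0 \<le> V t" by (simp add: V_est_nonneg)
    show "\<forall>\<^sub>F t in at_right 0. V t \<le>
        d * ((h t - D t) * ((d + excess 1 t) / rate_bound a C t) + eps_est \<nu> t)"
      using eventually_at_right_unit
    proof eventually_elim
      case (elim t)
      then have t: "0 < t" "t < 1" by auto
      note pos = D_est_pos[OF t] h_est_pos[OF t] rate_bound_pos[OF t] d_ge_1
      have "V t / d - eps_est \<nu> t \<le> (h t - D t) * (h t / D t)"
        using h_minus_D_lower[OF t] pos by (simp add: field_simps)
      also have "\<dots> \<le> (h t - D t) * ((d + excess 1 t) / rate_bound a C t)"
        using pos D_est_le_h_est[OF t] h_est_le[OF t] rate_bound_le_D_est[OF t]
        by (intro mult_left_mono frac_le) auto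
      finally show ?case using pos by (simp add: field_simps)
    qed
    have "((\<lambda>t. d * ((h t - D t) * ((d + excess 1 t) / rate_bound a C t) + eps_est \<nu> t)) \<longlongrightarrow>
        d * (0 * ((d + 0) / a) + 0)) (at_right 0)"
      using a by (intro tendsto_intros hD excess_tendsto_0 rate_bound_tendsto eps_est_tendsto_0) auto
    then show "((\<lambda>t. d * ((h t - D t) * ((d + excess 1 t) / rate_bound a C t) + eps_est \<nu> t)) \<longlongrightarrow> 0) (at_right 0)"
      by simp
  qed
qed

end

section \<open>Comparing limits along different filters, and logarithmic quantization errors\<close>

text \<open>The map \<open>\<phi>\<close> pushes \<open>G\<close> into \<open>F\<close>, so the
  values \<open>f (\<phi> j)\<close> eventually lie above any number below the lower limit along
  \<open>F\<close>. Letting \<open>\<phi>\<close> depend on \<open>\<epsilon>\<close> makes it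
  possible to shift thresholds by amounts of order \<open>\<epsilon>\<close>.\<close>

lemma Liminf_ereal_mono_along:
  fixes f :: "'i \<Rightarrow> real" and g :: "'j \<Rightarrow> real"
  assumes "\<And>\<epsilon>. 0 < \<epsilon> \<Longrightarrow> \<exists>\<phi>. filterlim \<phi> F G \<and> (\<forall>\<^sub>F j in G. f (\<phi> j) - \<epsilon> \<le> g j)"
  shows "Liminf F (\<lambda>i. ereal (f i)) \<le> Liminf G (\<lambda>j. ereal (g j))"
  unfolding le_Liminf_iff
proof (intro allI impI)
  fix y assume "y < Liminf F (\<lambda>i. ereal (f i))"
  then obtain z where z: "y < ereal z" "ereal z < Liminf F (\<lambda>i. ereal (f i))"
    using ereal_dense2 by blast
  from ereal_dense2[OF z(2)] obtain w where w: "z < w" "ereal w < Liminf F (\<lambda>i. ereal (f i))"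
    by auto
  have "\<forall>\<^sub>F i in F. w < f i"
    using w(2) le_Liminf_iff[of "Liminf F (\<lambda>i. ereal (f i))" F "\<lambda>i. ereal (f i)"] by auto
  moreover obtain \<phi> where \<phi>: "filterlim \<phi> F G" "\<forall>\<^sub>F j in G. f (\<phi> j) - (w - z) \<le> g j"
    using assms[of "w - z"] w(1) by auto
  ultimately have "\<forall>\<^sub>F j in G. w < f (\<phi> j)"
    using eventually_compose_filterlim by blast
  with \<phi>(2) show "\<forall>\<^sub>F j in G. y < ereal (g j)"
  proof eventually_elim
    case (elim j)
    then have "ereal z < ereal (g j)" by simp
    with z(1) show ?case by (rule less_trans)
  qed
qed

lemma Limsup_ereal_mono_along:
  fixes f :: "'i \<Rightarrow> real" and g :: "'j \<Rightarrow> real"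
  assumes "\<And>\<epsilon>. 0 < \<epsilon> \<Longrightarrow> \<exists>\<phi>. filterlim \<phi> F G \<and> (\<forall>\<^sub>F j in G. g j \<le> f (\<phi> j) + \<epsilon>)"
  shows "Limsup G (\<lambda>j. ereal (g j)) \<le> Limsup F (\<lambda>i. ereal (f i))"
proof -
  have "Liminf F (\<lambda>i. ereal (- f i)) \<le> Liminf G (\<lambda>j. ereal (- g j))"
  proof (rule Liminf_ereal_mono_along)
    fix \<epsilon> :: real assume "0 < \<epsilon>"
    then obtain \<phi> where "filterlim \<phi> F G" "\<forall>\<^sub>F j in G. g j \<le> f (\<phi> j) + \<epsilon>" using assms by blast
    then show "\<exists>\<phi>. filterlim \<phi> F G \<and> (\<forall>\<^sub>F j in G. - f (\<phi> j) - \<epsilon> \<le> - g j)"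
      by (intro exI[of _ \<phi>]) (auto elim: eventually_mono)
  qed
  then show ?thesis
    using ereal_Liminf_uminus[of F "\<lambda>i. ereal (f i)"] ereal_Liminf_uminus[of G "\<lambda>i. ereal (g i)"] by simp
qed

lemma
  assumes "finite A" "A \<noteq> {}"
  shows max_dist_less_iff: "max_dist x A < r \<longleftrightarrow> (\<exists>y\<in>A. infnorm (x - y) < r)"
    and max_dist_le: "y \<in> A \<Longrightarrow> max_dist x A \<le> infnorm (x - y)"
    and max_dist_nonneg: "0 \<le> max_dist x A"
proof -
  have eq: "max_dist x A = Min ((\<lambda>y. infnorm (x - y)) ` A)"
    unfolding max_dist_def using assms by (intro cInf_eq_Min) auto
  have ne: "finite ((\<lambda>y. infnorm (x - y)) ` A)" "(\<lambda>y. infnorm (x - y)) ` A \<noteq> {}"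
    using assms by auto
  show "max_dist x A < r \<longleftrightarrow> (\<exists>y\<in>A. infnorm (x - y) < r)"
    unfolding eq Min_less_iff[OF ne] by auto
  show "y \<in> A \<Longrightarrow> max_dist x A \<le> infnorm (x - y)"
    unfolding eq by (rule Min_le[OF ne(1)]) auto
  show "0 \<le> max_dist x A"
    unfolding eq Min_ge_iff[OF ne] by (auto simp: infnorm_pos_le)
qed

lemma max_dist_borel:
  assumes "finite A" "A \<noteq> {}"
  shows "(\<lambda>x. max_dist x A) \<in> borel_measurable borel"
  unfolding borel_measurable_iff_less
proof (intro allI)
  fix r
  have "{x \<in> space borel. max_dist x A < r} = (\<Union>y\<in>A. {x. infnorm (x - y) < r})"
    using max_dist_less_iff[OF assms] by auto
  moreover have "open {x. infnorm (x - y) < r}" for y :: "real ^ 'a"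
    by (intro open_Collect_less continuous_intros)
  ultimately show "{x \<in> space borel. max_dist x A < r} \<in> sets borel"
    using assms by (auto intro!: borel_open open_UN)
qed

context frostman_measure
begin

lemma prob_near_less:
  assumes t: "0 < t"
  shows "prob {x. infnorm (x - y) < 1 / 2 ^ m \<and> mass m x < t} \<le> 3 ^ CARD('n) * min t (C * 2 powr (- a * real m))"
proof -
  let ?b = "min t (C * 2 powr (- a * real m))"
  let ?Z = "{z \<in> nearby m y \<inter> indices m. measure \<nu> (cell m z) < t}"
  have "x \<in> (\<Union>z\<in>?Z. cell m z)"
    if "x \<in> cbox 0 1" "infnorm (x - y) < 1 / 2 ^ m" "mass m x < t" for x
    using that cell_index_nearby[of x y m] mem_cell_index[of x m] by (auto simp: mass_eq)
  then have "prob {x. infnorm (x - y) < 1 / 2 ^ m \<and> mass m x < t} \<le> prob (\<Union>z\<in>?Z. cell m z)"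
    using AE_cube by (intro finite_measure_mono_AE) auto
  also have "\<dots> \<le> (\<Sum>z\<in>?Z. prob (cell m z))"
    by (intro finite_measure_subadditive_finite) auto
  also have "\<dots> \<le> (\<Sum>z\<in>?Z. ?b)"
    by (intro sum_mono) (auto intro!: frostman[simplified] simp: dyadic_cubes_eq)
  also have "\<dots> \<le> real (card (nearby m y)) * ?b"
    using t C by (auto intro!: mult_right_mono card_mono)
  also have "\<dots> \<le> real (3 ^ CARD('n)) * ?b"
    using card_nearby[of m y] t C by (intro mult_right_mono) (auto simp del: of_nat_power)
  finally show ?thesis by simp
qed

lemma max_dist_measurable:
  assumes "finite A" "A \<noteq> {}"
  shows "(\<lambda>x. max_dist x A) \<in> borel_measurable \<nu>"
  using max_dist_borel[OF assms] by (simp add: measurable_cong_sets[OF borel refl])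

lemma infnorm_ball_sets [measurable]: "{x. infnorm (x - y) < r} \<in> sets \<nu>" for y :: "real ^ 'n"
proof -
  have "open {x. infnorm (x - y) < r}" by (intro open_Collect_less continuous_intros)
  then show ?thesis by (simp add: borel)
qed

lemma prob_max_dist_less:
  assumes A: "finite A" "A \<noteq> {}" and t: "0 < t"
  shows "prob {x. max_dist x A < 1 / 2 ^ m \<and> mass m x < t} \<le>
    real (card A) * 3 ^ CARD('n) * min t (C * 2 powr (- a * real m))"
proof -
  have s: "{x. infnorm (x - y) < 1 / 2 ^ m \<and> mass m x < t} \<in> sets \<nu>" for y :: "real ^ 'n"
  proof -
    have "{x. infnorm (x - y) < 1 / 2 ^ m} \<inter> {x. mass m x < t} \<in> sets \<nu>"
      by (intro sets.Int infnorm_ball_sets pred_imp_sets) measurable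
    then show ?thesis by (simp add: Collect_conj_eq)
  qed
  have "{x. max_dist x A < 1 / 2 ^ m \<and> mass m x < t} = (\<Union>y\<in>A. {x. infnorm (x - y) < 1 / 2 ^ m \<and> mass m x < t})"
    using max_dist_less_iff[OF A] by auto
  then have "prob {x. max_dist x A < 1 / 2 ^ m \<and> mass m x < t} \<le>
      (\<Sum>y\<in>A. prob {x. infnorm (x - y) < 1 / 2 ^ m \<and> mass m x < t})"
    using A s by (auto intro!: finite_measure_subadditive_finite)
  also have "\<dots> \<le> (\<Sum>y\<in>A. 3 ^ CARD('n) * min t (C * 2 powr (- a * real m)))"
    by (intro sum_mono prob_near_less t)
  finally show ?thesis by simp
qed

text \<open>Value of the geometric series of ratio \<open>2 powr (- a)\<close>: the contribution of
  all levels beyond \<open>depth_bound\<close>, in units of \<open>t\<close>.\<close>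

definition kappa :: real where "kappa = 1 / (1 - 2 powr (- a))"

lemma two_powr_neg_a: "0 < 2 powr (- a)" "2 powr (- a) < 1"
  using a powr_less_mono[of "- a" 0 2] by auto

text \<open>The two bounds cross near level \<open>depth_bound\<close>. Up to there each level costs
  at most \<open>t\<close>; beyond it the Frostman bound starts below \<open>t\<close> and decays
  geometrically.\<close>

lemma suminf_min_le:
  assumes t: "0 < t" "t < 1"
  shows "summable (\<lambda>m. min t (C * 2 powr (- a * real m)))"
    and "(\<Sum>m. min t (C * 2 powr (- a * real m))) \<le> t * (depth_bound a C t + kappa)"
proof -
  let ?f = "\<lambda>m. min t (C * 2 powr (- a * real m))"
  have geo: "2 powr (- a * real m) = (2 powr (- a)) ^ m" for m
    by (simp add: powr_powr powr_realpow[symmetric])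
  have sum_geo: "summable (\<lambda>m. (2 powr (- a)) ^ m)" "(\<Sum>m. (2 powr (- a)) ^ m) = kappa"
    using two_powr_neg_a unfolding kappa_def by (auto intro!: summable_geometric suminf_geometric)
  show f: "summable ?f"
    by (rule summable_comparison_test'[OF summable_mult[OF sum_geo(1), of C]])
       (use t C in \<open>auto simp: geo[symmetric]\<close>)
  let ?y = "(\<sigma> t + log 2 C) / a"
  define J where "J = nat \<lfloor>?y\<rfloor> + 1"
  have "0 \<le> ?y" using t C a by simp
  then have J: "?y < real J" "real J \<le> 1 + ?y" unfolding J_def by linarith+
  have "?f (m + J) \<le> t * (2 powr (- a)) ^ m" for m
  proof -
    have "C * 2 powr (- a * real J) \<le> t"
      using mass_less_of_large[OF t(1) J(1)] by simp
    then have "C * 2 powr (- a * real J) * 2 powr (- a * real m) \<le> t * 2 powr (- a * real m)"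
      by (intro mult_right_mono) auto
    moreover have "C * 2 powr (- a * real (m + J)) = C * 2 powr (- a * real J) * 2 powr (- a * real m)"
      by (simp add: powr_add[symmetric] algebra_simps)
    ultimately show ?thesis unfolding geo[symmetric] by linarith
  qed
  then have "(\<Sum>m. ?f (m + J)) \<le> (\<Sum>m. t * (2 powr (- a)) ^ m)"
    by (intro suminf_le summable_mult sum_geo summable_ignore_initial_segment f)
  also have "\<dots> = t * kappa" unfolding suminf_mult[OF sum_geo(1)] sum_geo(2) ..
  finally have tail: "(\<Sum>m. ?f (m + J)) \<le> t * kappa" .
  have "(\<Sum>m<J. ?f m) \<le> (\<Sum>m<J. t)" by (intro sum_mono) simp
  also have "\<dots> \<le> t * depth_bound a C t"
    using J(2) t unfolding depth_bound_def by (simp add: mult.commute)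
  finally have "(\<Sum>m<J. ?f m) \<le> t * depth_bound a C t" .
  with tail show "(\<Sum>m. ?f m) \<le> t * (depth_bound a C t + kappa)"
    using suminf_split_initial_segment[OF f, of J] by (simp add: distrib_left)
qed

text \<open>The amount by which the mean of the negative logarithmic distance to \<open>N\<close>
  points can exceed the mean depth. It is small compared with \<open>\<sigma> t\<close> as soon as
  \<open>N t\<close> tends to 0.\<close>

definition quant_slack :: "nat \<Rightarrow> real \<Rightarrow> real" where
  "quant_slack N t = real N * 3 ^ CARD('n) * (t * (depth_bound a C t + kappa))"

text \<open>Where \<open>-log\<^sub>2 d(x, A)\<close> exceeds the stopping time, the excess counts the levels \<open>m\<close> at which
  \<open>x\<close> is \<open>2\<^sup>-\<^sup>m\<close>-close to \<open>A\<close> although its level \<open>m\<close> cube is already light.\<close>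

lemma nn_integral_neg_log_max_dist:
  assumes A: "finite A" "A \<noteq> {}" and t: "0 < t" "t < 1"
  shows "(\<integral>\<^sup>+x. ennreal (- log 2 (max_dist x A)) \<partial>\<nu>) \<le> ennreal (mean_depth \<nu> t + quant_slack (card A) t)"
proof -
  let ?B = "\<lambda>m. {x. max_dist x A < 1 / 2 ^ m \<and> mass m x < t}"
  let ?c = "real (card A) * 3 ^ CARD('n)"
  have [measurable]: "(\<lambda>x. max_dist x A) \<in> borel_measurable \<nu>" by (rule max_dist_measurable[OF A])
  have B [measurable]: "?B m \<in> sets \<nu>" for m by (intro pred_imp_sets) measurable
  have pointwise: "ennreal (- log 2 (max_dist x A)) \<le> ennreal (real (stop_time \<nu> t x)) + (\<Sum>m. indicator (?B m) x)" for x
  proof (cases "- log 2 (max_dist x A) \<le> real (stop_time \<nu> t x)")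
    case True
    then have "ennreal (- log 2 (max_dist x A)) \<le> ennreal (real (stop_time \<nu> t x))" by (rule ennreal_leI)
    then show ?thesis by (rule order_trans) simp
  next
    case False
    define f where "f = - log 2 (max_dist x A)"
    define T where "T = stop_time \<nu> t x"
    \<comment> \<open>The last integer strictly below \<open>f\<close>. The levels from
      \<open>T\<close> to \<open>M\<close> number \<open>M + 1 - T\<close>, which is at least
      \<open>f - T\<close>.\<close>
    define M where "M = nat \<lceil>f\<rceil> - 1"
    have T: "1 \<le> T" "real T < f" using False stop_time_ge_1[OF t, of x] by (auto simp: f_def T_def)
    then have M: "T \<le> M" "real M < f" "f \<le> real M + 1" unfolding M_def by linarith+
    \<comment> \<open>By \<open>ln 0 = 0\<close> a point of \<open>A\<close> would have
      \<open>f = 0\<close>, below any stopping time.\<close>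
    have "max_dist x A > 0"
      using T max_dist_nonneg[OF A, of x] by (cases "max_dist x A = 0") (auto simp: f_def log_def)
    then have "max_dist x A = 2 powr (- f)" by (simp add: f_def)
    moreover have "2 powr (- f) < 1 / 2 ^ m" if "m \<le> M" for m
    proof -
      have "real m < f" using that M(2) by linarith
      then have "2 powr (- f) < 2 powr (- real m)" by (intro powr_less_mono) auto
      then show ?thesis by (simp add: powr_minus_divide powr_realpow)
    qed
    moreover have "mass m x < t" if "T \<le> m" for m
      using mass_stop_time[OF t, of x] mass_antimono[OF that, of x] by (simp add: T_def)
    ultimately have ind: "indicator (?B m) x = (1 :: ennreal)" if "m \<in> {T..M}" for m
      using that by auto
    have "ennreal f \<le> ennreal (real T + real (card {T..M}))"
      using M by (intro ennreal_leI) (auto simp: of_nat_diff)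
    also have "\<dots> = ennreal (real T) + (\<Sum>m\<in>{T..M}. indicator (?B m) x)"
      by (simp add: ind ennreal_plus ennreal_of_nat_eq_real_of_nat del: card_atLeastAtMost)
    also have "\<dots> \<le> ennreal (real T) + (\<Sum>m. indicator (?B m) x)"
      by (intro add_left_mono sum_le_suminf) auto
    finally show ?thesis by (simp add: f_def T_def)
  qed
  have "(\<integral>\<^sup>+x. ennreal (- log 2 (max_dist x A)) \<partial>\<nu>) \<le>
      (\<integral>\<^sup>+x. ennreal (real (stop_time \<nu> t x)) + (\<Sum>m. indicator (?B m) x) \<partial>\<nu>)"
    by (intro nn_integral_mono pointwise)
  also have "\<dots> = (\<integral>\<^sup>+x. ennreal (real (stop_time \<nu> t x)) \<partial>\<nu>) + (\<integral>\<^sup>+x. (\<Sum>m. indicator (?B m) x) \<partial>\<nu>)"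
    by (intro nn_integral_add) measurable
  also have "(\<integral>\<^sup>+x. ennreal (real (stop_time \<nu> t x)) \<partial>\<nu>) = ennreal (mean_depth \<nu> t)"
    unfolding mean_depth_def by (intro nn_integral_eq_integral integrable_stop_time t) auto
  also have "(\<integral>\<^sup>+x. (\<Sum>m. indicator (?B m) x) \<partial>\<nu>) = (\<Sum>m. \<integral>\<^sup>+x. indicator (?B m) x \<partial>\<nu>)"
    by (intro nn_integral_suminf) measurable
  also have "\<dots> = (\<Sum>m. ennreal (prob (?B m)))"
    by (simp add: emeasure_eq_measure)
  also have "\<dots> \<le> (\<Sum>m. ennreal (?c * min t (C * 2 powr (- a * real m))))"
    by (intro suminf_le ennreal_leI prob_max_dist_less A t) auto
  also have "\<dots> = ennreal (\<Sum>m. ?c * min t (C * 2 powr (- a * real m)))"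
    using t C by (intro suminf_ennreal2 summable_mult suminf_min_le t) auto
  also have "(\<Sum>m. ?c * min t (C * 2 powr (- a * real m))) = ?c * (\<Sum>m. min t (C * 2 powr (- a * real m)))"
    by (intro suminf_mult suminf_min_le t)
  also have "ennreal (mean_depth \<nu> t) + ennreal (?c * (\<Sum>m. min t (C * 2 powr (- a * real m)))) \<le>
      ennreal (mean_depth \<nu> t) + ennreal (?c * (t * (depth_bound a C t + kappa)))"
    by (intro add_left_mono ennreal_leI mult_left_mono suminf_min_le t) auto
  also have "\<dots> = ennreal (mean_depth \<nu> t + quant_slack (card A) t)"
    using mean_depth_ge_1[OF t] depth_bound_ge_1[OF t] t two_powr_neg_a
    unfolding quant_slack_def by (intro ennreal_plus[symmetric]) (auto simp: kappa_def)
  finally show ?thesis by (simp add: add_left_mono)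
qed

text \<open>The logarithm of the distance is bounded above on the unit cube, and its negative part
  has a finite integral by the preceding bound, at any single \<open>t\<close>. Hence the integrals
  inside \<open>quant_err\<close> are genuine and the default value 0 of a non-integrable function
  never interferes.\<close>

lemma
  assumes A: "finite A" "A \<noteq> {}"
  shows integrable_log_max_dist: "integrable \<nu> (\<lambda>x. log 2 (max_dist x A))"
    and integral_log_max_dist_ge: "\<And>t. 0 < t \<Longrightarrow> t < 1 \<Longrightarrow>
      - (\<integral>x. log 2 (max_dist x A) \<partial>\<nu>) \<le> mean_depth \<nu> t + quant_slack (card A) t"
proof -
  have [measurable]: "(\<lambda>x. max_dist x A) \<in> borel_measurable \<nu>" by (rule max_dist_measurable[OF A])
  obtain y where y: "y \<in> A" using A by auto
  \<comment> \<open>Bounds the distance from any point of the unit cube to \<open>y\<close>. Since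
    \<open>R \<ge> 1\<close>, its logarithm is nonnegative, which also settles points at distance
    0.\<close>
  define R where "R = 1 + infnorm y"
  have R: "1 \<le> R" by (simp add: R_def infnorm_pos_le)
  let ?f = "\<lambda>x. - log 2 (max_dist x A)"
  have lower: "- log 2 R \<le> ?f x" if x: "x \<in> cbox 0 1" for x
  proof -
    have "infnorm x \<le> 1" using x by (intro infnorm_le_cart) (auto simp: mem_box_cart)
    then have "infnorm (x - y) \<le> R"
      using infnorm_triangle[of x "- y"] by (simp add: R_def infnorm_neg)
    then have le: "max_dist x A \<le> R" using max_dist_le[OF A y, of x] by simp
    show ?thesis
    proof (cases "max_dist x A = 0")
      case True
      then show ?thesis using R by (simp add: log_def)
    next
      case False
      then show ?thesis using le R max_dist_nonneg[OF A, of x] by simp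
    qed
  qed
  have fin: "(\<integral>\<^sup>+x. ennreal (?f x) \<partial>\<nu>) < \<infinity>"
    using nn_integral_neg_log_max_dist[OF A, of "1/2"] by (auto intro: le_less_trans)
  have "integrable \<nu> (\<lambda>x. ?f x + log 2 R)"
  proof (rule integrableI_nonneg)
    show "AE x in \<nu>. 0 \<le> ?f x + log 2 R" using AE_cube lower by fastforce
    have "(\<integral>\<^sup>+x. ennreal (?f x + log 2 R) \<partial>\<nu>) \<le> (\<integral>\<^sup>+x. ennreal (?f x) + ennreal (log 2 R) \<partial>\<nu>)"
    proof (intro nn_integral_mono)
      fix x
      show "ennreal (?f x + log 2 R) \<le> ennreal (?f x) + ennreal (log 2 R)"
        using R by (cases "0 \<le> ?f x") (auto simp: ennreal_plus[symmetric] ennreal_neg intro!: ennreal_leI simp del: ennreal_plus)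
    qed
    also have "\<dots> = (\<integral>\<^sup>+x. ennreal (?f x) \<partial>\<nu>) + ennreal (log 2 R)"
      by (subst nn_integral_add) (auto simp: emeasure_space_1[simplified])
    also have "\<dots> < \<infinity>" using fin by simp
    finally show "(\<integral>\<^sup>+x. ennreal (?f x + log 2 R) \<partial>\<nu>) < \<infinity>" .
  qed measurable
  then have "integrable \<nu> (\<lambda>x. (?f x + log 2 R) - log 2 R)"
    by (intro Bochner_Integration.integrable_diff) auto
  then have f: "integrable \<nu> ?f" by simp
  then show int: "integrable \<nu> (\<lambda>x. log 2 (max_dist x A))" by simp
  fix t :: real assume t: "0 < t" "t < 1"
  \<comment> \<open>The nonnegative integral sees only the positive part of \<open>?f\<close>; this
    suffices because the positive part dominates \<open>?f\<close>.\<close>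
  have g: "integrable \<nu> (\<lambda>x. max (?f x) 0)" using f by auto
  have "ennreal (\<integral>x. max (?f x) 0 \<partial>\<nu>) = (\<integral>\<^sup>+x. ennreal (max (?f x) 0) \<partial>\<nu>)"
    by (intro nn_integral_eq_integral[symmetric] g) auto
  also have "\<dots> = (\<integral>\<^sup>+x. ennreal (?f x) \<partial>\<nu>)" by (simp add: ennreal_max_0)
  also have "\<dots> \<le> ennreal (mean_depth \<nu> t + quant_slack (card A) t)"
    by (rule nn_integral_neg_log_max_dist[OF A t])
  finally have "(\<integral>x. max (?f x) 0 \<partial>\<nu>) \<le> mean_depth \<nu> t + quant_slack (card A) t"
    using mean_depth_ge_1[OF t] depth_bound_ge_1[OF t] t two_powr_neg_a
    by (subst (asm) ennreal_le_iff) (auto simp: quant_slack_def kappa_def)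
  moreover have "(\<integral>x. ?f x \<partial>\<nu>) \<le> (\<integral>x. max (?f x) 0 \<partial>\<nu>)"
    by (intro integral_mono f g) auto
  ultimately show "- (\<integral>x. log 2 (max_dist x A) \<partial>\<nu>) \<le> mean_depth \<nu> t + quant_slack (card A) t"
    by simp
qed

lemma AE_max_dist_pos:
  assumes A: "finite A" "A \<noteq> {}"
  shows "AE x in \<nu>. 0 < max_dist x A"
proof -
  have [measurable]: "(\<lambda>x. max_dist x A) \<in> borel_measurable \<nu>" by (rule max_dist_measurable[OF A])
  have S: "{x. max_dist x A = 0} \<in> sets \<nu>" by (intro pred_imp_sets) measurable
  have bound: "prob {x. max_dist x A = 0} \<le> real (card A) * 3 ^ CARD('n) * (C * (2 powr (- a)) ^ m)" for m
  proof -
    \<comment> \<open>The threshold 2 exceeds every mass, so the second condition is void, and the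
      Frostman bound makes the estimate vanish as \<open>m\<close> grows.\<close>
    have "prob {x. max_dist x A = 0} \<le> prob {x. max_dist x A < 1 / 2 ^ m \<and> mass m x < 2}"
      using prob_le_1 by (intro finite_measure_mono) (auto intro!: pred_imp_sets intro: le_less_trans)
    also have "\<dots> \<le> real (card A) * 3 ^ CARD('n) * min 2 (C * 2 powr (- a * real m))"
      by (intro prob_max_dist_less A) simp
    also have "\<dots> \<le> real (card A) * 3 ^ CARD('n) * (C * 2 powr (- a * real m))"
      by (intro mult_left_mono) auto
    finally show ?thesis by (simp add: powr_powr powr_realpow[symmetric])
  qed
  have "(\<lambda>m. real (card A) * 3 ^ CARD('n) * (C * (2 powr (- a)) ^ m)) \<longlonglongrightarrow>
      real (card A) * 3 ^ CARD('n) * (C * 0)"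
    using two_powr_neg_a by (intro tendsto_intros LIMSEQ_realpow_zero) auto
  then have "prob {x. max_dist x A = 0} \<le> 0"
    using bound by (intro LIMSEQ_le_const[where X="\<lambda>m. real (card A) * 3 ^ CARD('n) * (C * (2 powr (- a)) ^ m)"]) auto
  then have "prob {x. max_dist x A = 0} = 0" by (simp add: measure_le_0_iff)
  then have "AE x in \<nu>. x \<notin> {x. max_dist x A = 0}"
    using S by (intro AE_not_in) (auto simp: null_sets_def emeasure_eq_measure)
  then show ?thesis
    by eventually_elim (use max_dist_nonneg[OF A] in \<open>auto simp: less_le\<close>)
qed

text \<open>A level has at most \<open>1 / t\<close> cubes of mass at least \<open>t\<close>, and
  only levels below \<open>depth_bound\<close> are used. The parent of a stopped cube is still
  heavy, so its centre is available.\<close>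

lemma ex_stopped_centers:
  assumes t: "0 < t" "t < 1"
  shows "\<exists>A. finite A \<and> 1 \<le> card A \<and> real (card A) \<le> depth_bound a C t / t \<and>
    (\<forall>x\<in>cbox 0 1. max_dist x A \<le> 1 / 2 ^ stop_time \<nu> t x)"
proof -
  let ?H = "\<lambda>k. {z \<in> indices k. t \<le> measure \<nu> (cell k z)}"
  define J where "J = nat \<lfloor>depth_bound a C t\<rfloor>"
  have J: "real J \<le> depth_bound a C t" using depth_bound_ge_1[OF t] by (simp add: J_def)
  define A where "A = (\<Union>k<J. cell_center k ` ?H k)"
  have fin: "finite A" by (auto simp: A_def)
  have H: "real (card (?H k)) \<le> 1 / t" for k
  proof -
    have "(\<Sum>z\<in>?H k. t) \<le> (\<Sum>z\<in>?H k. measure \<nu> (cell k z))"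
      by (rule sum_mono) simp
    also have "\<dots> \<le> (\<Sum>z\<in>indices k. measure \<nu> (cell k z))" by (intro sum_mono2) auto
    finally have "real (card (?H k)) * t \<le> 1" by (simp add: sum_cells)
    then show ?thesis using t by (simp add: pos_le_divide_eq)
  qed
  have "card A \<le> (\<Sum>k<J. card (cell_center k ` ?H k))" unfolding A_def by (rule card_UN_le) simp
  also have "\<dots> \<le> (\<Sum>k<J. card (?H k))" by (intro sum_mono card_image_le) auto
  finally have "real (card A) \<le> real (\<Sum>k<J. card (?H k))" by (simp only: of_nat_le_iff)
  also have "\<dots> = (\<Sum>k<J. real (card (?H k)))" by (rule of_nat_sum)
  also have "\<dots> \<le> (\<Sum>k<J. 1 / t)" by (intro sum_mono H)
  also have "\<dots> \<le> depth_bound a C t / t" using J t by (simp add: divide_right_mono)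
  finally have card: "real (card A) \<le> depth_bound a C t / t" .
  have ex: "\<exists>y\<in>A. infnorm (x - y) \<le> 1 / 2 ^ stop_time \<nu> t x" if x: "x \<in> cbox 0 1" for x
  proof -
    define T where "T = stop_time \<nu> t x"
    have T: "1 \<le> T" "real T \<le> depth_bound a C t"
      using stop_time_ge_1[OF t, of x] stop_time_le[OF t, of x] by (auto simp: T_def)
    \<comment> \<open>If the stopping time is 1, there is no earlier admissible level to compare
      with; the parent is then the unit cube, of mass 1.\<close>
    have "t \<le> mass (T - 1) x"
    proof (cases "T = 1")
      case True
      then show ?thesis using mass_0[OF x] t by simp
    next
      case False
      then show ?thesis using stop_time_le_iff[OF t, of "T - 1" x] T by (force simp: T_def)
    qed
    then have "cell_index (T - 1) x \<in> ?H (T - 1)" using x by (simp add: mass_eq)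
    moreover have "T - 1 < J" using T le_nat_floor[OF T(2)] unfolding J_def by linarith
    ultimately have "cell_center (T - 1) (cell_index (T - 1) x) \<in> A" unfolding A_def by blast
    moreover have "infnorm (x - cell_center (T - 1) (cell_index (T - 1) x)) \<le> 1 / 2 ^ T"
      using infnorm_cell_center[OF mem_cell_index[OF x], of "T - 1"] T by simp
    ultimately show ?thesis by (auto simp: T_def)
  qed
  have "(0 :: real ^ 'n) \<in> cbox 0 1" by (simp add: mem_box_cart)
  then have ne: "A \<noteq> {}" using ex by blast
  then have "1 \<le> card A" using fin by (simp add: Suc_le_eq card_gt_0_iff)
  moreover have "max_dist x A \<le> 1 / 2 ^ stop_time \<nu> t x" if "x \<in> cbox 0 1" for x
    using ex[OF that] max_dist_le[OF fin ne] by (blast intro: order_trans)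
  ultimately show ?thesis using fin card by blast
qed

lemma exp_integral_ln: "exp (\<integral>x. ln (max_dist x A) \<partial>\<nu>) = 2 powr (\<integral>x. log 2 (max_dist x A) \<partial>\<nu>)"
  by (simp add: powr_def log_def)

lemma quant_err_ge:
  assumes t: "0 < t" "t < 1" and N: "1 \<le> N"
  shows "2 powr (- (mean_depth \<nu> t + quant_slack N t)) \<le> quant_err \<nu> N"
  unfolding quant_err_def
proof (rule cINF_greatest)
  have "{0 :: real ^ 'n} \<in> {A. finite A \<and> 1 \<le> card A \<and> card A \<le> N}" using N by simp
  then show "{A :: (real ^ 'n) set. finite A \<and> 1 \<le> card A \<and> card A \<le> N} \<noteq> {}" by blast
next
  fix A :: "(real ^ 'n) set" assume "A \<in> {A. finite A \<and> 1 \<le> card A \<and> card A \<le> N}"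
  then have A: "finite A" "A \<noteq> {}" "card A \<le> N" by auto
  have "quant_slack (card A) t \<le> quant_slack N t"
    unfolding quant_slack_def using A depth_bound_ge_1[OF t] t two_powr_neg_a
    by (intro mult_right_mono) (auto simp: kappa_def)
  then have "- (mean_depth \<nu> t + quant_slack N t) \<le> (\<integral>x. log 2 (max_dist x A) \<partial>\<nu>)"
    using integral_log_max_dist_ge[OF A(1,2) t] by linarith
  then show "2 powr (- (mean_depth \<nu> t + quant_slack N t)) \<le> exp (\<integral>x. ln (max_dist x A) \<partial>\<nu>)"
    unfolding exp_integral_ln by (intro powr_mono) auto
qed

text \<open>An infimum of positive numbers could be 0; the lower bound through the mean depth, at an
  arbitrary \<open>t\<close>, excludes this.\<close>

lemma quant_err_pos: "1 \<le> N \<Longrightarrow> 0 < quant_err \<nu> N"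
  by (rule less_le_trans[OF _ quant_err_ge[of "1 / 2" N]]) auto

lemma neg_log_quant_err_le:
  assumes t: "0 < t" "t < 1" and N: "1 \<le> N"
  shows "- log 2 (quant_err \<nu> N) \<le> mean_depth \<nu> t + quant_slack N t"
proof -
  have "log 2 (2 powr (- (mean_depth \<nu> t + quant_slack N t))) \<le> log 2 (quant_err \<nu> N)"
    using quant_err_ge[OF assms] quant_err_pos[OF N] by (subst log_le_cancel_iff) auto
  then show ?thesis by simp
qed

lemma mean_depth_le_neg_log_quant_err:
  assumes t: "0 < t" "t < 1" and N: "depth_bound a C t / t \<le> real N"
  shows "mean_depth \<nu> t \<le> - log 2 (quant_err \<nu> N)"
proof -
  obtain A where A: "finite A" "1 \<le> card A" "real (card A) \<le> depth_bound a C t / t"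
    "\<And>x. x \<in> cbox 0 1 \<Longrightarrow> max_dist x A \<le> 1 / 2 ^ stop_time \<nu> t x"
    using ex_stopped_centers[OF t] by blast
  have ne: "A \<noteq> {}" using A by auto
  have N1: "1 \<le> N" "card A \<le> N" using A N by linarith+
  have "AE x in \<nu>. real (stop_time \<nu> t x) \<le> - log 2 (max_dist x A)"
    using AE_cube AE_max_dist_pos[OF A(1) ne]
  proof eventually_elim
    case (elim x)
    then have "log 2 (max_dist x A) \<le> log 2 (1 / 2 ^ stop_time \<nu> t x)"
      using A(4)[of x] by (subst log_le_cancel_iff) auto
    then show ?case by (simp add: log_divide log_nat_power)
  qed
  then have "mean_depth \<nu> t \<le> (\<integral>x. - log 2 (max_dist x A) \<partial>\<nu>)"
    unfolding mean_depth_def using integrable_log_max_dist[OF A(1) ne]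
    by (intro integral_mono_AE integrable_stop_time t) auto
  moreover have "quant_err \<nu> N \<le> exp (\<integral>x. ln (max_dist x A) \<partial>\<nu>)"
    unfolding quant_err_def using A N1
    by (intro cINF_lower) (auto intro!: bdd_belowI2[of _ 0])
  then have "log 2 (quant_err \<nu> N) \<le> log 2 (2 powr (\<integral>x. log 2 (max_dist x A) \<partial>\<nu>))"
    unfolding exp_integral_ln using quant_err_pos[OF N1(1)] by (subst log_le_cancel_iff) auto
  ultimately show ?thesis by simp
qed

end

section \<open>Quantization dimensions as limits of the harmonic mean estimate\<close>

text \<open>In the application \<open>s\<close> is \<open>\<sigma> t\<close>, \<open>L\<close> the
  mean depth, \<open>e\<close> the quantization slack and \<open>l\<close> is
  \<open>log 2 N\<close>. Passing from \<open>s / L\<close> to \<open>l / (L + e)\<close> loses an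
  amount of first order in the relative errors \<open>1 - l / s\<close> and \<open>e / s\<close>,
  with constants from the bound \<open>B\<close> on \<open>s / L\<close>.\<close>

lemma ratio_perturb:
  fixes L e l s B :: real
  assumes "0 < L" "0 \<le> e" "0 < s" "s / L \<le> B"
  shows "s / L - (B * \<bar>1 - l / s\<bar> + B\<^sup>2 * (e / s)) \<le> l / (L + e)"
proof -
  define D where "D = s / L"
  define u where "u = e / s"
  define r where "r = l / s"
  have D: "0 < D" "D \<le> B" and u: "0 \<le> u" using assms by (auto simp: D_def u_def)
  have "0 \<le> u * D" using D u by simp
  then have p: "0 < 1 + u * D" by linarith
  have eq: "l / (L + e) = r * (D / (1 + u * D))"
  proof -
    have "1 + u * D = (L + e) / L" using assms by (simp add: D_def u_def field_simps)
    then show ?thesis using assms by (simp add: D_def r_def)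
  qed
  have "(D - u * D\<^sup>2) * (1 + u * D) \<le> D"
    using D u by (simp add: algebra_simps power2_eq_square)
  then have 1: "D - u * D\<^sup>2 \<le> D / (1 + u * D)" using p by (simp add: pos_le_divide_eq)
  have "D\<^sup>2 \<le> B\<^sup>2" using D by (intro power_mono) auto
  then have 2: "u * D\<^sup>2 \<le> B\<^sup>2 * u" using u by (simp add: mult.commute mult_left_mono)
  have "D / (1 + u * D) \<le> D" using p D u by (simp add: divide_le_eq)
  then have "D / (1 + u * D) \<le> B" "0 \<le> D / (1 + u * D)" using D p by auto
  then have "\<bar>1 - r\<bar> * (D / (1 + u * D)) \<le> \<bar>1 - r\<bar> * B" by (intro mult_left_mono) auto
  moreover have "(1 - r) * (D / (1 + u * D)) \<le> \<bar>1 - r\<bar> * (D / (1 + u * D))"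
    using \<open>0 \<le> D / (1 + u * D)\<close> by (intro mult_right_mono) auto
  ultimately have "D / (1 + u * D) - r * (D / (1 + u * D)) \<le> B * \<bar>1 - r\<bar>"
    by (simp only: left_diff_distrib mult_1_left mult.commute[of B])
  then show ?thesis unfolding eq using 1 2 by (simp add: D_def u_def r_def)
qed

context frostman_measure
begin

definition quant_ratio :: "nat \<Rightarrow> real" where
  "quant_ratio N = log 2 (real N) / (- log 2 (quant_err \<nu> N))"

lemma D_est_eventually_le: "\<forall>\<^sub>F t in at_right 0. D t \<le> d + 1"
proof -
  have "\<forall>\<^sub>F t in at_right 0. excess 1 t < 1"
    using excess_tendsto_0[of 1] by (intro order_tendstoD(2)) auto
  with eventually_at_right_unit show ?thesis
  proof eventually_elim
    case (elim t)
    then show ?case using D_est_le_h_est[of t] h_est_le[of t] by auto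
  qed
qed

lemma depth_bound_div_tendsto: "((\<lambda>t. (depth_bound a C t + kappa) / \<sigma> t) \<longlongrightarrow> 1 / a) (at_right 0)"
  unfolding depth_bound_def using a by real_asymp (simp add: field_simps)

lemma quant_ratio_ge:
  assumes t: "filterlim t (at_right 0) G" and N: "filterlim N sequentially G"
    and r: "((\<lambda>j. log 2 (real (N j)) / \<sigma> (t j)) \<longlongrightarrow> 1) G"
    and Nt: "((\<lambda>j. real (N j) * t j) \<longlongrightarrow> 0) G" and \<epsilon>: "0 < \<epsilon>"
  shows "\<forall>\<^sub>F j in G. D (t j) - \<epsilon> \<le> quant_ratio (N j)"
proof -
  let ?B = "d + 1"
  let ?err = "\<lambda>j. ?B * \<bar>1 - log 2 (real (N j)) / \<sigma> (t j)\<bar> + ?B\<^sup>2 * (quant_slack (N j) (t j) / \<sigma> (t j))"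
  have "((\<lambda>j. 3 ^ CARD('n) * (real (N j) * t j) * ((depth_bound a C (t j) + kappa) / \<sigma> (t j)))
      \<longlongrightarrow> 3 ^ CARD('n) * 0 * (1 / a)) G"
    by (intro tendsto_intros Nt filterlim_compose[OF depth_bound_div_tendsto t])
  then have "((\<lambda>j. quant_slack (N j) (t j) / \<sigma> (t j)) \<longlongrightarrow> 0) G"
    by (simp add: quant_slack_def mult_ac)
  then have "(?err \<longlongrightarrow> ?B * \<bar>1 - 1\<bar> + ?B\<^sup>2 * 0) G" by (intro tendsto_intros r)
  then have ev: "\<forall>\<^sub>F j in G. ?err j < \<epsilon>" using \<epsilon> by (intro order_tendstoD(2)) auto
  \<comment> \<open>From this size on, the comparison at \<open>t = 1 / 2\<close> gives
    \<open>- log 2 (quant_err \<nu> N) \<ge> 1\<close>, so the denominator of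
    \<open>quant_ratio\<close> is positive.\<close>
  have ev2: "\<forall>\<^sub>F j in G. max 1 (nat \<lceil>depth_bound a C (1 / 2) / (1 / 2)\<rceil>) \<le> N j"
    using N unfolding filterlim_at_top by blast
  show ?thesis
    using ev ev2 eventually_compose_filterlim[OF eventually_at_right_unit t]
      eventually_compose_filterlim[OF D_est_eventually_le t]
  proof eventually_elim
    case (elim j)
    then have t: "0 < t j" "t j < 1" and N1: "1 \<le> N j"
      and N2: "depth_bound a C (1 / 2) / (1 / 2) \<le> real (N j)" by linarith+
    have L: "1 \<le> mean_depth \<nu> (t j)" by (rule mean_depth_ge_1[OF t])
    have "1 \<le> - log 2 (quant_err \<nu> (N j))"
      using mean_depth_le_neg_log_quant_err[of "1 / 2" "N j"] N2 mean_depth_ge_1[of "1 / 2"] by simp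
    moreover have "0 \<le> log 2 (real (N j))" using N1 by simp
    ultimately have "log 2 (real (N j)) / (mean_depth \<nu> (t j) + quant_slack (N j) (t j)) \<le> quant_ratio (N j)"
      unfolding quant_ratio_def using neg_log_quant_err_le[OF t N1]
      by (intro divide_left_mono mult_pos_pos) auto
    moreover have "D (t j) - ?err j \<le>
        log 2 (real (N j)) / (mean_depth \<nu> (t j) + quant_slack (N j) (t j))"
      unfolding D_est_def
    proof (rule ratio_perturb)
      show "0 \<le> quant_slack (N j) (t j)"
        using depth_bound_ge_1[OF t] t two_powr_neg_a by (auto simp: quant_slack_def kappa_def)
    qed (use elim L sigma_pos[OF t] in \<open>auto simp: D_est_def\<close>)
    ultimately show ?case using elim(1) by linarith
  qed
qed

lemma quant_ratio_le:
  assumes t: "filterlim t (at_right 0) G" and N: "\<forall>\<^sub>F j in G. depth_bound a C (t j) / t j \<le> real (N j)"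
    and r: "((\<lambda>j. log 2 (real (N j)) / \<sigma> (t j)) \<longlongrightarrow> 1) G" and \<epsilon>: "0 < \<epsilon>"
  shows "\<forall>\<^sub>F j in G. quant_ratio (N j) \<le> D (t j) + \<epsilon>"
proof -
  let ?B = "d + 1"
  let ?err = "\<lambda>j. ?B * \<bar>log 2 (real (N j)) / \<sigma> (t j) - 1\<bar>"
  have "(?err \<longlongrightarrow> ?B * \<bar>1 - 1\<bar>) G" by (intro tendsto_intros r)
  then have ev: "\<forall>\<^sub>F j in G. ?err j < \<epsilon>" using \<epsilon> by (intro order_tendstoD(2)) auto
  show ?thesis
    using ev N eventually_compose_filterlim[OF eventually_at_right_unit t]
      eventually_compose_filterlim[OF D_est_eventually_le t]
  proof eventually_elim
    case (elim j)
    then have t: "0 < t j" "t j < 1" by auto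
    have L: "1 \<le> mean_depth \<nu> (t j)" by (rule mean_depth_ge_1[OF t])
    let ?r = "log 2 (real (N j)) / \<sigma> (t j)"
    have "1 \<le> 1 / t j" using t by simp
    also have "\<dots> \<le> depth_bound a C (t j) / t j"
      using depth_bound_ge_1[OF t] t by (intro divide_right_mono) auto
    also have "\<dots> \<le> real (N j)" by (rule elim)
    finally have "0 \<le> log 2 (real (N j))" by simp
    then have "quant_ratio (N j) \<le> log 2 (real (N j)) / mean_depth \<nu> (t j)"
      unfolding quant_ratio_def using mean_depth_le_neg_log_quant_err[OF t elim(2)] L
      by (intro divide_left_mono mult_pos_pos) auto
    also have "\<dots> = D (t j) + D (t j) * (?r - 1)"
      using sigma_pos[OF t] L by (simp add: D_est_def field_simps)
    also have "D (t j) * (?r - 1) \<le> D (t j) * \<bar>?r - 1\<bar>"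
      using D_est_pos[OF t] by (intro mult_left_mono) auto
    also have "D (t j) * \<bar>?r - 1\<bar> \<le> ?err j" by (intro mult_right_mono elim) auto
    finally show ?case using elim(1) by linarith
  qed
qed

text \<open>An inequality between lower limits is proved along the parameter of its larger side:
  \<open>N\<close> is chosen as a function of \<open>t\<close> for the first one, \<open>t\<close>
  as a function of \<open>N\<close> for the second. For upper limits it is the smaller side that
  prescribes the parameter.\<close>

lemma D0_lower_eq: "D0_lower \<nu> = Liminf (at_right 0) (\<lambda>t. ereal (D t))"
proof (rule antisym)
  let ?K = "depth_bound a C" and ?N = "\<lambda>t. nat \<lceil>depth_bound a C t / t\<rceil>"
  show "D0_lower \<nu> \<le> Liminf (at_right 0) (\<lambda>t. ereal (D t))"
    unfolding D0_lower_def quant_ratio_def[symmetric]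
  proof (rule Liminf_ereal_mono_along)
    fix \<epsilon> :: real assume \<epsilon>: "0 < \<epsilon>"
    have "\<forall>\<^sub>F t in at_right 0. quant_ratio (?N t) \<le> D t + \<epsilon>"
    proof (rule quant_ratio_le[OF _ _ _ \<epsilon>])
      show "filterlim (\<lambda>t. t) (at_right 0) (at_right (0::real))" by (simp add: filterlim_ident)
      show "\<forall>\<^sub>F t in at_right 0. ?K t / t \<le> real (?N t)" by (intro always_eventually allI) linarith
      show "((\<lambda>t. log 2 (real (?N t)) / \<sigma> t) \<longlongrightarrow> 1) (at_right 0)"
        unfolding depth_bound_def using a by real_asymp
    qed
    moreover have "filterlim ?N sequentially (at_right 0)"
      unfolding depth_bound_def using a by real_asymp
    ultimately show "\<exists>\<phi>. filterlim \<phi> sequentially (at_right 0) \<and>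
        (\<forall>\<^sub>F t in at_right 0. quant_ratio (\<phi> t) - \<epsilon> \<le> D t)"
      by (intro exI[of _ ?N]) (auto elim: eventually_mono)
  qed
  show "Liminf (at_right 0) (\<lambda>t. ereal (D t)) \<le> D0_lower \<nu>"
    unfolding D0_lower_def quant_ratio_def[symmetric]
  proof (rule Liminf_ereal_mono_along)
    fix \<epsilon> :: real assume \<epsilon>: "0 < \<epsilon>"
    \<comment> \<open>Makes \<open>N t = 1 / log 2 N\<close> tend to 0 while
      \<open>log 2 (1 / t)\<close> stays asymptotic to \<open>log 2 N\<close>.\<close>
    let ?t = "\<lambda>N :: nat. 1 / (real N * log 2 (real N))"
    have t: "filterlim ?t (at_right 0) sequentially" by real_asymp
    have "\<forall>\<^sub>F N in sequentially. D (?t N) - \<epsilon> \<le> quant_ratio N"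
      by (rule quant_ratio_ge[OF t filterlim_ident _ _ \<epsilon>]) real_asymp+
    with t show "\<exists>\<phi>. filterlim \<phi> (at_right 0) sequentially \<and>
        (\<forall>\<^sub>F N in sequentially. D (\<phi> N) - \<epsilon> \<le> quant_ratio N)" by blast
  qed
qed

lemma D0_upper_eq: "D0_upper \<nu> = Limsup (at_right 0) (\<lambda>t. ereal (D t))"
proof (rule antisym)
  let ?K = "depth_bound a C"
  show "D0_upper \<nu> \<le> Limsup (at_right 0) (\<lambda>t. ereal (D t))"
    unfolding D0_upper_def quant_ratio_def[symmetric]
  proof (rule Limsup_ereal_mono_along)
    fix \<epsilon> :: real assume \<epsilon>: "0 < \<epsilon>"
    \<comment> \<open>Here \<open>N\<close> must exceed \<open>depth_bound / t\<close>, which for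
      this \<open>t\<close> is of order \<open>N / log 2 N\<close>: one logarithm pays for the
      depth, the other is room to spare.\<close>
    let ?t = "\<lambda>N :: nat. (log 2 (real N))\<^sup>2 / real N"
    have t: "filterlim ?t (at_right 0) sequentially" by real_asymp
    have "\<forall>\<^sub>F N in sequentially. quant_ratio N \<le> D (?t N) + \<epsilon>"
    proof (rule quant_ratio_le[OF t _ _ \<epsilon>])
      show "\<forall>\<^sub>F N in sequentially. ?K (?t N) / ?t N \<le> real N"
        unfolding depth_bound_def using a by real_asymp
      show "(\<lambda>N. log 2 (real N) / \<sigma> (?t N)) \<longlonglongrightarrow> 1" by real_asymp
    qed
    with t show "\<exists>\<phi>. filterlim \<phi> (at_right 0) sequentially \<and>
        (\<forall>\<^sub>F N in sequentially. quant_ratio N \<le> D (\<phi> N) + \<epsilon>)" by blast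
  qed
  show "Limsup (at_right 0) (\<lambda>t. ereal (D t)) \<le> D0_upper \<nu>"
    unfolding D0_upper_def quant_ratio_def[symmetric]
  proof (rule Limsup_ereal_mono_along)
    fix \<epsilon> :: real assume \<epsilon>: "0 < \<epsilon>"
    \<comment> \<open>The integer version of \<open>N t = 1 / \<sigma> t\<close>, small enough to
      make the slack negligible.\<close>
    let ?N = "\<lambda>t. nat \<lfloor>1 / (t * \<sigma> t)\<rfloor>"
    have N: "filterlim ?N sequentially (at_right 0)" by real_asymp
    have "\<forall>\<^sub>F t in at_right 0. D t - \<epsilon> \<le> quant_ratio (?N t)"
    proof (rule quant_ratio_ge[OF _ N _ _ \<epsilon>])
      show "filterlim (\<lambda>t. t) (at_right 0) (at_right (0::real))" by (simp add: filterlim_ident)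
      show "((\<lambda>t. log 2 (real (?N t)) / \<sigma> t) \<longlongrightarrow> 1) (at_right 0)" by real_asymp
      show "((\<lambda>t. real (?N t) * t) \<longlongrightarrow> 0) (at_right 0)" by real_asymp
    qed
    with N show "\<exists>\<phi>. filterlim \<phi> sequentially (at_right 0) \<and>
        (\<forall>\<^sub>F t in at_right 0. D t \<le> quant_ratio (\<phi> t) + \<epsilon>)"
      by (intro exI[of _ ?N]) (auto elim: eventually_mono)
  qed
qed

section \<open>Concentration of the information rates under vanishing variance\<close>

lemma info_rate_nonneg: "0 \<le> X k x"
proof (cases "mass k x = 0")
  case True
  then show ?thesis by (simp add: info_rate_def log_def)
next
  case False
  then have "log 2 (mass k x) \<le> 0"
    using prob_le_1[of "cube_at k x"] by (simp add: zero_less_measure_iff)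
  then show ?thesis by (simp add: info_rate_def divide_nonpos_nonneg)
qed

text \<open>A null set must be excepted: a cube of mass 0 has information rate 0 by
  \<open>ln 0 = 0\<close>, although its mass is below every threshold.\<close>

lemma AE_info_rate_gt_iff:
  assumes "1 \<le> k"
  shows "AE x in \<nu>. v < X k x \<longleftrightarrow> mass k x < 2 powr (- (real k * v))"
  using AE_mass_pos
proof eventually_elim
  case (elim x)
  then have m: "0 < mass k x" by blast
  have "v < X k x \<longleftrightarrow> log 2 (mass k x) < - (real k * v)"
    using assms by (auto simp: info_rate_def field_simps)
  also have "\<dots> \<longleftrightarrow> mass k x < 2 powr (- (real k * v))"
    using m by (simp add: log_less_iff)
  finally show ?case .
qed

lemma prob_info_rate_gt:
  assumes "1 \<le> k"
  shows "prob {x. v < X k x} = prob {x. mass k x < 2 powr (- (real k * v))}"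
  using AE_info_rate_gt_iff[OF assms, of v]
  by (intro measure_eq_AE) (auto intro!: pred_imp_sets)

lemma prob_dim_est_ge_eq:
  assumes t: "0 < t" "t < 1" and k: "1 \<le> k"
  shows "prob {x. \<sigma> t / real k \<le> dim_est \<nu> t x} = prob {x. \<sigma> t / real k < X k x}"
proof -
  have "2 powr (- (real k * (\<sigma> t / real k))) = t" using t k by (simp add: log_divide)
  then show ?thesis
    unfolding prob_info_rate_gt[OF k] dim_est_ge_iff_mass[OF t k] by simp
qed

lemma prob_not:
  assumes "Measurable.pred \<nu> P"
  shows "prob {x. \<not> P x} = 1 - prob {x. P x}"
proof -
  have "prob (space \<nu> - {x. P x}) = 1 - prob {x. P x}"
    using assms by (intro prob_compl pred_imp_sets)
  then show ?thesis by (simp add: Compl_eq_Diff_UNIV[symmetric] Collect_neg_eq)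
qed

text \<open>Where \<open>Z\<close> exceeds \<open>w\<close> it is at most \<open>d\<close> plus its
  excess over \<open>d\<close>. The excess is negligible for both \<open>info_rate\<close> and
  \<open>dim_est\<close>, so upper tails control means at the price of a factor
  \<open>d\<close>.\<close>

lemma expectation_le_threshold:
  fixes Z :: "real ^ 'n \<Rightarrow> real"
  assumes Z: "integrable \<nu> Z" and w: "0 \<le> w"
  shows "(\<integral>x. Z x \<partial>\<nu>) \<le> w + d * prob {x. w < Z x} + (\<integral>x. max (Z x - d) 0 \<partial>\<nu>)"
proof -
  have [measurable]: "Z \<in> borel_measurable \<nu>" using Z by simp
  have S: "{x. w < Z x} \<in> sets \<nu>" by (intro pred_imp_sets) measurable
  have i: "integrable \<nu> (\<lambda>x. d * indicator {x. w < Z x} x)"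
    using S by (intro integrable_mult_right integrable_real_indicator) (auto simp: less_top[symmetric])
  have u: "integrable \<nu> (\<lambda>x. max (Z x - d) 0)" using Z by auto
  have "(\<integral>x. Z x \<partial>\<nu>) \<le> (\<integral>x. w + d * indicator {x. w < Z x} x + max (Z x - d) 0 \<partial>\<nu>)"
    using w d_ge_1 by (intro integral_mono Z Bochner_Integration.integrable_add i u) (auto split: split_indicator)
  also have "\<dots> = w + d * prob {x. w < Z x} + (\<integral>x. max (Z x - d) 0 \<partial>\<nu>)"
    using i u S prob_space by simp
  finally show ?thesis .
qed

lemma expectation_ge_threshold:
  fixes Z :: "real ^ 'n \<Rightarrow> real"
  assumes Z: "integrable \<nu> Z" "\<And>x. 0 \<le> Z x"
  shows "w * prob {x. w \<le> Z x} \<le> (\<integral>x. Z x \<partial>\<nu>)"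
proof -
  have [measurable]: "Z \<in> borel_measurable \<nu>" using Z by simp
  have S: "{x. w \<le> Z x} \<in> sets \<nu>" by (intro pred_imp_sets) measurable
  have i: "integrable \<nu> (\<lambda>x. w * indicator {x. w \<le> Z x} x)"
    using S by (intro integrable_mult_right integrable_real_indicator) (auto simp: less_top[symmetric])
  have "w * prob {x. w \<le> Z x} = (\<integral>x. w * indicator {x. w \<le> Z x} x \<partial>\<nu>)" using S by simp
  also have "\<dots> \<le> (\<integral>x. Z x \<partial>\<nu>)"
    using Z by (intro integral_mono i) (auto split: split_indicator)
  finally show ?thesis .
qed

lemma chebyshev:
  fixes Z :: "real ^ 'n \<Rightarrow> real"
  assumes "Z \<in> borel_measurable \<nu>" "integrable \<nu> (\<lambda>x. (Z x)\<^sup>2)" "0 < c"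
  shows "prob {x. c \<le> \<bar>Z x - (\<integral>x. Z x \<partial>\<nu>)\<bar>} \<le> mvar \<nu> Z / c\<^sup>2"
  using Chebyshev_inequality[OF assms] by (simp add: mvar_def)

lemma chebyshev_dim_est:
  assumes t: "0 < t" "t < 1" and c: "0 < c"
  shows "prob {x. c \<le> \<bar>dim_est \<nu> t x - h t\<bar>} \<le> V t / c\<^sup>2"
  unfolding V_est_def h_est_def using c by (intro chebyshev integrable_dim_est[OF t]) measurable

lemma chebyshev_info_rate:
  assumes c: "0 < c"
  shows "prob {x. c \<le> \<bar>X k x - H k\<bar>} \<le> mvar \<nu> (X k) / c\<^sup>2"
  unfolding entropy_level_eq using c by (intro chebyshev integral_info_rate(1)) measurable

text \<open>The last summand bounds the probability of an exceptionally large drop of \<open>\<nu>(Q\<^sub>k(x))\<close>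
  between the levels \<open>k - j\<close> and \<open>k\<close>.\<close>

lemma prob_info_rate_gt_le:
  assumes v: "0 < v" and \<epsilon>: "0 < \<epsilon>" and j: "real j * d \<le> \<epsilon> * real k / 2" "j < k"
  shows "prob {x. v + \<epsilon> < X k x} \<le>
    prob {x. real k * v / real (k - j) \<le> dim_est \<nu> (2 powr (- (real k * v))) x} + 2 powr (- (\<epsilon> * real k / 2))"
proof -
  define t where "t = 2 powr (- (real k * v))"
  define \<eta> where "\<eta> = 2 powr (- (\<epsilon> * real k / 2))"
  have k: "1 \<le> k" using j by simp
  have t: "0 < t" "t < 1" "\<sigma> t = real k * v"
    using v k by (auto simp: t_def powr_minus_divide intro!: powr_less_one)
  let ?A = "{x. real k * v / real (k - j) \<le> dim_est \<nu> t x}"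
  let ?B = "{x. mass (k - j + j) x \<le> \<eta> * mass (k - j) x / 2 ^ (j * CARD('n))}"
  \<comment> \<open>Outside \<open>?A\<close> the cube of level \<open>k - j\<close> has mass at
    least \<open>t\<close>; outside \<open>?B\<close> it shrinks by no more than
    \<open>\<eta> 2 powr (- j d)\<close> in \<open>j\<close> levels. Each of these two factors costs
    at most \<open>\<epsilon> k / 2\<close> in the exponent, together the allowed
    \<open>\<epsilon> k\<close>.\<close>
  have "{x. mass k x < 2 powr (- (real k * (v + \<epsilon>)))} \<subseteq> ?A \<union> ?B"
  proof (intro subsetI, rule ccontr)
    fix x assume x: "x \<in> {x. mass k x < 2 powr (- (real k * (v + \<epsilon>)))}" "x \<notin> ?A \<union> ?B"
    have kj: "1 \<le> k - j" using j by simp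
    have "t \<le> mass (k - j) x"
      using dim_est_ge_iff_mass[OF t(1,2) kj, of x, unfolded t(3)] x(2) unfolding not_less[symmetric] by blast
    moreover have "\<eta> * mass (k - j) x / 2 ^ (j * CARD('n)) < mass k x" using x j by auto
    ultimately have "\<eta> * t / 2 ^ (j * CARD('n)) < mass k x"
      by (elim le_less_trans[rotated]) (auto simp: \<eta>_def intro!: divide_right_mono mult_left_mono)
    also have "\<dots> < 2 powr (- (real k * (v + \<epsilon>)))" using x by simp
    also have "2 ^ (j * CARD('n)) = 2 powr (real j * d)"
      by (simp add: dim powr_realpow[symmetric])
    then have "\<eta> * t / 2 ^ (j * CARD('n)) = 2 powr (- (\<epsilon> * real k / 2) - real k * v - real j * d)"
      by (simp add: \<eta>_def t_def powr_add[symmetric] powr_diff[symmetric])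
    finally have "- (\<epsilon> * real k / 2) - real k * v - real j * d < - (real k * (v + \<epsilon>))" by simp
    then show False using j(1) by (simp add: algebra_simps)
  qed
  then have "prob {x. mass k x < 2 powr (- (real k * (v + \<epsilon>)))} \<le> prob (?A \<union> ?B)"
    by (intro finite_measure_mono sets.Un pred_imp_sets) measurable
  also have "\<dots> \<le> prob ?A + prob ?B"
    by (intro measure_Un_le pred_imp_sets) measurable
  also have "prob ?B \<le> \<eta>" by (rule prob_mass_drop) (simp add: \<eta>_def)
  finally show ?thesis by (simp add: prob_info_rate_gt[OF k] t_def \<eta>_def)
qed

text \<open>At \<open>t = 2 powr (- k v)\<close> the event \<open>X k > v\<close> has the
  probability of \<open>dim_est \<ge> v\<close>, while \<open>X k > v + \<epsilon>\<close> forces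
  \<open>dim_est \<ge> v + c\<close> up to a small probability. As the estimate concentrates at
  \<open>h t\<close>, the first event is almost certain if \<open>h t\<close> exceeds
  \<open>v + c / 2\<close>, and the second almost impossible if not.\<close>

lemma info_rate_dichotomy:
  assumes V: "(V \<longlongrightarrow> 0) (at_right 0)"
    and v: "0 < v" and \<epsilon>: "0 < \<epsilon>" "\<epsilon> \<le> 1" and \<delta>: "0 < \<delta>"
  shows "\<forall>\<^sub>F k in sequentially.
    1 - \<delta> \<le> prob {x. v < X k x} \<or> prob {x. v + \<epsilon> < X k x} \<le> \<delta>"
proof -
  define t where "t k = 2 powr (- (real k * v))" for k :: nat
  \<comment> \<open>Going back \<open>j\<close> levels raises the threshold from \<open>v\<close> to
    \<open>k v / (k - j)\<close>, at least \<open>v + v j / k\<close>; as \<open>j\<close> will be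
    at least \<open>\<epsilon> k / (4 d)\<close>, the gain is at least \<open>c\<close>.\<close>
  define c where "c = v * \<epsilon> / (4 * d)"
  have c: "0 < c" using v \<epsilon> d_ge_1 by (simp add: c_def)
  have "filterlim t (at_right 0) sequentially" unfolding t_def using v by real_asymp
  then have "(\<lambda>k. V (t k)) \<longlonglongrightarrow> 0" by (rule filterlim_compose[OF V])
  moreover have "(\<lambda>k. 2 powr (- (\<epsilon> * real k / 2))) \<longlonglongrightarrow> 0" using \<epsilon> by real_asymp
  ultimately have "(\<lambda>k. V (t k) / (c / 2)\<^sup>2 + 2 powr (- (\<epsilon> * real k / 2))) \<longlonglongrightarrow> 0 / (c / 2)\<^sup>2 + 0"
    using c by (intro tendsto_intros) auto
  then have "\<forall>\<^sub>F k in sequentially. V (t k) / (c / 2)\<^sup>2 + 2 powr (- (\<epsilon> * real k / 2)) < \<delta>"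
    using \<delta> by (intro order_tendstoD(2)) auto
  moreover have "\<forall>\<^sub>F k in sequentially. max 1 (nat \<lceil>4 * d / \<epsilon>\<rceil>) \<le> k" by (rule eventually_ge_at_top)
  ultimately show ?thesis
  proof eventually_elim
    case (elim k)
    then have k: "1 \<le> k" "4 * d / \<epsilon> \<le> real k" by linarith+
    \<comment> \<open>The largest \<open>j\<close> with \<open>j d \<le> \<epsilon> k / 2\<close>.
      Since \<open>k \<ge> 4 d / \<epsilon>\<close>, rounding down loses at most half.\<close>
    define j where "j = nat \<lfloor>\<epsilon> * real k / (2 * d)\<rfloor>"
    have "0 \<le> \<epsilon> * real k / (2 * d)" using \<epsilon> d_ge_1 by simp
    then have j: "real j \<le> \<epsilon> * real k / (2 * d)" "\<epsilon> * real k / (2 * d) < real j + 1"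
      unfolding j_def by linarith+
    have jd: "real j * d \<le> \<epsilon> * real k / 2" using j(1) d_ge_1 by (simp add: field_simps)
    have "1 \<le> \<epsilon> * real k / (4 * d)" using k(2) \<epsilon> d_ge_1 by (simp add: field_simps)
    then have j_ge: "\<epsilon> * real k / (4 * d) \<le> real j" using j(2) by (simp add: field_simps)
    have "real j * 1 \<le> real j * d" using d_ge_1 by (intro mult_left_mono) auto
    also have "\<dots> \<le> 1 * real k / 2" using jd \<epsilon> by (meson divide_right_mono mult_right_mono of_nat_0_le_iff order_trans zero_le_numeral)
    finally have jk: "j < k" using k(1) by simp
    have t: "0 < t k" "t k < 1" "\<sigma> (t k) = real k * v"
      using v k by (auto simp: t_def powr_minus_divide intro!: powr_less_one)
    have gap: "v + c \<le> real k * v / real (k - j)"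
    proof -
      have "c * real k = v * (\<epsilon> * real k / (4 * d))" by (simp add: c_def)
      also have "\<dots> \<le> v * real j" using j_ge v by (intro mult_left_mono) auto
      finally have "c * real k \<le> v * real j" .
      moreover have "0 \<le> c * real j" using c by simp
      ultimately have "(v + c) * (real k - real j) \<le> real k * v" by (simp add: algebra_simps)
      then show ?thesis using jk by (simp add: of_nat_diff pos_le_divide_eq)
    qed
    have "2 powr (- (\<epsilon> * real k / 2)) \<ge> 0" by simp
    with elim(1) have V': "V (t k) / (c / 2)\<^sup>2 \<le> \<delta>"
      "V (t k) / (c / 2)\<^sup>2 + 2 powr (- (\<epsilon> * real k / 2)) \<le> \<delta>" by linarith+
    have cheb: "prob {x. c / 2 \<le> \<bar>dim_est \<nu> (t k) x - h (t k)\<bar>} \<le> V (t k) / (c / 2)\<^sup>2"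
      using c by (intro chebyshev_dim_est t) auto
    show ?case
    proof (cases "h (t k) \<le> v + c / 2")
      case True
      have "prob {x. real k * v / real (k - j) \<le> dim_est \<nu> (t k) x} \<le>
          prob {x. c / 2 \<le> \<bar>dim_est \<nu> (t k) x - h (t k)\<bar>}"
      proof (intro finite_measure_mono pred_imp_sets subsetI)
        fix x assume "x \<in> {x. real k * v / real (k - j) \<le> dim_est \<nu> (t k) x}"
        then have "v + c \<le> dim_est \<nu> (t k) x" using gap by auto
        then show "x \<in> {x. c / 2 \<le> \<bar>dim_est \<nu> (t k) x - h (t k)\<bar>}"
          using True unfolding mem_Collect_eq by linarith
      qed measurable
      then show ?thesis
        using prob_info_rate_gt_le[OF v \<epsilon>(1) jd jk] cheb V'(2) unfolding t_def by linarith
    next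
      case False
      have "prob {x. \<not> v \<le> dim_est \<nu> (t k) x} \<le> prob {x. c / 2 \<le> \<bar>dim_est \<nu> (t k) x - h (t k)\<bar>}"
      proof (intro finite_measure_mono pred_imp_sets subsetI)
        fix x assume "x \<in> {x. \<not> v \<le> dim_est \<nu> (t k) x}"
        then show "x \<in> {x. c / 2 \<le> \<bar>dim_est \<nu> (t k) x - h (t k)\<bar>}"
          using False unfolding mem_Collect_eq by linarith
      qed measurable
      moreover have "prob {x. \<not> v \<le> dim_est \<nu> (t k) x} = 1 - prob {x. v \<le> dim_est \<nu> (t k) x}"
        by (rule prob_not) measurable
      moreover have "prob {x. v \<le> dim_est \<nu> (t k) x} = prob {x. v < X k x}"
        using prob_dim_est_ge_eq[OF t(1,2) k(1)] k(1) by (simp add: t(3))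
      ultimately show ?thesis using cheb V'(1) by linarith
    qed
  qed
qed

lemma mvar_info_rate_nonneg: "0 \<le> mvar \<nu> (X k)"
  unfolding mvar_def by (intro integral_nonneg_AE) auto

text \<open>The variance is at most the second moment about any \<open>c\<close>. Clipping at
  \<open>d\<close> leaves a bounded variable, within \<open>\<epsilon>\<close> of \<open>c\<close>
  up to probability \<open>2 \<delta>\<close>, and an excess whose second moment is at most
  \<open>(4 / k)\<^sup>2\<close>; \<open>(d + 1)\<^sup>2\<close> bounds the squared deviation on the
  exceptional set.\<close>

lemma mvar_info_rate_le:
  assumes k: "1 \<le> k" and c: "0 \<le> c" "c \<le> d + 1"
    and p: "prob {x. c + \<epsilon> < min (X k x) d} \<le> \<delta>" "prob {x. min (X k x) d < c - \<epsilon>} \<le> \<delta>"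
  shows "mvar \<nu> (X k) \<le> 2 * (\<epsilon>\<^sup>2 + (d + 1)\<^sup>2 * (2 * \<delta>)) + 2 * (4 / real k)\<^sup>2"
proof -
  have sq: "(p + q)\<^sup>2 \<le> 2 * p\<^sup>2 + 2 * q\<^sup>2" for p q :: real
    using zero_le_power2[of "p - q"] by (simp add: power2_sum power2_diff)
  let ?X = "X k"
  let ?A = "{x. c + \<epsilon> < min (?X x) d}" and ?B = "{x. min (?X x) d < c - \<epsilon>}"
  have S: "?A \<in> sets \<nu>" "?B \<in> sets \<nu>" by (intro pred_imp_sets; measurable)+
  have int: "integrable \<nu> (\<lambda>x. F (?X x))" if "F \<in> borel_measurable borel" for F :: "real \<Rightarrow> real"
    by (rule integral_info_rate(1)[OF that])
  have iA: "integrable \<nu> (indicator ?A :: _ \<Rightarrow> real)" "integrable \<nu> (indicator ?B :: _ \<Rightarrow> real)"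
    using S by (auto intro!: integrable_real_indicator simp: less_top[symmetric])
  have "(\<integral>x. (?X x - c)\<^sup>2 \<partial>\<nu>) = (\<integral>x. (?X x)\<^sup>2 - 2 * c * ?X x + c\<^sup>2 \<partial>\<nu>)"
    by (simp add: power2_diff algebra_simps)
  also have "\<dots> = (\<integral>x. (?X x)\<^sup>2 \<partial>\<nu>) - 2 * c * (\<integral>x. ?X x \<partial>\<nu>) + c\<^sup>2"
    using int[of "\<lambda>y. y\<^sup>2"] int[of "\<lambda>y. y"] prob_space by simp
  finally have "(\<integral>x. (?X x - c)\<^sup>2 \<partial>\<nu>) = mvar \<nu> ?X + ((\<integral>x. ?X x \<partial>\<nu>) - c)\<^sup>2"
    by (simp add: mvar_info_rate power2_diff)
  then have "mvar \<nu> ?X \<le> (\<integral>x. (?X x - c)\<^sup>2 \<partial>\<nu>)" by simp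
  also have "\<dots> \<le> (\<integral>x. 2 * (\<epsilon>\<^sup>2 + (d + 1)\<^sup>2 * (indicator ?A x + indicator ?B x)) + 2 * (max (?X x - d) 0)\<^sup>2 \<partial>\<nu>)"
  proof (intro integral_mono Bochner_Integration.integrable_add integrable_mult_right iA)
    fix x
    let ?Y = "min (?X x) d" and ?u = "max (?X x - d) 0"
    have Y: "0 \<le> ?Y" "?Y \<le> d" using info_rate_nonneg[of k x] d_ge_1 by auto
    have "(?Y - c)\<^sup>2 \<le> \<epsilon>\<^sup>2 + (d + 1)\<^sup>2 * (indicator ?A x + indicator ?B x)"
    proof (cases "x \<in> ?A \<or> x \<in> ?B")
      case True
      have "(?Y - c)\<^sup>2 \<le> (d + 1)\<^sup>2" using Y c d_ge_1 by (intro power2_le_iff_abs_le[THEN iffD2]) auto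
      also have "\<dots> \<le> (d + 1)\<^sup>2 * (indicator ?A x + indicator ?B x)"
      proof -
        have "1 \<le> indicator ?A x + (indicator ?B x :: real)" using True by (auto split: split_indicator)
        then have "(d + 1)\<^sup>2 * 1 \<le> (d + 1)\<^sup>2 * (indicator ?A x + indicator ?B x)" by (intro mult_left_mono) auto
        then show ?thesis by simp
      qed
      finally show ?thesis using zero_le_power2[of \<epsilon>] by linarith
    next
      case False
      then have "\<bar>?Y - c\<bar> \<le> \<epsilon>" by auto
      then have "\<bar>?Y - c\<bar>\<^sup>2 \<le> \<epsilon>\<^sup>2" by (intro power_mono) auto
      then show ?thesis using False by auto
    qed
    then have yb: "2 * (?Y - c)\<^sup>2 + 2 * ?u\<^sup>2 \<le>
        2 * (\<epsilon>\<^sup>2 + (d + 1)\<^sup>2 * (indicator ?A x + indicator ?B x)) + 2 * ?u\<^sup>2"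
      by (intro add_right_mono mult_left_mono) auto
    have "?X x - c = (?Y - c) + ?u" by auto
    then have "(?X x - c)\<^sup>2 = ((?Y - c) + ?u)\<^sup>2" by (rule arg_cong)
    also note sq
    also note yb
    finally show "(?X x - c)\<^sup>2 \<le> 2 * (\<epsilon>\<^sup>2 + (d + 1)\<^sup>2 * (indicator ?A x + indicator ?B x)) + 2 * ?u\<^sup>2" .
  qed (auto intro!: int[of "\<lambda>y. (y - c)\<^sup>2"] int[of "\<lambda>y. (max (y - d) 0)\<^sup>2"])
  also have "\<dots> = 2 * (\<epsilon>\<^sup>2 + (d + 1)\<^sup>2 * (prob ?A + prob ?B)) + 2 * (\<integral>x. (max (?X x - d) 0)\<^sup>2 \<partial>\<nu>)"
  proof -
    have iu: "integrable \<nu> (\<lambda>x. (max (?X x - d) 0)\<^sup>2)" by (rule int[of "\<lambda>y. (max (y - d) 0)\<^sup>2"]) simp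
    show ?thesis using iA iu S prob_space by (simp add: distrib_left)
  qed
  also have "\<dots> \<le> 2 * (\<epsilon>\<^sup>2 + (d + 1)\<^sup>2 * (2 * \<delta>)) + 2 * (4 / real k)\<^sup>2"
    using p info_rate_excess[of k 2] k by (intro add_mono mult_left_mono order_refl) auto
  finally show ?thesis .
qed

lemma mvar_info_rate_tendsto_0:
  assumes V: "(V \<longlongrightarrow> 0) (at_right 0)"
  shows "(\<lambda>k. mvar \<nu> (X k)) \<longlonglongrightarrow> 0"
proof (rule order_tendstoI)
  fix e :: real assume "e < 0"
  then show "\<forall>\<^sub>F k in sequentially. e < mvar \<nu> (X k)"
    by (intro always_eventually allI less_le_trans[OF _ mvar_info_rate_nonneg])
next
  fix e :: real assume e: "0 < e"
  \<comment> \<open>Calibrated so that \<open>2 (e / 8 + e / 8)\<close> and the excess term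
    \<open>e / 2\<close> add up to \<open>e\<close>.\<close>
  define \<epsilon> where "\<epsilon> = min 1 (sqrt (e / 8))"
  define \<delta> where "\<delta> = min (1 / 2) (e / (16 * (d + 1)\<^sup>2))"
  have \<epsilon>: "0 < \<epsilon>" "\<epsilon> \<le> 1" using e by (auto simp: \<epsilon>_def)
  have "\<epsilon>\<^sup>2 \<le> (sqrt (e / 8))\<^sup>2" using \<epsilon> by (intro power_mono) (auto simp: \<epsilon>_def)
  then have \<epsilon>2: "\<epsilon>\<^sup>2 \<le> e / 8" using e by simp
  have \<delta>: "0 < \<delta>" "\<delta> < 1" using e d_ge_1 by (auto simp: \<delta>_def min_less_iff_disj)
  have "(d + 1)\<^sup>2 * (2 * \<delta>) \<le> (d + 1)\<^sup>2 * (2 * (e / (16 * (d + 1)\<^sup>2)))"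
    by (intro mult_left_mono) (auto simp: \<delta>_def)
  also have "\<dots> = e / 8" using d_ge_1 by simp
  finally have \<delta>2: "(d + 1)\<^sup>2 * (2 * \<delta>) \<le> e / 8" .
  \<comment> \<open>The grid starts at \<open>\<epsilon>\<close> because the dichotomy needs
    \<open>v > 0\<close>; it ends at or beyond \<open>d\<close>, above which the clipped rate has no
    mass.\<close>
  define v where "v i = real (i + 1) * \<epsilon>" for i
  have v_pos: "0 < v i" for i unfolding v_def using \<epsilon> by (intro mult_pos_pos) auto
  have v_Suc: "v (Suc i) = v i + \<epsilon>" for i by (simp add: v_def algebra_simps)
  define M where "M = nat \<lceil>d / \<epsilon>\<rceil>"
  have "d / \<epsilon> \<le> real M" unfolding M_def by linarith
  then have vM: "d \<le> v M" using \<epsilon> by (simp add: v_def field_simps)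
  have "\<forall>\<^sub>F k in sequentially. \<forall>i\<in>{..M}.
      1 - \<delta> \<le> prob {x. v i < X k x} \<or> prob {x. v i + \<epsilon> < X k x} \<le> \<delta>"
    by (intro eventually_ball_finite ballI info_rate_dichotomy V v_pos \<epsilon> \<delta>) simp
  moreover have "(\<lambda>k. 2 * (4 / real k)\<^sup>2) \<longlonglongrightarrow> 0" by real_asymp
  then have "\<forall>\<^sub>F k in sequentially. 2 * (4 / real k)\<^sup>2 < e / 2"
    by (rule order_tendstoD(2)) (use e in simp)
  moreover have "\<forall>\<^sub>F k in sequentially. 1 \<le> (k :: nat)" by (rule eventually_ge_at_top)
  ultimately show "\<forall>\<^sub>F k in sequentially. mvar \<nu> (X k) < e"
  proof eventually_elim
    case (elim k)
    let ?Y = "\<lambda>x. min (X k x) d"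
    \<comment> \<open>At this \<open>i\<close> the first alternative of the dichotomy fails, so
      little mass lies above \<open>v i + \<epsilon>\<close>; at \<open>i - 1\<close> it holds by
      minimality, so little lies below \<open>v i - \<epsilon>\<close> (none for
      \<open>i = 0\<close>, as rates are nonnegative). Hence \<open>v i\<close> is the centre
      sought.\<close>
    define i where "i = (LEAST i. prob {x. v i < ?Y x} < 1 - \<delta>)"
    have empty: "{x. w < ?Y x} = {}" if "d \<le> w" for w using that by auto
    have "prob {x. v M < ?Y x} < 1 - \<delta>" using vM \<delta> by (simp add: empty)
    then have i: "prob {x. v i < ?Y x} < 1 - \<delta>" "i \<le> M"
      unfolding i_def by (auto intro: LeastI Least_le)
    have below: "1 - \<delta> \<le> prob {x. v j < ?Y x}" if "j < i" for j
      using not_less_Least[of j "\<lambda>i. prob {x. v i < ?Y x} < 1 - \<delta>"] that by (auto simp: i_def)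
    have above: "prob {x. v i + \<epsilon> < ?Y x} \<le> \<delta>"
    proof (cases "v i < d")
      case True
      then have eq: "{x. v i < ?Y x} = {x. v i < X k x}" by auto
      have "prob {x. v i < X k x} < 1 - \<delta>" using i(1) by (simp only: eq)
      then have "prob {x. v i + \<epsilon> < X k x} \<le> \<delta>" using bspec[OF elim(1), of i] i(2) by force
      moreover have "prob {x. v i + \<epsilon> < ?Y x} \<le> prob {x. v i + \<epsilon> < X k x}"
        by (intro finite_measure_mono pred_imp_sets) auto
      ultimately show ?thesis by linarith
    next
      case False
      then show ?thesis using \<epsilon> \<delta> by (simp add: empty)
    qed
    have vi: "v i \<le> d + 1 \<and> prob {x. ?Y x < v i - \<epsilon>} \<le> \<delta>"
    proof (cases i)
      case 0
      have "\<not> ?Y x < 0" for x using info_rate_nonneg[of k x] d_ge_1 by auto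
      then have "{x. ?Y x < v i - \<epsilon>} = {}" using 0 by (auto simp: v_def)
      then show ?thesis using 0 \<epsilon> \<delta> d_ge_1 by (simp add: v_def)
    next
      case (Suc j)
      have j: "1 - \<delta> \<le> prob {x. v j < ?Y x}" using below Suc by simp
      have "v j < d"
      proof (rule ccontr)
        assume "\<not> v j < d"
        then have "{x. v j < ?Y x} = {}" by (intro empty) simp
        then have "1 - \<delta> \<le> 0" using j by (simp only: measure_empty)
        then show False using \<delta> by simp
      qed
      moreover have "prob {x. ?Y x < v i - \<epsilon>} \<le> prob {x. \<not> v j < ?Y x}"
        using Suc by (intro finite_measure_mono pred_imp_sets) (auto simp: v_Suc)
      moreover have "prob {x. \<not> v j < ?Y x} = 1 - prob {x. v j < ?Y x}" by (rule prob_not) measurable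
      ultimately show ?thesis using Suc j \<epsilon> by (simp add: v_Suc)
    qed
    have "mvar \<nu> (X k) \<le> 2 * (\<epsilon>\<^sup>2 + (d + 1)\<^sup>2 * (2 * \<delta>)) + 2 * (4 / real k)\<^sup>2"
      using vi above v_pos[of i] elim(3) by (intro mvar_info_rate_le) auto
    also have "\<dots> < 2 * (e / 8 + e / 8) + e / 2"
      by (intro add_le_less_mono mult_left_mono add_mono \<epsilon>2 \<delta>2 elim(2)) simp
    finally show ?case by simp
  qed
qed

lemma beta_dd1_smallo_iff:
  "beta_dd1 \<nu> \<in> o(\<lambda>k. real k) \<longleftrightarrow> (\<lambda>k. mvar \<nu> (X k)) \<longlonglongrightarrow> 0"
proof -
  have "beta_dd1 \<nu> \<in> o(\<lambda>k. real k) \<longleftrightarrow> (\<lambda>k. beta_dd1 \<nu> k / real k) \<longlonglongrightarrow> 0"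
    by (rule iffI, erule smalloD_tendsto, erule smalloI_tendsto) (auto intro: eventually_sequentiallyI[of 1])
  also have "\<dots> \<longleftrightarrow> (\<lambda>k. ln 2 * mvar \<nu> (X k)) \<longlonglongrightarrow> 0"
    by (intro tendsto_cong eventually_sequentiallyI[of 1]) (simp add: beta_dd1_eq)
  also have "\<dots> \<longleftrightarrow> (\<lambda>k. mvar \<nu> (X k)) \<longlonglongrightarrow> 0"
    using tendsto_mult_left_iff[of "ln 2 :: real" "\<lambda>k. mvar \<nu> (X k)" 0] by simp
  finally show ?thesis .
qed

end

section \<open>Entropies versus means of the stopped estimate\<close>

lemma filterlim_two_powr_at_right_0:
  assumes "0 < c" "\<forall>\<^sub>F k in sequentially. c \<le> w k"
  shows "filterlim (\<lambda>k. 2 powr (- (real k * w k))) (at_right 0) sequentially"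
proof (rule tendsto_imp_filterlim_at_right)
  show "(\<lambda>k. 2 powr (- (real k * w k))) \<longlonglongrightarrow> 0"
  proof (rule tendsto_sandwich[OF _ _ tendsto_const])
    show "\<forall>\<^sub>F k in sequentially. 0 \<le> 2 powr (- (real k * w k))" by simp
    show "\<forall>\<^sub>F k in sequentially. 2 powr (- (real k * w k)) \<le> 2 powr (- (real k * c))"
      using assms(2) by eventually_elim (auto intro!: powr_mono mult_left_mono)
    show "(\<lambda>k. 2 powr (- (real k * c))) \<longlonglongrightarrow> 0" using assms(1) by real_asymp
  qed
qed simp

context frostman_measure
begin

lemma AE_info_rate_ge:
  assumes "1 \<le> k"
  shows "AE x in \<nu>. a - log 2 C / real k \<le> X k x"
  using AE_mass_pos
proof eventually_elim
  case (elim x)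
  then have "log 2 (mass k x) \<le> log 2 (C * 2 powr (- a * real k))"
    using mass_le[of k x] C by (subst log_le_cancel_iff) auto
  also have "\<dots> = log 2 C - a * real k" using C by (simp add: log_mult)
  finally have "(a * real k - log 2 C) / real k \<le> - log 2 (mass k x) / real k"
    by (intro divide_right_mono) auto
  then show ?case using assms by (simp add: info_rate_def diff_divide_distrib)
qed

lemma entropy_level_ge:
  assumes "1 \<le> k"
  shows "a - log 2 C / real k \<le> H k"
proof -
  have "(\<integral>x. a - log 2 C / real k \<partial>\<nu>) \<le> H k"
    unfolding entropy_level_eq using AE_info_rate_ge[OF assms]
    by (intro integral_mono_AE integral_info_rate(1)[of "\<lambda>y. y"]) auto
  then show ?thesis using prob_space by simp
qed

lemma entropy_level_eventually_ge: "\<forall>\<^sub>F k in sequentially. a / 2 \<le> H k"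
proof -
  have "(\<lambda>k. a - log 2 C / real k) \<longlonglongrightarrow> a" by real_asymp
  then have "\<forall>\<^sub>F k in sequentially. a / 2 < a - log 2 C / real k"
    by (rule order_tendstoD(1)) (use a in simp)
  with eventually_ge_at_top[of 1] show ?thesis
    by eventually_elim (use entropy_level_ge in force)
qed

lemma info_rate_excess_1:
  assumes "1 \<le> k"
  shows "(\<integral>x. max (X k x - d) 0 \<partial>\<nu>) \<le> 2 / real k"
  using info_rate_excess[of k 1] assms by simp

lemma entropy_level_le:
  assumes k: "1 \<le> k" and w: "0 \<le> w"
  shows "H k \<le> w + d * prob {x. w < X k x} + 2 / real k"
  using expectation_le_threshold[OF integral_info_rate(1)[of "\<lambda>y. y" k] w] info_rate_excess_1[OF k]
  unfolding entropy_level_eq by simp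

lemma entropy_level_le_dim:
  assumes k: "1 \<le> k"
  shows "H k \<le> d + 2 / real k"
proof -
  have "H k \<le> (\<integral>x. d + max (X k x - d) 0 \<partial>\<nu>)"
    unfolding entropy_level_eq
    by (intro integral_mono integral_info_rate(1)[of "\<lambda>y. y"] integral_info_rate(1)[of "\<lambda>y. d + max (y - d) 0"]) auto
  also have "\<dots> = d + (\<integral>x. max (X k x - d) 0 \<partial>\<nu>)"
    using integral_info_rate(1)[of "\<lambda>y. max (y - d) 0" k] prob_space by simp
  finally show ?thesis using info_rate_excess_1[OF k] by simp
qed

lemma h_est_le_threshold:
  assumes t: "0 < t" "t < 1" and w: "0 \<le> w"
  shows "h t \<le> w + d * prob {x. w \<le> dim_est \<nu> t x} + excess 1 t"
proof -
  have "h t \<le> w + d * prob {x. w < dim_est \<nu> t x} + excess 1 t"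
    using expectation_le_threshold[OF integrable_dim_est[OF t, of "\<lambda>y. y"] w]
    by (simp add: h_est_def excess_def)
  moreover have "d * prob {x. w < dim_est \<nu> t x} \<le> d * prob {x. w \<le> dim_est \<nu> t x}"
    using d_ge_1 by (intro mult_left_mono finite_measure_mono pred_imp_sets) auto
  ultimately show ?thesis by linarith
qed

lemma prob_dim_est_ge_level:
  assumes w: "0 < w" and k: "1 \<le> k"
  shows "prob {x. w \<le> dim_est \<nu> (2 powr (- (real k * w))) x} = prob {x. w < X k x}"
proof -
  let ?t = "2 powr (- (real k * w))"
  have t: "0 < ?t" "?t < 1" using w k by (auto simp: powr_minus_divide intro!: powr_less_one)
  have "\<sigma> ?t / real k = w" using k by (simp add: log_divide)
  then show ?thesis using prob_dim_est_ge_eq[OF t k] by (simp only:)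
qed

lemma prob_info_rate_above_mean:
  assumes "0 < \<epsilon>"
  shows "prob {x. H k + \<epsilon> < X k x} \<le> mvar \<nu> (X k) / \<epsilon>\<^sup>2"
proof -
  have "prob {x. H k + \<epsilon> < X k x} \<le> prob {x. \<epsilon> \<le> \<bar>X k x - H k\<bar>}"
    by (intro finite_measure_mono pred_imp_sets) auto
  then show ?thesis using chebyshev_info_rate[OF assms, of k] by linarith
qed

lemma prob_info_rate_below_mean:
  assumes "0 < \<epsilon>"
  shows "1 - mvar \<nu> (X k) / \<epsilon>\<^sup>2 \<le> prob {x. H k - \<epsilon> < X k x}"
proof -
  have "prob {x. \<not> H k - \<epsilon> < X k x} \<le> prob {x. \<epsilon> \<le> \<bar>X k x - H k\<bar>}"
    by (intro finite_measure_mono pred_imp_sets) auto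
  moreover have "prob {x. \<not> H k - \<epsilon> < X k x} = 1 - prob {x. H k - \<epsilon> < X k x}"
    by (rule prob_not) measurable
  ultimately show ?thesis using chebyshev_info_rate[OF assms, of k] by linarith
qed

lemma prob_dim_est_above_mean:
  assumes t: "0 < t" "t < 1" and "0 < \<epsilon>"
  shows "prob {x. h t + \<epsilon> \<le> dim_est \<nu> t x} \<le> V t / \<epsilon>\<^sup>2"
proof -
  have "prob {x. h t + \<epsilon> \<le> dim_est \<nu> t x} \<le> prob {x. \<epsilon> \<le> \<bar>dim_est \<nu> t x - h t\<bar>}"
    by (intro finite_measure_mono pred_imp_sets) auto
  then show ?thesis using chebyshev_dim_est[OF assms] by linarith
qed

lemma prob_dim_est_below_mean:
  assumes t: "0 < t" "t < 1" and "0 < \<epsilon>"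
  shows "1 - V t / \<epsilon>\<^sup>2 \<le> prob {x. h t - \<epsilon> \<le> dim_est \<nu> t x}"
proof -
  have "prob {x. \<not> h t - \<epsilon> \<le> dim_est \<nu> t x} \<le> prob {x. \<epsilon> \<le> \<bar>dim_est \<nu> t x - h t\<bar>}"
    by (intro finite_measure_mono pred_imp_sets) auto
  moreover have "prob {x. \<not> h t - \<epsilon> \<le> dim_est \<nu> t x} = 1 - prob {x. h t - \<epsilon> \<le> dim_est \<nu> t x}"
    by (rule prob_not) measurable
  ultimately show ?thesis using chebyshev_dim_est[OF assms] by linarith
qed

text \<open>Levels are integers, so a general \<open>v\<close> is rounded up to
  \<open>\<sigma> t / k\<close>, which leaves the event for \<open>dim_est\<close> unchanged. From
  \<open>k v \<le> \<sigma> t \<le> (k + 1) v\<close> the rounding is at most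
  \<open>v / k\<close>.\<close>

lemma
  assumes t: "0 < t" "t < 1" and v: "0 < v" and k: "k = nat \<lfloor>\<sigma> t / v\<rfloor>" "1 \<le> k"
  shows prob_dim_est_ge_floor: "prob {x. v \<le> dim_est \<nu> t x} = prob {x. \<sigma> t / real k < X k x}"
    and level_rate_bounds: "v \<le> \<sigma> t / real k" "\<sigma> t / real k \<le> v + v / real k"
proof -
  have "v \<le> dim_est \<nu> t x \<longleftrightarrow> \<sigma> t / real k \<le> dim_est \<nu> t x" for x
    using dim_est_ge_iff[OF t v, of x] dim_est_ge_iff_mass[OF t k(2), of x] k by simp
  then show "prob {x. v \<le> dim_est \<nu> t x} = prob {x. \<sigma> t / real k < X k x}"
    using prob_dim_est_ge_eq[OF t k(2)] by simp
  have "0 \<le> \<sigma> t / v" using sigma_pos[OF t] v by simp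
  then have "real k \<le> \<sigma> t / v" "\<sigma> t / v \<le> real k + 1" unfolding k(1) by linarith+
  then have "real k * v \<le> \<sigma> t" "\<sigma> t \<le> (real k + 1) * v" using v by (simp_all add: field_simps)
  then show "v \<le> \<sigma> t / real k" "\<sigma> t / real k \<le> v + v / real k" using k(2) by (simp_all add: field_simps)
qed

text \<open>Uniform over thresholds in a bounded range, so that \<open>v t\<close> may follow the
  moving mean \<open>h t\<close>.\<close>

lemma filterlim_level:
  assumes "\<forall>\<^sub>F t in at_right 0. 0 < v t \<and> v t \<le> B" and B: "0 < B"
  shows "filterlim (\<lambda>t. nat \<lfloor>\<sigma> t / v t\<rfloor>) sequentially (at_right 0)"
proof (rule filterlim_at_top_mono)
  show "filterlim (\<lambda>t. nat \<lfloor>\<sigma> t / B\<rfloor>) sequentially (at_right 0)" using B by real_asymp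
  show "\<forall>\<^sub>F t in at_right 0. nat \<lfloor>\<sigma> t / B\<rfloor> \<le> nat \<lfloor>\<sigma> t / v t\<rfloor>"
    using assms(1) eventually_at_right_unit
  proof eventually_elim
    case (elim t)
    then have "\<sigma> t / B \<le> \<sigma> t / v t" using sigma_pos[of t] B by (intro divide_left_mono) auto
    then show ?case by (intro nat_mono floor_mono)
  qed
qed

lemma h_est_eventually_bounds: "\<forall>\<^sub>F t in at_right 0. a / 2 \<le> h t \<and> h t \<le> d + 1"
proof -
  have "\<forall>\<^sub>F t in at_right 0. excess 1 t < 1"
    using excess_tendsto_0[of 1] by (intro order_tendstoD(2)) auto
  moreover have "\<forall>\<^sub>F t in at_right 0. a / 2 < rate_bound a C t"
    by (rule order_tendstoD(1)[OF rate_bound_tendsto]) (use a in simp)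
  ultimately show ?thesis using eventually_at_right_unit
  proof eventually_elim
    case (elim t)
    then show ?case
      using D_est_le_h_est[of t] rate_bound_le_D_est[of t] h_est_le[of t] by auto
  qed
qed

text \<open>Given a level \<open>k\<close>, a threshold \<open>w\<close> slightly above the mean
  \<open>H k\<close> and \<open>t = 2 powr (- k w)\<close> make the tails of \<open>dim_est\<close>
  and \<open>X k\<close> at \<open>w\<close> equal, without rounding. Chebyshev for
  \<open>X k\<close> then bounds \<open>h t\<close> from above.\<close>

lemma Liminf_h_est_le_h_lower:
  assumes W: "(\<lambda>k. mvar \<nu> (X k)) \<longlonglongrightarrow> 0"
  shows "Liminf (at_right 0) (\<lambda>t. ereal (h t)) \<le> h_lower \<nu>"
  unfolding h_lower_def
proof (rule Liminf_ereal_mono_along)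
  fix \<epsilon> :: real assume \<epsilon>: "0 < \<epsilon>"
  define w where "w k = H k + \<epsilon> / 2" for k
  define \<phi> where "\<phi> k = 2 powr (- (real k * w k))" for k
  have w: "\<epsilon> / 2 \<le> w k" for k
    unfolding w_def entropy_level_eq using info_rate_nonneg by (simp add: integral_nonneg_AE)
  have \<phi>: "filterlim \<phi> (at_right 0) sequentially"
    unfolding \<phi>_def using \<epsilon> w by (intro filterlim_two_powr_at_right_0[of "\<epsilon> / 2"]) auto
  have "(\<lambda>k. d * (mvar \<nu> (X k) / (\<epsilon> / 2)\<^sup>2) + excess 1 (\<phi> k)) \<longlonglongrightarrow> d * (0 / (\<epsilon> / 2)\<^sup>2) + 0"
    using \<epsilon> by (intro tendsto_intros W filterlim_compose[OF excess_tendsto_0 \<phi>]) auto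
  then have "\<forall>\<^sub>F k in sequentially. d * (mvar \<nu> (X k) / (\<epsilon> / 2)\<^sup>2) + excess 1 (\<phi> k) < \<epsilon> / 2"
    by (rule order_tendstoD(2)) (use \<epsilon> in simp)
  then have "\<forall>\<^sub>F k in sequentially. h (\<phi> k) - \<epsilon> \<le> H k"
    using eventually_compose_filterlim[OF eventually_at_right_unit \<phi>] eventually_ge_at_top[of 1]
  proof eventually_elim
    case (elim k)
    have "0 < w k" using w[of k] \<epsilon> by linarith
    then have "prob {x. w k \<le> dim_est \<nu> (\<phi> k) x} = prob {x. w k < X k x}"
      unfolding \<phi>_def using elim by (intro prob_dim_est_ge_level) auto
    also have "\<dots> \<le> mvar \<nu> (X k) / (\<epsilon> / 2)\<^sup>2"
      unfolding w_def using \<epsilon> by (intro prob_info_rate_above_mean) auto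
    finally have "d * prob {x. w k \<le> dim_est \<nu> (\<phi> k) x} \<le> d * (mvar \<nu> (X k) / (\<epsilon> / 2)\<^sup>2)"
      using d_ge_1 by (intro mult_left_mono) auto
    moreover have "h (\<phi> k) \<le> w k + d * prob {x. w k \<le> dim_est \<nu> (\<phi> k) x} + excess 1 (\<phi> k)"
      using elim \<open>0 < w k\<close> by (intro h_est_le_threshold) auto
    ultimately have "h (\<phi> k) \<le> w k + \<epsilon> / 2" using elim(1) by linarith
    then show ?case by (simp add: w_def)
  qed
  with \<phi> show "\<exists>\<phi>. filterlim \<phi> (at_right 0) sequentially \<and>
      (\<forall>\<^sub>F k in sequentially. h (\<phi> k) - \<epsilon> \<le> H k)" by blast
qed

lemma h_upper_le_Limsup_h_est:
  assumes W: "(\<lambda>k. mvar \<nu> (X k)) \<longlonglongrightarrow> 0"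
  shows "h_upper \<nu> \<le> Limsup (at_right 0) (\<lambda>t. ereal (h t))"
  unfolding h_upper_def
proof (rule Limsup_ereal_mono_along)
  fix \<epsilon> :: real assume \<epsilon>: "0 < \<epsilon>"
  \<comment> \<open>The cap \<open>a / 4\<close> keeps \<open>w k\<close> at least
    \<open>a / 4\<close>, as \<open>H k\<close> is eventually at least \<open>a / 2\<close>; this
    forces \<open>2 powr (- k w)\<close> to tend to 0.\<close>
  define \<delta> where "\<delta> = min (\<epsilon> / 2) (a / 4)"
  have \<delta>: "0 < \<delta>" "\<delta> \<le> \<epsilon> / 2" "\<delta> \<le> a / 4" using \<epsilon> a by (auto simp: \<delta>_def)
  define w where "w k = H k - \<delta>" for k
  define \<phi> where "\<phi> k = 2 powr (- (real k * w k))" for k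
  have w: "\<forall>\<^sub>F k in sequentially. a / 4 \<le> w k"
    using entropy_level_eventually_ge by eventually_elim (use \<delta> in \<open>simp add: w_def\<close>)
  have \<phi>: "filterlim \<phi> (at_right 0) sequentially"
    unfolding \<phi>_def using a w by (intro filterlim_two_powr_at_right_0[of "a / 4"]) auto
  have "(\<lambda>k. (d + 2) * (mvar \<nu> (X k) / \<delta>\<^sup>2)) \<longlonglongrightarrow> (d + 2) * (0 / \<delta>\<^sup>2)"
    using \<delta> by (intro tendsto_intros W) auto
  then have "\<forall>\<^sub>F k in sequentially. (d + 2) * (mvar \<nu> (X k) / \<delta>\<^sup>2) < \<epsilon> / 2"
    by (rule order_tendstoD(2)) (use \<epsilon> in simp)
  then have "\<forall>\<^sub>F k in sequentially. H k \<le> h (\<phi> k) + \<epsilon>"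
    using eventually_compose_filterlim[OF eventually_at_right_unit \<phi>] eventually_ge_at_top[of 1] w
  proof eventually_elim
    case (elim k)
    let ?p = "mvar \<nu> (X k) / \<delta>\<^sup>2"
    have w0: "0 < w k" using elim a by linarith
    have "2 / real k \<le> 2" using elim by (simp add: field_simps)
    then have w1: "w k \<le> d + 2" using entropy_level_le_dim[OF elim(3)] \<delta> by (simp add: w_def)
    have "prob {x. w k \<le> dim_est \<nu> (\<phi> k) x} = prob {x. w k < X k x}"
      unfolding \<phi>_def using elim w0 by (intro prob_dim_est_ge_level) auto
    also have "1 - ?p \<le> \<dots>"
      unfolding w_def using \<delta> by (intro prob_info_rate_below_mean) auto
    finally have "w k * (1 - ?p) \<le> w k * prob {x. w k \<le> dim_est \<nu> (\<phi> k) x}"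
      using w0 by (intro mult_left_mono) auto
    also have "\<dots> \<le> h (\<phi> k)"
      unfolding h_est_def using elim dim_est_pos
      by (intro expectation_ge_threshold integrable_dim_est[of _ "\<lambda>y. y"]) (auto intro: less_imp_le)
    finally have "w k - w k * ?p \<le> h (\<phi> k)" by (simp add: right_diff_distrib)
    moreover have "w k * ?p \<le> (d + 2) * ?p"
      using w1 mvar_info_rate_nonneg by (intro mult_right_mono) auto
    ultimately have "w k \<le> h (\<phi> k) + \<epsilon> / 2" using elim(1) by linarith
    then show ?case using \<delta> by (simp add: w_def)
  qed
  with \<phi> show "\<exists>\<phi>. filterlim \<phi> (at_right 0) sequentially \<and>
      (\<forall>\<^sub>F k in sequentially. H k \<le> h (\<phi> k) + \<epsilon>)" by blast
qed

text \<open>Here \<open>t\<close> is given and the level is found by rounding, so Chebyshev is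
  applied to \<open>dim_est\<close>; hence the hypothesis is on the variance of the estimate and not
  on that of \<open>X k\<close>.\<close>

lemma Limsup_h_est_le_h_upper:
  assumes V: "(V \<longlongrightarrow> 0) (at_right 0)"
  shows "Limsup (at_right 0) (\<lambda>t. ereal (h t)) \<le> h_upper \<nu>"
  unfolding h_upper_def
proof (rule Limsup_ereal_mono_along)
  fix \<epsilon> :: real assume \<epsilon>: "0 < \<epsilon>"
  define \<delta> where "\<delta> = min (\<epsilon> / 2) (a / 4)"
  have \<delta>: "0 < \<delta>" "\<delta> \<le> \<epsilon> / 2" "\<delta> \<le> a / 4" using \<epsilon> a by (auto simp: \<delta>_def)
  define v where "v t = h t - \<delta>" for t
  define \<phi> where "\<phi> t = nat \<lfloor>\<sigma> t / v t\<rfloor>" for t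
  have v: "\<forall>\<^sub>F t in at_right 0. 0 < v t \<and> v t \<le> d + 1"
    using h_est_eventually_bounds by eventually_elim (use \<delta> a in \<open>auto simp: v_def\<close>)
  have \<phi>: "filterlim \<phi> sequentially (at_right 0)"
    unfolding \<phi>_def using d_ge_1 by (intro filterlim_level[OF v]) auto
  have "((\<lambda>t. (d + 1) * (V t / \<delta>\<^sup>2)) \<longlongrightarrow> (d + 1) * (0 / \<delta>\<^sup>2)) (at_right 0)"
    using \<delta> by (intro tendsto_intros V) auto
  then have "\<forall>\<^sub>F t in at_right 0. (d + 1) * (V t / \<delta>\<^sup>2) < \<epsilon> / 2"
    by (rule order_tendstoD(2)) (use \<epsilon> in simp)
  then have "\<forall>\<^sub>F t in at_right 0. h t \<le> H (\<phi> t) + \<epsilon>"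
    using eventually_at_right_unit eventually_compose_filterlim[OF eventually_ge_at_top[of 1] \<phi>] v
  proof eventually_elim
    case (elim t)
    then have t: "0 < t" "t < 1" and v0: "0 < v t" "v t \<le> d + 1" and k: "1 \<le> \<phi> t" by auto
    let ?p = "V t / \<delta>\<^sup>2"
    have "1 - ?p \<le> prob {x. v t \<le> dim_est \<nu> t x}"
      unfolding v_def using \<delta> by (intro prob_dim_est_below_mean t)
    also have "\<dots> = prob {x. \<sigma> t / real (\<phi> t) < X (\<phi> t) x}"
      by (intro prob_dim_est_ge_floor t v0 k) (simp add: \<phi>_def)
    also have "\<dots> \<le> prob {x. v t \<le> X (\<phi> t) x}"
      using level_rate_bounds(1)[OF t v0(1) \<phi>_def k]
      by (intro finite_measure_mono pred_imp_sets) auto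
    finally have "v t * (1 - ?p) \<le> v t * prob {x. v t \<le> X (\<phi> t) x}"
      using v0 by (intro mult_left_mono) auto
    also have "\<dots> \<le> H (\<phi> t)"
      unfolding entropy_level_eq
      by (intro expectation_ge_threshold integral_info_rate(1)[of "\<lambda>y. y"] info_rate_nonneg) simp
    finally have "v t - v t * ?p \<le> H (\<phi> t)" by (simp add: right_diff_distrib)
    moreover have "v t * ?p \<le> (d + 1) * ?p"
      using v0 V_est_nonneg by (intro mult_right_mono) auto
    ultimately have "v t \<le> H (\<phi> t) + \<epsilon> / 2" using elim(1) by linarith
    then show ?case using \<delta> by (simp add: v_def)
  qed
  with \<phi> show "\<exists>\<phi>. filterlim \<phi> sequentially (at_right 0) \<and>
      (\<forall>\<^sub>F t in at_right 0. h t \<le> H (\<phi> t) + \<epsilon>)" by blast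
qed

lemma h_lower_le_Liminf_h_est:
  assumes V: "(V \<longlongrightarrow> 0) (at_right 0)"
  shows "h_lower \<nu> \<le> Liminf (at_right 0) (\<lambda>t. ereal (h t))"
  unfolding h_lower_def
proof (rule Liminf_ereal_mono_along)
  fix \<epsilon> :: real assume \<epsilon>: "0 < \<epsilon>"
  define \<delta> where "\<delta> = min (\<epsilon> / 2) 1"
  have \<delta>: "0 < \<delta>" "\<delta> \<le> \<epsilon> / 2" "\<delta> \<le> 1" using \<epsilon> by (auto simp: \<delta>_def)
  define v where "v t = h t + \<delta>" for t
  define \<phi> where "\<phi> t = nat \<lfloor>\<sigma> t / v t\<rfloor>" for t
  have v: "\<forall>\<^sub>F t in at_right 0. 0 < v t \<and> v t \<le> d + 2"
    using h_est_eventually_bounds by eventually_elim (use \<delta> a in \<open>auto simp: v_def\<close>)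
  have \<phi>: "filterlim \<phi> sequentially (at_right 0)"
    unfolding \<phi>_def using d_ge_1 by (intro filterlim_level[OF v]) auto
  \<comment> \<open>Rounding the level costs \<open>v t / k \<le> (d + 2) / k\<close>, the excess of
    the information rate over \<open>d\<close> another \<open>2 / k\<close>.\<close>
  have "(\<lambda>k. (d + 4) / real k) \<longlonglongrightarrow> 0" by real_asymp
  then have "((\<lambda>t. (d + 4) / real (\<phi> t) + d * (V t / \<delta>\<^sup>2)) \<longlongrightarrow> 0 + d * (0 / \<delta>\<^sup>2)) (at_right 0)"
    using \<delta> by (intro tendsto_intros V filterlim_compose[OF _ \<phi>]) auto
  then have "\<forall>\<^sub>F t in at_right 0. (d + 4) / real (\<phi> t) + d * (V t / \<delta>\<^sup>2) < \<epsilon> / 2"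
    by (rule order_tendstoD(2)) (use \<epsilon> in simp)
  then have "\<forall>\<^sub>F t in at_right 0. H (\<phi> t) - \<epsilon> \<le> h t"
    using eventually_at_right_unit eventually_compose_filterlim[OF eventually_ge_at_top[of 1] \<phi>] v
  proof eventually_elim
    case (elim t)
    then have t: "0 < t" "t < 1" and v0: "0 < v t" "v t \<le> d + 2" and k: "1 \<le> \<phi> t" by auto
    let ?p = "V t / \<delta>\<^sup>2" and ?w = "\<sigma> t / real (\<phi> t)"
    have "prob {x. ?w < X (\<phi> t) x} = prob {x. v t \<le> dim_est \<nu> t x}"
      by (intro prob_dim_est_ge_floor[symmetric] t v0 k) (simp add: \<phi>_def)
    also have "\<dots> \<le> ?p"
      unfolding v_def using \<delta> by (intro prob_dim_est_above_mean t)
    finally have "d * prob {x. ?w < X (\<phi> t) x} \<le> d * ?p"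
      using d_ge_1 by (intro mult_left_mono) auto
    moreover have "H (\<phi> t) \<le> ?w + d * prob {x. ?w < X (\<phi> t) x} + 2 / real (\<phi> t)"
      using sigma_pos[OF t] by (intro entropy_level_le k) auto
    moreover have "?w \<le> v t + v t / real (\<phi> t)" by (rule level_rate_bounds(2)[OF t v0(1) \<phi>_def k])
    moreover have "v t / real (\<phi> t) + 2 / real (\<phi> t) \<le> (d + 4) / real (\<phi> t)"
      using v0 by (simp add: add_divide_distrib[symmetric] divide_right_mono)
    ultimately have "H (\<phi> t) \<le> v t + \<epsilon> / 2" using elim(1) by linarith
    then show ?case using \<delta> by (simp add: v_def)
  qed
  with \<phi> show "\<exists>\<phi>. filterlim \<phi> sequentially (at_right 0) \<and>
      (\<forall>\<^sub>F t in at_right 0. H (\<phi> t) - \<epsilon> \<le> h t)" by blast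
qed

lemma h_lower_upper_eq:
  assumes "(V \<longlongrightarrow> 0) (at_right 0)"
  shows "h_lower \<nu> = Liminf (at_right 0) (\<lambda>t. ereal (h t))"
    and "h_upper \<nu> = Limsup (at_right 0) (\<lambda>t. ereal (h t))"
  using Liminf_h_est_le_h_lower h_upper_le_Limsup_h_est Limsup_h_est_le_h_upper h_lower_le_Liminf_h_est
    mvar_info_rate_tendsto_0 assms by (auto intro: antisym)

lemma Liminf_Limsup_h_est_eq_D0:
  assumes hD: "((\<lambda>t. h t - D t) \<longlongrightarrow> 0) (at_right 0)"
  shows "Liminf (at_right 0) (\<lambda>t. ereal (h t)) = D0_lower \<nu>"
    and "Limsup (at_right 0) (\<lambda>t. ereal (h t)) = D0_upper \<nu>"
proof -
  have ev: "\<forall>\<^sub>F t in at_right 0. D t - \<epsilon> \<le> h t" "\<forall>\<^sub>F t in at_right 0. h t - \<epsilon> \<le> D t"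
    "\<forall>\<^sub>F t in at_right 0. D t \<le> h t + \<epsilon>" "\<forall>\<^sub>F t in at_right 0. h t \<le> D t + \<epsilon>"
    if "0 < \<epsilon>" for \<epsilon>
    using order_tendstoD(2)[OF hD that] eventually_at_right_unit
    by (eventually_elim, use D_est_le_h_est that in force)+
  have id: "filterlim (\<lambda>t. t) (at_right 0) (at_right (0 :: real))" by (rule filterlim_ident)
  show "Liminf (at_right 0) (\<lambda>t. ereal (h t)) = D0_lower \<nu>"
    unfolding D0_lower_eq using ev(1,2) id by (intro antisym Liminf_ereal_mono_along) blast+
  show "Limsup (at_right 0) (\<lambda>t. ereal (h t)) = D0_upper \<nu>"
    unfolding D0_upper_eq using ev(3,4) id by (intro antisym Limsup_ereal_mono_along) blast+
qed

end

section \<open>Weak limits of the information rates\<close>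

text \<open>Testing against the continuous ramp between \<open>x\<close> and \<open>y\<close>
  compares distribution functions at two distinct points, whether or not these are continuity points
  of the limit.\<close>

lemma weak_conv_m_eventually_cdf:
  assumes \<mu>: "\<And>n. real_distribution (\<mu> n)" and \<rho>: "real_distribution \<rho>" and wc: "weak_conv_m \<mu> \<rho>"
    and xy: "x < y" and \<delta>: "0 < \<delta>"
  shows "\<forall>\<^sub>F n in sequentially. cdf (\<mu> n) x \<le> cdf \<rho> y + \<delta>"
    and "\<forall>\<^sub>F n in sequentially. cdf \<rho> x - \<delta> \<le> cdf (\<mu> n) y"
proof -
  have lim: "(\<lambda>n. integral\<^sup>L (\<mu> n) (cts_step x y)) \<longlonglongrightarrow> integral\<^sup>L \<rho> (cts_step x y)"
  proof (rule weak_conv_imp_integral_bdd_continuous_conv[OF \<mu> \<rho> wc])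
    show "isCont (cts_step x y) z" for z
      using uniformly_continuous_imp_continuous[OF cts_step_uniformly_continuous[OF xy]]
      by (simp add: continuous_on_eq_continuous_at)
    show "norm (cts_step x y z) \<le> 1" for z
      using xy by (auto simp: cts_step_def field_simps)
  qed
  note step = real_distribution.cdf_cts_step[OF _ xy]
  have "\<forall>\<^sub>F n in sequentially. integral\<^sup>L (\<mu> n) (cts_step x y) < integral\<^sup>L \<rho> (cts_step x y) + \<delta>"
    by (rule order_tendstoD(2)[OF lim]) (use \<delta> in simp)
  then show "\<forall>\<^sub>F n in sequentially. cdf (\<mu> n) x \<le> cdf \<rho> y + \<delta>"
  proof eventually_elim
    case (elim n)
    then show ?case using step(1)[OF \<mu>[of n]] step(2)[OF \<rho>] by linarith
  qed
  have "\<forall>\<^sub>F n in sequentially. integral\<^sup>L \<rho> (cts_step x y) - \<delta> < integral\<^sup>L (\<mu> n) (cts_step x y)"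
    by (rule order_tendstoD(1)[OF lim]) (use \<delta> in simp)
  then show "\<forall>\<^sub>F n in sequentially. cdf \<rho> x - \<delta> \<le> cdf (\<mu> n) y"
  proof eventually_elim
    case (elim n)
    then show ?case using step(2)[OF \<mu>[of n]] step(1)[OF \<rho>] by linarith
  qed
qed

context frostman_measure
begin

lemma cdf_distr:
  assumes [measurable]: "Z \<in> borel_measurable \<nu>"
  shows "cdf (distr \<nu> borel Z) x = prob {y. Z y \<le> x}"
proof -
  have "Z -` {..x} \<inter> space \<nu> = {y. Z y \<le> x}" by auto
  then show ?thesis by (simp add: cdf_def measure_distr)
qed

lemma prob_le_eq:
  assumes [measurable]: "Z \<in> borel_measurable \<nu>"
  shows "prob {y. Z y \<le> x} = 1 - prob {y. x < (Z y :: real)}"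
  using prob_not[of "\<lambda>y. x < Z y"] by (simp add: not_less)

text \<open>Weak convergence tests bounded continuous functions only. The part clipped to
  \<open>[0, d]\<close> is bounded, the rest is the excess, whose moments vanish; the limit lives on
  \<open>[a, d]\<close>, where clipping does nothing. The sequence \<open>Z\<close> is left general
  to serve both \<open>info_rate\<close> and \<open>dim_est\<close>.\<close>

lemma clipped_moments:
  fixes Z :: "nat \<Rightarrow> real ^ 'n \<Rightarrow> real"
  assumes Z: "\<And>n F. F \<in> borel_measurable borel \<Longrightarrow> integrable \<nu> (\<lambda>x. F (Z n x) :: real)" "\<And>n x. 0 \<le> Z n x"
    and meas: "\<And>n. Z n \<in> borel_measurable \<nu>"
    and \<rho>: "real_distribution \<rho>" and wc: "weak_conv_m (\<lambda>n. distr \<nu> borel (Z n)) \<rho>"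
    and supp: "AE y in \<rho>. a \<le> y \<and> y \<le> d"
    and u1: "(\<lambda>n. \<integral>x. max (Z n x - d) 0 \<partial>\<nu>) \<longlonglongrightarrow> 0"
    and u2: "(\<lambda>n. \<integral>x. (max (Z n x - d) 0)\<^sup>2 \<partial>\<nu>) \<longlonglongrightarrow> 0"
  shows "(\<lambda>n. \<integral>x. Z n x \<partial>\<nu>) \<longlonglongrightarrow> (\<integral>y. y \<partial>\<rho>)"
    and "(\<lambda>n. \<integral>x. (Z n x)\<^sup>2 \<partial>\<nu>) \<longlonglongrightarrow> (\<integral>y. y\<^sup>2 \<partial>\<rho>)"
    and "\<forall>\<^sub>F n in sequentially. \<forall>x. a / 2 \<le> Z n x \<Longrightarrow> (\<lambda>n. \<integral>x. inverse (Z n x) \<partial>\<nu>) \<longlonglongrightarrow> (\<integral>y. 1 / y \<partial>\<rho>)"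
proof -
  interpret \<rho>: real_distribution \<rho> by fact
  have bdd: "(\<lambda>n. \<integral>x. \<phi> (Z n x) \<partial>\<nu>) \<longlonglongrightarrow> (\<integral>y. \<phi> y \<partial>\<rho>)"
    if cont: "continuous_on UNIV \<phi>" and B: "\<And>y. \<bar>\<phi> y\<bar> \<le> B" for \<phi> :: "real \<Rightarrow> real" and B
  proof -
    have "(\<lambda>n. integral\<^sup>L (distr \<nu> borel (Z n)) \<phi>) \<longlonglongrightarrow> integral\<^sup>L \<rho> \<phi>"
      using cont B
      by (intro weak_conv_imp_integral_bdd_continuous_conv[OF _ \<rho> wc] real_distribution_distr meas)
         (auto simp: continuous_on_eq_continuous_at)
    moreover have "integral\<^sup>L (distr \<nu> borel (Z n)) \<phi> = (\<integral>x. \<phi> (Z n x) \<partial>\<nu>)" for n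
      using borel_measurable_continuous_onI[OF cont] meas by (intro integral_distr)
    ultimately show ?thesis by simp
  qed
  let ?c = "\<lambda>y. max 0 (min y d)" and ?u = "\<lambda>y. max (y - d) 0"
  have c1: "(\<lambda>n. \<integral>x. ?c (Z n x) \<partial>\<nu>) \<longlonglongrightarrow> (\<integral>y. ?c y \<partial>\<rho>)"
    by (intro bdd[of _ d] continuous_intros) (use d_ge_1 in auto)
  have c2: "(\<lambda>n. \<integral>x. (?c (Z n x))\<^sup>2 \<partial>\<nu>) \<longlonglongrightarrow> (\<integral>y. (?c y)\<^sup>2 \<partial>\<rho>)"
    by (intro bdd[of _ "d\<^sup>2"] continuous_intros) (use d_ge_1 in \<open>auto intro!: power_mono\<close>)
  have cc: "AE y in \<rho>. ?c y = y" using supp by eventually_elim (use a in auto)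
  have split1: "z = ?c z + ?u z" if "0 \<le> z" for z
    using that d_ge_1 by (simp add: max_def min_def)
  have split2: "z\<^sup>2 = (?c z)\<^sup>2 + 2 * d * ?u z + (?u z)\<^sup>2" if "0 \<le> z" for z
  proof (cases "d \<le> z")
    case True
    then have "?c z = d" "?u z = z - d" using d_ge_1 by auto
    then show ?thesis by (simp add: power2_eq_square algebra_simps)
  next
    case False
    then show ?thesis using that by auto
  qed
  note int = Z(1)[of ?c] Z(1)[of ?u] Z(1)[of "\<lambda>z. (?c z)\<^sup>2"] Z(1)[of "\<lambda>z. (?u z)\<^sup>2"]
  have "(\<lambda>n. (\<integral>x. ?c (Z n x) \<partial>\<nu>) + (\<integral>x. ?u (Z n x) \<partial>\<nu>)) \<longlonglongrightarrow> (\<integral>y. ?c y \<partial>\<rho>) + 0"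
    by (intro tendsto_intros c1 u1)
  moreover have "(\<integral>x. ?c (Z n x) \<partial>\<nu>) + (\<integral>x. ?u (Z n x) \<partial>\<nu>) = (\<integral>x. Z n x \<partial>\<nu>)" for n
  proof -
    have "(\<integral>x. Z n x \<partial>\<nu>) = (\<integral>x. ?c (Z n x) + ?u (Z n x) \<partial>\<nu>)"
      by (rule Bochner_Integration.integral_cong[OF refl split1[OF Z(2)]])
    also have "\<dots> = (\<integral>x. ?c (Z n x) \<partial>\<nu>) + (\<integral>x. ?u (Z n x) \<partial>\<nu>)"
      by (intro Bochner_Integration.integral_add int) auto
    finally show ?thesis by simp
  qed
  moreover have "(\<integral>y. ?c y \<partial>\<rho>) = (\<integral>y. y \<partial>\<rho>)"
    using cc by (intro integral_cong_AE) auto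
  ultimately show "(\<lambda>n. \<integral>x. Z n x \<partial>\<nu>) \<longlonglongrightarrow> (\<integral>y. y \<partial>\<rho>)" by simp
  have "(\<lambda>n. (\<integral>x. (?c (Z n x))\<^sup>2 \<partial>\<nu>) + 2 * d * (\<integral>x. ?u (Z n x) \<partial>\<nu>) + (\<integral>x. (?u (Z n x))\<^sup>2 \<partial>\<nu>))
      \<longlonglongrightarrow> (\<integral>y. (?c y)\<^sup>2 \<partial>\<rho>) + 2 * d * 0 + 0"
    by (intro tendsto_intros c2 u1 u2)
  moreover have "(\<integral>x. (?c (Z n x))\<^sup>2 \<partial>\<nu>) + 2 * d * (\<integral>x. ?u (Z n x) \<partial>\<nu>) + (\<integral>x. (?u (Z n x))\<^sup>2 \<partial>\<nu>) = (\<integral>x. (Z n x)\<^sup>2 \<partial>\<nu>)" for n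
  proof -
    have i: "integrable \<nu> (\<lambda>x. 2 * d * ?u (Z n x))" by (intro integrable_mult_right int) auto
    have "(\<integral>x. (Z n x)\<^sup>2 \<partial>\<nu>) = (\<integral>x. (?c (Z n x))\<^sup>2 + 2 * d * ?u (Z n x) + (?u (Z n x))\<^sup>2 \<partial>\<nu>)"
      by (rule Bochner_Integration.integral_cong[OF refl split2[OF Z(2)]])
    also have "\<dots> = (\<integral>x. (?c (Z n x))\<^sup>2 + 2 * d * ?u (Z n x) \<partial>\<nu>) + (\<integral>x. (?u (Z n x))\<^sup>2 \<partial>\<nu>)"
      by (intro Bochner_Integration.integral_add Bochner_Integration.integrable_add int i) auto
    also have "(\<integral>x. (?c (Z n x))\<^sup>2 + 2 * d * ?u (Z n x) \<partial>\<nu>) = (\<integral>x. (?c (Z n x))\<^sup>2 \<partial>\<nu>) + (\<integral>x. 2 * d * ?u (Z n x) \<partial>\<nu>)"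
      by (intro Bochner_Integration.integral_add int i) auto
    finally show ?thesis by simp
  qed
  moreover have "(\<integral>y. (?c y)\<^sup>2 \<partial>\<rho>) = (\<integral>y. y\<^sup>2 \<partial>\<rho>)"
    using cc by (intro integral_cong_AE) auto
  ultimately show "(\<lambda>n. \<integral>x. (Z n x)\<^sup>2 \<partial>\<nu>) \<longlonglongrightarrow> (\<integral>y. y\<^sup>2 \<partial>\<rho>)" by simp
  assume low: "\<forall>\<^sub>F n in sequentially. \<forall>x. a / 2 \<le> Z n x"
  \<comment> \<open>Agrees with the reciprocal above \<open>a / 2\<close>, where both the limit and
    eventually the sequence live, but is bounded and continuous on the whole line.\<close>
  let ?i = "\<lambda>y. 1 / max y (a / 2)"
  have "(\<lambda>n. \<integral>x. ?i (Z n x) \<partial>\<nu>) \<longlonglongrightarrow> (\<integral>y. ?i y \<partial>\<rho>)"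
  proof (rule bdd[of _ "2 / a"])
    have "max y (a / 2) \<noteq> 0" for y using a by (simp add: max_def)
    then show "continuous_on UNIV ?i" by (intro continuous_intros) auto
    have "1 / max y (a / 2) \<le> 1 / (a / 2)" for y using a by (intro divide_left_mono) (auto simp: max_def)
    moreover have "0 \<le> 1 / max y (a / 2)" for y using a by (simp add: max_def)
    ultimately show "\<bar>?i y\<bar> \<le> 2 / a" for y by simp
  qed
  moreover have "\<forall>\<^sub>F n in sequentially. (\<integral>x. ?i (Z n x) \<partial>\<nu>) = (\<integral>x. inverse (Z n x) \<partial>\<nu>)"
    using low by eventually_elim (simp add: max_absorb1 inverse_eq_divide)
  moreover have "(\<integral>y. ?i y \<partial>\<rho>) = (\<integral>y. 1 / y \<partial>\<rho>)"
    using supp a by (intro integral_cong_AE) (auto elim!: eventually_mono simp: max_def)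
  ultimately show "(\<lambda>n. \<integral>x. inverse (Z n x) \<partial>\<nu>) \<longlonglongrightarrow> (\<integral>y. 1 / y \<partial>\<rho>)"
    by (simp add: tendsto_cong)
qed

lemma info_rate_excess_tendsto_0:
  assumes "0 < n"
  shows "(\<lambda>k. \<integral>x. (max (X k x - d) 0) ^ n \<partial>\<nu>) \<longlonglongrightarrow> 0"
proof (rule tendsto_sandwich[OF _ _ tendsto_const])
  show "\<forall>\<^sub>F k in sequentially. 0 \<le> (\<integral>x. (max (X k x - d) 0) ^ n \<partial>\<nu>)"
    by (intro always_eventually allI integral_nonneg_AE) auto
  show "\<forall>\<^sub>F k in sequentially. (\<integral>x. (max (X k x - d) 0) ^ n \<partial>\<nu>) \<le> (2 * real n / real k) ^ n"
    using eventually_ge_at_top[of 1] by eventually_elim (intro info_rate_excess assms, simp)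
  have "(\<lambda>k. 2 * real n / real k) \<longlonglongrightarrow> 0" by real_asymp
  from tendsto_power[OF this, of n] show "(\<lambda>k. (2 * real n / real k) ^ n) \<longlonglongrightarrow> 0"
    unfolding zero_power[OF assms] .
qed

lemma real_distribution_info_rate: "real_distribution (distr \<nu> borel (X k))"
  by (intro real_distribution_distr) measurable

context
  fixes \<rho> :: "real measure"
  assumes \<rho>: "real_distribution \<rho>" and wc: "weak_conv_m (\<lambda>k. distr \<nu> borel (X k)) \<rho>"
begin

interpretation \<rho>: real_distribution \<rho> by (rule \<rho>)

lemma eventually_prob_info_rate:
  assumes "x < y" "0 < \<delta>"
  shows "\<forall>\<^sub>F k in sequentially. 1 - prob {z. x < X k z} \<le> cdf \<rho> y + \<delta>"
    and "\<forall>\<^sub>F k in sequentially. cdf \<rho> x - \<delta> \<le> 1 - prob {z. y < X k z}"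
  using weak_conv_m_eventually_cdf[OF real_distribution_info_rate \<rho> wc assms]
  by (simp_all add: cdf_distr prob_le_eq)

text \<open>The Frostman bound keeps \<open>X k\<close> almost surely above
  \<open>a - log 2 C / k\<close>. The midpoint \<open>y\<close> leaves room for the two-point
  comparison of distribution functions.\<close>

lemma limit_cdf_eq_0:
  assumes x: "x < a"
  shows "cdf \<rho> x = 0"
proof (rule antisym)
  show "0 \<le> cdf \<rho> x" by (rule \<rho>.cdf_nonneg)
  show "cdf \<rho> x \<le> 0"
  proof (rule field_le_epsilon)
    fix \<delta> :: real assume \<delta>: "0 < \<delta>"
    define y where "y = (x + a) / 2"
    have y: "x < y" "y < a" using x by (auto simp: y_def)
    have "(\<lambda>k. a - log 2 C / real k) \<longlonglongrightarrow> a" by real_asymp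
    then have "\<forall>\<^sub>F k in sequentially. y < a - log 2 C / real k"
      by (rule order_tendstoD(1)) (use y in simp)
    with eventually_ge_at_top[of 1] have "\<forall>\<^sub>F k in sequentially. prob {z. y < X k z} = 1"
    proof eventually_elim
      case (elim k)
      have "AE z in \<nu>. z \<in> {z. y < X k z}"
        using AE_info_rate_ge[OF elim(1)] elim(2) by (auto elim!: eventually_mono)
      then show ?case by (subst prob_eq_1) (auto intro!: pred_imp_sets)
    qed
    with eventually_prob_info_rate(2)[OF y(1) \<delta>] have "\<forall>\<^sub>F k in sequentially. cdf \<rho> x \<le> 0 + \<delta>"
      by eventually_elim simp
    then show "cdf \<rho> x \<le> 0 + \<delta>" using eventually_happens'[OF sequentially_bot] by blast
  qed
qed

text \<open>Counting cubes bounds the probability of \<open>X k > x\<close> by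
  \<open>2 powr (- k (x - d))\<close>, which vanishes in the limit for \<open>x > d\<close>.\<close>

lemma limit_cdf_eq_1:
  assumes y: "d < y"
  shows "cdf \<rho> y = 1"
proof (rule antisym)
  show "cdf \<rho> y \<le> 1" by (rule \<rho>.cdf_bounded_prob)
  show "1 \<le> cdf \<rho> y"
  proof (rule field_le_epsilon)
    fix \<delta> :: real assume \<delta>: "0 < \<delta>"
    define x where "x = (y + d) / 2"
    have x: "d < x" "x < y" using y by (auto simp: x_def)
    have "(\<lambda>k. 2 powr (- (real k * c))) \<longlonglongrightarrow> 0" if "0 < c" for c using that by real_asymp
    from this[of "x - d"] have "(\<lambda>k. 2 powr (- (real k * (x - d)))) \<longlonglongrightarrow> 0" using x by simp
    then have "\<forall>\<^sub>F k in sequentially. 2 powr (- (real k * (x - d))) < \<delta> / 2"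
      by (rule order_tendstoD(2)) (use \<delta> in simp)
    moreover have "\<forall>\<^sub>F k in sequentially. 1 - prob {z. x < X k z} \<le> cdf \<rho> y + \<delta> / 2"
      using x \<delta> by (intro eventually_prob_info_rate(1)) auto
    moreover note eventually_ge_at_top[of "1 :: nat"]
    ultimately have "\<forall>\<^sub>F k in sequentially. 1 \<le> cdf \<rho> y + \<delta>"
    proof eventually_elim
      case (elim k)
      have "prob {z. x < X k z} \<le> 2 ^ (k * CARD('n)) * 2 powr (- (real k * x))"
        unfolding prob_info_rate_gt[OF elim(3)] by (rule prob_mass_less) simp
      also have "\<dots> = 2 powr (- (real k * (x - d)))"
        by (simp add: dim powr_realpow[symmetric] powr_add[symmetric] algebra_simps)
      finally show ?case using elim(1,2) by linarith
    qed
    then show "1 \<le> cdf \<rho> y + \<delta>" using eventually_happens'[OF sequentially_bot] by blast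
  qed
qed

text \<open>The distribution function is known only strictly outside \<open>[a, d]\<close>, so the
  end points are reached through countably many shrinking margins.\<close>

lemma AE_limit: "AE y in \<rho>. a \<le> y \<and> y \<le> d"
proof -
  have "AE y in \<rho>. a - inverse (real (Suc n)) < y \<and> y \<le> d + inverse (real (Suc n))" for n
  proof -
    have "0 < inverse (real (Suc n))" by simp
    then have "a - inverse (real (Suc n)) < a" "d < d + inverse (real (Suc n))" by linarith+
    note cdf = limit_cdf_eq_0[OF this(1)] limit_cdf_eq_1[OF this(2)]
    have "AE y in \<rho>. y \<in> {.. d + inverse (real (Suc n))}"
      using cdf(2) by (subst \<rho>.prob_eq_1[symmetric]) (auto simp: cdf_def)
    moreover have "AE y in \<rho>. y \<notin> {.. a - inverse (real (Suc n))}"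
      using cdf(1) by (intro AE_not_in) (auto simp: cdf_def null_sets_def \<rho>.emeasure_eq_measure)
    ultimately show ?thesis by eventually_elim auto
  qed
  then have "AE y in \<rho>. \<forall>n. a - inverse (real (Suc n)) < y \<and> y \<le> d + inverse (real (Suc n))"
    by (simp add: AE_all_countable)
  then show ?thesis
  proof eventually_elim
    case (elim y)
    have lim: "(\<lambda>n. inverse (real (Suc n))) \<longlonglongrightarrow> 0" by (rule LIMSEQ_inverse_real_of_nat)
    have "a - 0 \<le> y"
      using elim by (intro LIMSEQ_le_const2[OF tendsto_diff[OF tendsto_const lim]]) (auto intro: less_imp_le)
    moreover have "y \<le> d + 0"
      using elim by (intro LIMSEQ_le_const[OF tendsto_add[OF tendsto_const lim]]) auto
    ultimately show ?case by simp
  qed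
qed

text \<open>The allowance \<open>3 \<eta>\<close> is spent once on replacing \<open>\<le> v\<close>
  by \<open>< v + \<eta>\<close>, once on rounding the level, and once on the two-point
  comparison.\<close>

lemma eventually_cdf_dim_est_upper:
  assumes v: "0 < v" and \<eta>: "0 < \<eta>" and \<delta>: "0 < \<delta>"
  shows "\<forall>\<^sub>F t in at_right 0. prob {z. dim_est \<nu> t z \<le> v} \<le> cdf \<rho> (v + 3 * \<eta>) + \<delta>"
proof -
  let ?v = "v + \<eta>" and ?k = "\<lambda>t. nat \<lfloor>\<sigma> t / (v + \<eta>)\<rfloor>"
  have v': "0 < ?v" using v \<eta> by simp
  have k: "filterlim ?k sequentially (at_right 0)"
    using v' by (intro filterlim_level[of "\<lambda>_. ?v" ?v]) auto
  have "(\<lambda>k. ?v / real k) \<longlonglongrightarrow> 0" by real_asymp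
  then have "\<forall>\<^sub>F k in sequentially. ?v / real k < \<eta>" by (rule order_tendstoD(2)) (rule \<eta>)
  moreover have "\<forall>\<^sub>F k in sequentially. 1 - prob {z. v + 2 * \<eta> < X k z} \<le> cdf \<rho> (v + 3 * \<eta>) + \<delta>"
    using \<eta> \<delta> by (intro eventually_prob_info_rate(1)) auto
  ultimately have "\<forall>\<^sub>F k in sequentially. ?v / real k < \<eta> \<and> 1 \<le> k \<and>
      1 - prob {z. v + 2 * \<eta> < X k z} \<le> cdf \<rho> (v + 3 * \<eta>) + \<delta>"
    using eventually_ge_at_top[of 1] by eventually_elim auto
  from eventually_compose_filterlim[OF this k] eventually_at_right_unit show ?thesis
  proof eventually_elim
    case (elim t)
    then have t: "0 < t" "t < 1" and k1: "1 \<le> ?k t" by auto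
    have "prob {z. dim_est \<nu> t z \<le> v} \<le> prob {z. \<not> ?v \<le> dim_est \<nu> t z}"
      using \<eta> by (intro finite_measure_mono pred_imp_sets) auto
    also have "\<dots> = 1 - prob {z. ?v \<le> dim_est \<nu> t z}" by (rule prob_not) measurable
    also have "prob {z. ?v \<le> dim_est \<nu> t z} = prob {z. \<sigma> t / real (?k t) < X (?k t) z}"
      by (rule prob_dim_est_ge_floor[OF t v' refl k1])
    also have "1 - \<dots> \<le> 1 - prob {z. v + 2 * \<eta> < X (?k t) z}"
    proof -
      have "\<sigma> t / real (?k t) \<le> v + 2 * \<eta>" using level_rate_bounds(2)[OF t v' refl k1] elim(1) by linarith
      then show ?thesis by (intro diff_left_mono finite_measure_mono pred_imp_sets) auto
    qed
    finally show ?case using elim(1) by linarith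
  qed
qed

text \<open>Rounding raises the threshold, which is favourable here, so a single
  \<open>\<eta>\<close> for the two-point comparison is enough.\<close>

lemma eventually_cdf_dim_est_lower:
  assumes v: "0 < v" and \<eta>: "0 < \<eta>" and \<delta>: "0 < \<delta>"
  shows "\<forall>\<^sub>F t in at_right 0. cdf \<rho> (v - \<eta>) - \<delta> \<le> prob {z. dim_est \<nu> t z \<le> v}"
proof -
  let ?k = "\<lambda>t. nat \<lfloor>\<sigma> t / v\<rfloor>"
  have k: "filterlim ?k sequentially (at_right 0)"
    using v by (intro filterlim_level[of "\<lambda>_. v" v]) auto
  have "\<forall>\<^sub>F k in sequentially. cdf \<rho> (v - \<eta>) - \<delta> \<le> 1 - prob {z. v < X k z}"
    using \<eta> \<delta> by (intro eventually_prob_info_rate(2)) auto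
  then have "\<forall>\<^sub>F k in sequentially. 1 \<le> k \<and> cdf \<rho> (v - \<eta>) - \<delta> \<le> 1 - prob {z. v < X k z}"
    using eventually_ge_at_top[of 1] by eventually_elim auto
  from eventually_compose_filterlim[OF this k] eventually_at_right_unit show ?thesis
  proof eventually_elim
    case (elim t)
    then have t: "0 < t" "t < 1" and k1: "1 \<le> ?k t" by auto
    have "prob {z. \<sigma> t / real (?k t) < X (?k t) z} \<le> prob {z. v < X (?k t) z}"
      using level_rate_bounds(1)[OF t v refl k1] by (intro finite_measure_mono pred_imp_sets) auto
    moreover have "prob {z. v \<le> dim_est \<nu> t z} = prob {z. \<sigma> t / real (?k t) < X (?k t) z}"
      by (rule prob_dim_est_ge_floor[OF t v refl k1])
    moreover have "prob {z. \<not> v \<le> dim_est \<nu> t z} = 1 - prob {z. v \<le> dim_est \<nu> t z}"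
      by (rule prob_not) measurable
    moreover have "prob {z. \<not> v \<le> dim_est \<nu> t z} \<le> prob {z. dim_est \<nu> t z \<le> v}"
      by (intro finite_measure_mono pred_imp_sets) auto
    ultimately show ?case using elim(1) by linarith
  qed
qed

lemma weak_conv_dim_est: "weak_conv_along (at_right 0) (\<lambda>t. distr \<nu> borel (dim_est \<nu> t)) \<rho>"
  unfolding weak_conv_along_def
proof (intro allI impI)
  fix v assume cont: "isCont (cdf \<rho>) v"
  have cdf_eq: "cdf (distr \<nu> borel (dim_est \<nu> t)) v = prob {z. dim_est \<nu> t z \<le> v}" for t
    by (rule cdf_distr) measurable
  show "((\<lambda>t. cdf (distr \<nu> borel (dim_est \<nu> t)) v) \<longlongrightarrow> cdf \<rho> v) (at_right 0)"
  proof (cases "0 < v")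
    \<comment> \<open>For \<open>v \<le> 0\<close> both sides are 0: the estimate is positive and
      the limit has no mass below \<open>a\<close>.\<close>
    case False
    have "\<forall>\<^sub>F t in at_right 0. cdf (distr \<nu> borel (dim_est \<nu> t)) v = 0"
      using eventually_at_right_unit
    proof eventually_elim
      case (elim t)
      then have "\<not> dim_est \<nu> t z \<le> v" for z
        using dim_est_pos[of t z] False by linarith
      then show ?case by (simp add: cdf_eq)
    qed
    moreover have "cdf \<rho> v = 0" using False a by (intro limit_cdf_eq_0) simp
    ultimately show ?thesis by (simp add: tendsto_eventually)
  next
    case v: True
    show ?thesis
    proof (rule tendstoI)
      fix e :: real assume e: "0 < e"
      obtain s where s: "0 < s" "\<And>y. \<bar>y - v\<bar> < s \<Longrightarrow> \<bar>cdf \<rho> y - cdf \<rho> v\<bar> < e / 2"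
        using cont e unfolding continuous_at_eps_delta dist_real_def by (meson half_gt_zero)
      \<comment> \<open>A quarter of \<open>s\<close> keeps \<open>v + 3 \<eta>\<close> inside the
        neighbourhood where the distribution function varies by less than \<open>e / 2\<close>;
        adding \<open>e / 3\<close> stays below \<open>e\<close>.\<close>
      define \<eta> where "\<eta> = s / 4"
      have \<eta>: "0 < \<eta>" using s by (simp add: \<eta>_def)
      have near: "\<bar>cdf \<rho> (v + 3 * \<eta>) - cdf \<rho> v\<bar> < e / 2" "\<bar>cdf \<rho> (v - \<eta>) - cdf \<rho> v\<bar> < e / 2"
        by (rule s(2); use s(1) in \<open>simp add: \<eta>_def\<close>)+
      have "0 < e / 3" using e by simp
      from eventually_cdf_dim_est_upper[OF v \<eta> this] eventually_cdf_dim_est_lower[OF v \<eta> this]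
      show "\<forall>\<^sub>F t in at_right 0. dist (cdf (distr \<nu> borel (dim_est \<nu> t)) v) (cdf \<rho> v) < e"
      proof eventually_elim
        case (elim t)
        then show ?case using near e unfolding cdf_eq dist_real_def by linarith
      qed
    qed
  qed
qed

lemma integrable_limit:
  assumes "F \<in> borel_measurable borel" "\<And>y. a \<le> y \<Longrightarrow> y \<le> d \<Longrightarrow> \<bar>F y :: real\<bar> \<le> B"
  shows "integrable \<rho> F"
proof (rule \<rho>.integrable_const_bound[of _ B])
  show "AE y in \<rho>. norm (F y) \<le> B" using AE_limit by eventually_elim (use assms(2) in auto)
  show "F \<in> borel_measurable \<rho>" using assms(1) by simp
qed

lemma
  shows integrable_limit_id: "integrable \<rho> (\<lambda>y. y)"
    and integrable_limit_sq: "integrable \<rho> (\<lambda>y. y\<^sup>2)"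
    and integrable_limit_inverse: "integrable \<rho> (\<lambda>y. 1 / y)"
proof -
  show "integrable \<rho> (\<lambda>y. y)" using a by (intro integrable_limit[of _ d]) auto
  show "integrable \<rho> (\<lambda>y. y\<^sup>2)" using a by (intro integrable_limit[of _ "d\<^sup>2"]) (auto intro!: power_mono)
  show "integrable \<rho> (\<lambda>y. 1 / y)" using a by (intro integrable_limit[of _ "1 / a"]) (auto simp: frac_le)
qed

lemma mvar_limit: "mvar \<rho> (\<lambda>y. y) = (\<integral>y. y\<^sup>2 \<partial>\<rho>) - (\<integral>y. y \<partial>\<rho>)\<^sup>2"
  unfolding mvar_def by (rule \<rho>.variance_eq[OF integrable_limit_id integrable_limit_sq])

lemma limit_moments_pos: "0 < (\<integral>y. y \<partial>\<rho>)" "0 < (\<integral>y. 1 / y \<partial>\<rho>)"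
proof -
  have "(\<integral>y. a \<partial>\<rho>) \<le> (\<integral>y. y \<partial>\<rho>)"
    using AE_limit by (intro integral_mono_AE integrable_limit_id) auto
  then show "0 < (\<integral>y. y \<partial>\<rho>)" using a \<rho>.prob_space by simp
  have "AE y in \<rho>. 1 / d \<le> 1 / y" using AE_limit by eventually_elim (use a in \<open>simp add: frac_le\<close>)
  then have "(\<integral>y. 1 / d \<partial>\<rho>) \<le> (\<integral>y. 1 / y \<partial>\<rho>)"
    by (intro integral_mono_AE integrable_limit_inverse) auto
  moreover have "0 < 1 / d" using d_ge_1 by simp
  moreover have "(\<integral>y. 1 / d \<partial>\<rho>) = 1 / d" using \<rho>.prob_space by simp
  ultimately show "0 < (\<integral>y. 1 / y \<partial>\<rho>)" by linarith
qed

lemma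
  shows entropy_level_tendsto: "H \<longlonglongrightarrow> (\<integral>y. y \<partial>\<rho>)"
    and mvar_info_rate_tendsto: "(\<lambda>k. mvar \<nu> (X k)) \<longlonglongrightarrow> mvar \<rho> (\<lambda>y. y)"
proof -
  note lims = clipped_moments(1,2)[OF integral_info_rate(1) info_rate_nonneg info_rate_measurable \<rho> wc AE_limit
      info_rate_excess_tendsto_0[of 1, simplified] info_rate_excess_tendsto_0[of 2, simplified]]
  show "H \<longlonglongrightarrow> (\<integral>y. y \<partial>\<rho>)"
    using lims(1) by (simp add: entropy_level_eq[abs_def])
  show "(\<lambda>k. mvar \<nu> (X k)) \<longlonglongrightarrow> mvar \<rho> (\<lambda>y. y)"
    unfolding mvar_info_rate mvar_limit by (intro tendsto_intros lims)
qed

text \<open>\<open>clipped_moments\<close> is sequential, so the one-sided limit is taken along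
  arbitrary sequences in \<open>(0, 1)\<close> that tend to 0. Unlike the information rates, the
  estimates have a positive lower bound at every point, which admits the reciprocal as a test
  function.\<close>

lemma dim_est_moments_tendsto:
  shows "(h \<longlongrightarrow> (\<integral>y. y \<partial>\<rho>)) (at_right 0)"
    and "((\<lambda>t. \<integral>x. (dim_est \<nu> t x)\<^sup>2 \<partial>\<nu>) \<longlongrightarrow> (\<integral>y. y\<^sup>2 \<partial>\<rho>)) (at_right 0)"
    and "((\<lambda>t. \<integral>x. inverse (dim_est \<nu> t x) \<partial>\<nu>) \<longlongrightarrow> (\<integral>y. 1 / y \<partial>\<rho>)) (at_right 0)"
proof -
  have "(\<lambda>n. h (S n)) \<longlonglongrightarrow> (\<integral>y. y \<partial>\<rho>) \<and>
      (\<lambda>n. \<integral>x. (dim_est \<nu> (S n) x)\<^sup>2 \<partial>\<nu>) \<longlonglongrightarrow> (\<integral>y. y\<^sup>2 \<partial>\<rho>) \<and>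
      (\<lambda>n. \<integral>x. inverse (dim_est \<nu> (S n) x) \<partial>\<nu>) \<longlonglongrightarrow> (\<integral>y. 1 / y \<partial>\<rho>)"
    if S: "\<And>n. 0 < S n" "\<And>n. S n < 1" "S \<longlonglongrightarrow> 0" for S
  proof -
    have lim: "filterlim S (at_right 0) sequentially"
      using S by (intro tendsto_imp_filterlim_at_right) auto
    have wcS: "weak_conv_m (\<lambda>n. distr \<nu> borel (dim_est \<nu> (S n))) \<rho>"
      unfolding weak_conv_along_sequentially[symmetric]
      using weak_conv_dim_est filterlim_compose[OF _ lim] unfolding weak_conv_along_def by blast
    have u: "(\<lambda>n. \<integral>x. (max (dim_est \<nu> (S n) x - d) 0) ^ m \<partial>\<nu>) \<longlonglongrightarrow> 0" if "1 \<le> m" for m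
      using filterlim_compose[OF excess_tendsto_0[OF that] lim] by (simp add: excess_def)
    have "\<forall>\<^sub>F t in at_right 0. a / 2 < rate_bound a C t"
      by (rule order_tendstoD(1)[OF rate_bound_tendsto]) (use a in simp)
    from eventually_compose_filterlim[OF this lim]
    have low: "\<forall>\<^sub>F n in sequentially. \<forall>x. a / 2 \<le> dim_est \<nu> (S n) x"
    proof eventually_elim
      case (elim n)
      then show ?case using rate_bound_le_dim_est[OF S(1,2), of n] by (meson less_imp_le order_trans)
    qed
    note lims = clipped_moments[OF integrable_dim_est[OF S(1,2)] less_imp_le[OF dim_est_pos[OF S(1,2)]]
        dim_est_measurable \<rho> wcS AE_limit u[of 1, simplified] u[of 2, simplified]]
    show ?thesis using lims(1,2) lims(3)[OF low] by (simp add: h_est_def)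
  qed
  note seq = this
  show "(h \<longlongrightarrow> (\<integral>y. y \<partial>\<rho>)) (at_right 0)"
    "((\<lambda>t. \<integral>x. (dim_est \<nu> t x)\<^sup>2 \<partial>\<nu>) \<longlongrightarrow> (\<integral>y. y\<^sup>2 \<partial>\<rho>)) (at_right 0)"
    "((\<lambda>t. \<integral>x. inverse (dim_est \<nu> t x) \<partial>\<nu>) \<longlongrightarrow> (\<integral>y. 1 / y \<partial>\<rho>)) (at_right 0)"
    by (rule tendsto_at_right_sequentially[of 0 1]; use seq in simp)+
qed

lemma D_est_tendsto: "(D \<longlongrightarrow> inverse (\<integral>y. 1 / y \<partial>\<rho>)) (at_right 0)"
proof -
  have "((\<lambda>t. inverse (\<integral>x. inverse (dim_est \<nu> t x) \<partial>\<nu>)) \<longlongrightarrow> inverse (\<integral>y. 1 / y \<partial>\<rho>)) (at_right 0)"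
    using limit_moments_pos by (intro tendsto_inverse dim_est_moments_tendsto) auto
  then show ?thesis
    by (rule Lim_transform_eventually)
       (use eventually_at_right_unit in \<open>eventually_elim, simp add: integral_inverse_dim_est\<close>)
qed

lemma V_est_tendsto: "(V \<longlongrightarrow> mvar \<rho> (\<lambda>y. y)) (at_right 0)"
proof -
  have "((\<lambda>t. (\<integral>x. (dim_est \<nu> t x)\<^sup>2 \<partial>\<nu>) - (h t)\<^sup>2) \<longlongrightarrow> mvar \<rho> (\<lambda>y. y)) (at_right 0)"
    unfolding mvar_limit by (intro tendsto_intros dim_est_moments_tendsto)
  then show ?thesis
  proof (rule Lim_transform_eventually)
    show "\<forall>\<^sub>F t in at_right 0. (\<integral>x. (dim_est \<nu> t x)\<^sup>2 \<partial>\<nu>) - (h t)\<^sup>2 = V t"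
      using eventually_at_right_unit
    proof eventually_elim
      case (elim t)
      then show ?case
        unfolding V_est_def mvar_def h_est_def
        using integrable_dim_est[of t "\<lambda>y. y"] integrable_dim_est[of t "\<lambda>y. y\<^sup>2"]
        by (subst variance_eq) auto
    qed
  qed
qed

lemma h_lower_upper_limit:
  "h_lower \<nu> = ereal (\<integral>y. y \<partial>\<rho>)" "h_upper \<nu> = ereal (\<integral>y. y \<partial>\<rho>)" "h_dim \<nu> = (\<integral>y. y \<partial>\<rho>)"
proof -
  have "(\<lambda>k. ereal (H k)) \<longlonglongrightarrow> ereal (\<integral>y. y \<partial>\<rho>)" using entropy_level_tendsto by simp
  then show 1: "h_lower \<nu> = ereal (\<integral>y. y \<partial>\<rho>)" "h_upper \<nu> = ereal (\<integral>y. y \<partial>\<rho>)"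
    unfolding h_lower_def h_upper_def by (auto intro!: lim_imp_Liminf lim_imp_Limsup)
  then show "h_dim \<nu> = (\<integral>y. y \<partial>\<rho>)" unfolding h_dim_def by (intro the_equality) auto
qed

lemma D0_lower_upper_limit:
  "D0_lower \<nu> = ereal (inverse (\<integral>y. 1 / y \<partial>\<rho>))" "D0_upper \<nu> = ereal (inverse (\<integral>y. 1 / y \<partial>\<rho>))"
  "D0_dim \<nu> = inverse (\<integral>y. 1 / y \<partial>\<rho>)"
proof -
  have "((\<lambda>t. ereal (D t)) \<longlongrightarrow> ereal (inverse (\<integral>y. 1 / y \<partial>\<rho>))) (at_right 0)" using D_est_tendsto by simp
  then show 1: "D0_lower \<nu> = ereal (inverse (\<integral>y. 1 / y \<partial>\<rho>))" "D0_upper \<nu> = ereal (inverse (\<integral>y. 1 / y \<partial>\<rho>))"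
    unfolding D0_lower_eq D0_upper_eq by (auto intro!: lim_imp_Liminf lim_imp_Limsup)
  then show "D0_dim \<nu> = inverse (\<integral>y. 1 / y \<partial>\<rho>)" unfolding D0_dim_def by (intro the_equality) auto
qed

lemma limit_dims:
  "h_lower \<nu> = ereal (h_dim \<nu>)" "h_upper \<nu> = ereal (h_dim \<nu>)" "(\<integral>y. y \<partial>\<rho>) = h_dim \<nu>"
  "D0_lower \<nu> = ereal (D0_dim \<nu>)" "D0_upper \<nu> = ereal (D0_dim \<nu>)" "inverse (\<integral>y. 1 / y \<partial>\<rho>) = D0_dim \<nu>"
  by (simp_all add: h_lower_upper_limit D0_lower_upper_limit)

lemma V_upper_limit: "V_upper \<nu> = ereal (mvar \<rho> (\<lambda>y. y))"
  unfolding V_upper_def using V_est_tendsto by (intro lim_imp_Limsup) auto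

lemma beta_dd1_tendsto: "(\<lambda>k. beta_dd1 \<nu> k / (real k * ln 2)) \<longlonglongrightarrow> mvar \<rho> (\<lambda>y. y)"
  using mvar_info_rate_tendsto
  by (rule Lim_transform_eventually) (auto intro!: eventually_sequentiallyI[of 1] simp: beta_dd1_eq)

lemma V_upper_eq_0_iff_beta: "V_upper \<nu> = 0 \<longleftrightarrow> beta_dd1 \<nu> \<in> o(\<lambda>k. real k)"
proof -
  have "V_upper \<nu> = 0 \<longleftrightarrow> mvar \<rho> (\<lambda>y. y) = 0" by (simp add: V_upper_limit)
  also have "\<dots> \<longleftrightarrow> (\<lambda>k. mvar \<nu> (X k)) \<longlonglongrightarrow> 0"
    using mvar_info_rate_tendsto LIMSEQ_unique[OF mvar_info_rate_tendsto, of 0] by metis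
  finally show ?thesis by (simp only: beta_dd1_smallo_iff)
qed

text \<open>The gap \<open>h t - D t\<close> converges to \<open>h_dim \<nu> - D0_dim \<nu>\<close>,
  so its vanishing in the limit is an equality of dimensions.\<close>

lemma V_upper_eq_0_iff_dims: "V_upper \<nu> = 0 \<longleftrightarrow> h_dim \<nu> = D0_dim \<nu>"
proof -
  have lim: "((\<lambda>t. h t - D t) \<longlongrightarrow> h_dim \<nu> - D0_dim \<nu>) (at_right 0)"
    unfolding h_lower_upper_limit D0_lower_upper_limit
    by (intro tendsto_diff dim_est_moments_tendsto D_est_tendsto)
  show ?thesis
    unfolding V_upper_eq_0_iff using lim tendsto_unique[OF _ lim, of 0] by auto
qed

text \<open>The expansion used for \<open>dim_est\<close>, now under the limit law; it holds almost
  everywhere because \<open>y \<ge> a > 0\<close> does.\<close>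

lemma integral_limit_sq_dev_over:
  "(\<integral>y. (y - c)\<^sup>2 / y \<partial>\<rho>) = (\<integral>y. y \<partial>\<rho>) - 2 * c + c\<^sup>2 * (\<integral>y. 1 / y \<partial>\<rho>)"
proof -
  have "AE y in \<rho>. (y - c)\<^sup>2 / y = (y - 2 * c) + c\<^sup>2 * (1 / y)"
    using AE_limit by eventually_elim (use a in \<open>simp add: field_simps power2_eq_square\<close>)
  then have "(\<integral>y. (y - c)\<^sup>2 / y \<partial>\<rho>) = (\<integral>y. (y - 2 * c) + c\<^sup>2 * (1 / y) \<partial>\<rho>)"
    by (intro integral_cong_AE) auto
  also have "\<dots> = (\<integral>y. y - 2 * c \<partial>\<rho>) + (\<integral>y. c\<^sup>2 * (1 / y) \<partial>\<rho>)"
    using integrable_limit_id integrable_limit_inverse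
    by (intro Bochner_Integration.integral_add integrable_mult_right Bochner_Integration.integrable_diff) auto
  also have "\<dots> = (\<integral>y. y \<partial>\<rho>) - 2 * c + c\<^sup>2 * (\<integral>y. 1 / y \<partial>\<rho>)"
    unfolding integral_mult_right_zero using integrable_limit_id \<rho>.prob_space by simp
  finally show ?thesis .
qed

lemma h_dim_minus_D0_dim:
  "h_dim \<nu> - D0_dim \<nu> = (\<integral>y. (y - D0_dim \<nu>)\<^sup>2 / y \<partial>\<rho>)"
  "h_dim \<nu> - D0_dim \<nu> = D0_dim \<nu> / h_dim \<nu> * (\<integral>y. (y - h_dim \<nu>)\<^sup>2 / y \<partial>\<rho>)"
  unfolding integral_limit_sq_dev_over h_lower_upper_limit D0_lower_upper_limit
  using limit_moments_pos by (simp_all add: field_simps power2_eq_square)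

end

end

theorem proposition2p11:
  fixes \<nu> :: "(real ^ 'n) measure" and a C :: real and d :: nat
  assumes dim: "d = CARD('n)"
    and borel: "sets \<nu> = sets borel"
    and prob: "prob_space \<nu>"
    and supp: "msupport \<nu> \<subseteq> interior (cbox 0 1)"
    and a: "a > 0" and C: "C \<ge> 1"
    and frostman: "\<And>k Q. Q \<in> dyadic_cubes k \<Longrightarrow> measure \<nu> Q \<le> C * 2 powr (- a * real k)"
  shows
    "(rate_bound a C \<longlongrightarrow> a) (at_right 0)
     \<and>
     \<comment> \<open>(1)\<close>
     (\<forall>t\<in>{0<..<1}. \<forall>x\<in>good_points \<nu>.
        rate_bound a C t \<le> dim_est \<nu> t x \<and> dim_est \<nu> t x \<le> log 2 (1 / t)) \<and>
     (\<forall>t\<in>{0<..<1}. \<forall>v>real d.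
        measure \<nu> {x. dim_est \<nu> t x \<ge> v} \<le> t powr (1 - real d / v)) \<and>
     (\<forall>n\<ge>1. ((\<lambda>t. \<integral>x. (max (dim_est \<nu> t x - real d) 0) ^ n \<partial>\<nu>) \<longlongrightarrow> 0) (at_right 0)) \<and>
     (\<forall>n. \<exists>B. \<forall>t. 0 < t \<and> t \<le> 1 / 2 \<longrightarrow>
        integrable \<nu> (\<lambda>x. dim_est \<nu> t x ^ n) \<and> (\<integral>x. dim_est \<nu> t x ^ n \<partial>\<nu>) \<le> B) \<and>
     (\<forall>t\<in>{0<..<1}.
        D_est \<nu> t = inverse (\<integral>x. inverse (dim_est \<nu> t x) \<partial>\<nu>) \<and>
        D_est \<nu> t \<le> h_est \<nu> t \<and>
        rate_bound a C t \<le> D_est \<nu> t) \<and>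
     (\<exists>e. (e \<longlongrightarrow> 0) (at_right 0) \<and> (\<forall>t\<in>{0<..<1}. h_est \<nu> t \<le> real d + e t))
     \<and>
     \<comment> \<open>(2)\<close>
     (\<forall>t\<in>{0<..<1}.
        h_est \<nu> t - D_est \<nu> t = (\<integral>x. (dim_est \<nu> t x - D_est \<nu> t)\<^sup>2 / dim_est \<nu> t x \<partial>\<nu>) \<and>
        h_est \<nu> t - D_est \<nu> t =
          D_est \<nu> t / h_est \<nu> t * (\<integral>x. (dim_est \<nu> t x - h_est \<nu> t)\<^sup>2 / dim_est \<nu> t x \<partial>\<nu>) \<and>
        D_est \<nu> t / h_est \<nu> t * (V_est \<nu> t / real d - eps_est \<nu> t) \<le> h_est \<nu> t - D_est \<nu> t \<and>
        h_est \<nu> t - D_est \<nu> t \<le> D_est \<nu> t / h_est \<nu> t * (V_est \<nu> t / rate_bound a C t)) \<and>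
     (eps_est \<nu> \<longlongrightarrow> 0) (at_right 0) \<and>
     (V_upper \<nu> = 0 \<longleftrightarrow> ((\<lambda>t. h_est \<nu> t - D_est \<nu> t) \<longlongrightarrow> 0) (at_right 0))
     \<and>
     \<comment> \<open>(3)\<close>
     (V_upper \<nu> = 0 \<longrightarrow>
        beta_dd1 \<nu> \<in> o(\<lambda>k. real k) \<and>
        h_lower \<nu> = Liminf (at_right 0) (\<lambda>t. ereal (h_est \<nu> t)) \<and>
        Liminf (at_right 0) (\<lambda>t. ereal (h_est \<nu> t)) = D0_lower \<nu> \<and>
        h_upper \<nu> = Limsup (at_right 0) (\<lambda>t. ereal (h_est \<nu> t)) \<and>
        Limsup (at_right 0) (\<lambda>t. ereal (h_est \<nu> t)) = D0_upper \<nu>)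
     \<and>
     \<comment> \<open>(4)\<close>
     (\<forall>\<rho>. real_distribution \<rho> \<longrightarrow>
        weak_conv_m (\<lambda>k. distr \<nu> borel (info_rate \<nu> k)) \<rho> \<longrightarrow>
        weak_conv_along (at_right 0) (\<lambda>t. distr \<nu> borel (dim_est \<nu> t)) \<rho> \<and>
        integrable \<rho> (\<lambda>y. y) \<and> integrable \<rho> (\<lambda>y. y\<^sup>2) \<and> integrable \<rho> (\<lambda>y. 1 / y) \<and>
        (h_est \<nu> \<longlongrightarrow> (\<integral>y. y \<partial>\<rho>)) (at_right 0) \<and>
        h_lower \<nu> = ereal (h_dim \<nu>) \<and> h_upper \<nu> = ereal (h_dim \<nu>) \<and>
        (\<integral>y. y \<partial>\<rho>) = h_dim \<nu> \<and>
        (D_est \<nu> \<longlongrightarrow> inverse (\<integral>y. 1 / y \<partial>\<rho>)) (at_right 0) \<and>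
        D0_lower \<nu> = ereal (D0_dim \<nu>) \<and> D0_upper \<nu> = ereal (D0_dim \<nu>) \<and>
        inverse (\<integral>y. 1 / y \<partial>\<rho>) = D0_dim \<nu> \<and>
        (V_est \<nu> \<longlongrightarrow> mvar \<rho> (\<lambda>y. y)) (at_right 0) \<and>
        V_upper \<nu> = ereal (mvar \<rho> (\<lambda>y. y)) \<and>
        (\<lambda>k. beta_dd1 \<nu> k / (real k * ln 2)) \<longlonglongrightarrow> mvar \<rho> (\<lambda>y. y) \<and>
        (V_upper \<nu> = 0 \<longleftrightarrow> beta_dd1 \<nu> \<in> o(\<lambda>k. real k)) \<and>
        (V_upper \<nu> = 0 \<longleftrightarrow> h_dim \<nu> = D0_dim \<nu>) \<and>
        h_dim \<nu> - D0_dim \<nu> = (\<integral>y. (y - D0_dim \<nu>)\<^sup>2 / y \<partial>\<rho>) \<and>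
        h_dim \<nu> - D0_dim \<nu> = D0_dim \<nu> / h_dim \<nu> * (\<integral>y. (y - h_dim \<nu>)\<^sup>2 / y \<partial>\<rho>))"
proof -
  interpret prob_space \<nu> by (rule prob)
  interpret frostman_measure \<nu> a C "real d"
    using borel supp a C frostman dim by unfold_locales auto
  \<comment> \<open>The error term is the mean overshoot \<open>excess 1\<close> of the estimate
    beyond \<open>d\<close>.\<close>
  have ex_e: "\<exists>e. (e \<longlongrightarrow> 0) (at_right 0) \<and> (\<forall>t\<in>{0<..<1}. h_est \<nu> t \<le> real d + e t)"
    using excess_tendsto_0[of 1] h_est_le by (intro exI[of _ "excess 1"]) auto
  have beta: "V_upper \<nu> = 0 \<Longrightarrow> beta_dd1 \<nu> \<in> o(\<lambda>k. real k)"
    unfolding V_upper_eq_0_iff_V_est beta_dd1_smallo_iff by (rule mvar_info_rate_tendsto_0)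
  have D_eq: "D_est \<nu> t = inverse (\<integral>x. inverse (dim_est \<nu> t x) \<partial>\<nu>)" for t
    by (simp add: integral_inverse_dim_est)
  note parts_1_2 = rate_bound_tendsto rate_bound_le_dim_est dim_est_le prob_dim_est_ge
    excess_tendsto_0[unfolded excess_def] ex_moment_bound D_eq D_est_le_h_est rate_bound_le_D_est ex_e
    h_minus_D h_minus_D_lower h_minus_D_upper eps_est_tendsto_0 V_upper_eq_0_iff
  note part_3 = beta h_lower_upper_eq[folded V_upper_eq_0_iff_V_est]
    Liminf_Limsup_h_est_eq_D0[folded V_upper_eq_0_iff]
  note part_4 = weak_conv_dim_est integrable_limit_id integrable_limit_sq integrable_limit_inverse
    dim_est_moments_tendsto(1) limit_dims D_est_tendsto V_est_tendsto V_upper_limit beta_dd1_tendsto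
    V_upper_eq_0_iff_beta V_upper_eq_0_iff_dims h_dim_minus_D0_dim
  show ?thesis
    by (intro conjI ballI allI impI; rule parts_1_2 part_3 part_4; (assumption | simp))
qed

end
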